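(* Let $\mathcal{G}$ be a compact, connected metric graph obtained from two copies of another connected metric graph $\widehat{\mathcal{G}}$ by pairwise gluing of finitely many pairs of the duplicated vertices (i.e. for finitely many vertices $\mathsf{v}$ of $\widehat{\mathcal{G}}$, the two copies of $\mathsf{v}$ are identified with each other). If $\mathcal{G}$ has girth $s$, then the second eigenvalue (spectral gap) of the Laplacian on $\mathcal{G}$ with standard conditions at all vertices satisfies $$\lambda_2^{\mathrm{N}}(\mathcal{G}) \leq \frac{4\pi^2}{s^2},$$ where the right-hand side is read as $+\infty$ if $s=0$. Equality is attained if $\mathcal{G}$ is an equilateral pumpkin graph.
   Context: A compact metric graph $\mathcal{G}=(\mathsf{V},\mathsf{E})$ has finitely many edges, each edge $\mathsf{e}$ being identified with an interval $(0,\ell_{\mathsf{e}})$ of finite length $\ell_{\mathsf{e}}>0$; loops and multiple edges are allowed. Any interior point of an edge may be declared to be a vertex of degree two with standard conditions (a "dummy" vertex) without changing the Laplacian; in particular such points are allowed as vertices of $\widehat{\mathcal{G}}$. The Laplacian with standard vertex conditions acts as $-\frac{d^2}{dx^2}$ on functions that are in $H^2(0,\ell_{\mathsf{e}})$ on each edge, are continuous at every vertex, and whose normal derivatives sum to zero at every vertex. It is self-adjoint with discrete spectrum; on a connected graph its eigenvalues, counted with multiplicity, are $0=\lambda_1^{\mathrm{N}}<\lambda_2^{\mathrm{N}}\leq\dots$. A cycle is (the image of) a continuous map $\gamma:[0,1]\to\mathcal{G}$ with $\gamma(0)=\gamma(1)$ and $\gamma$ injective on $[0,1)$. The girth $s$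 of $\mathcal{G}$ (no Dirichlet vertices present) is the minimal total length of a cycle in $\mathcal{G}$, and is defined to be $0$ if $\mathcal{G}$ is a tree. A pumpkin (watermelon) graph consists of some number $m\geq 2$ of parallel edges between two vertices; it is equilateral if all its edges have the same length. *)

theory Defs
  imports "HOL-Analysis.Analysis" "HOL-Library.Function_Algebras"
begin

section \<open>Compact metric graphs\<close>

text \<open>The edge \<open>e\<close> is the interval from \<open>0\<close> (at \<open>src e\<close>) to \<open>len e\<close> (at \<open>tgt e\<close>). The orientation
  is only a choice of coordinate. Loops (\<open>src e = tgt e\<close>) and parallel edges are allowed.\<close>

record ('v, 'e) mgraph =
  verts :: "'v set"
  edges :: "'e set"
  src :: "'e \<Rightarrow> 'v"
  tgt :: "'e \<Rightarrow> 'v"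
  len :: "'e \<Rightarrow> real"

definition compact_metric_graph :: "('v, 'e) mgraph \<Rightarrow> bool" where
  "compact_metric_graph G \<longleftrightarrow>
     finite (verts G) \<and> verts G \<noteq> {} \<and> finite (edges G) \<and>
     (\<forall>e\<in>edges G. src G e \<in> verts G \<and> tgt G e \<in> verts G \<and> 0 < len G e)"

datatype ('v, 'e) gpoint = Vertex 'v | Inner 'e real

definition points :: "('v, 'e) mgraph \<Rightarrow> ('v, 'e) gpoint set" where
  "points G = Vertex ` verts G \<union> {Inner e x | e x. e \<in> edges G \<and> 0 < x \<and> x < len G e}"

text \<open>The parametrisation of the closed edge \<open>e\<close> by \<open>{0..len G e}\<close>.\<close>

definition edge_pt :: "('v, 'e) mgraph \<Rightarrow> 'e \<Rightarrow> real \<Rightarrow> ('v, 'e) gpoint" where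
  "edge_pt G e x =
     (if x = 0 then Vertex (src G e) else if x = len G e then Vertex (tgt G e) else Inner e x)"

text \<open>The quotient topology obtained by gluing the closed edges at the vertices.\<close>

definition graph_open :: "('v, 'e) mgraph \<Rightarrow> ('v, 'e) gpoint set \<Rightarrow> bool" where
  "graph_open G U \<longleftrightarrow> U \<subseteq> points G \<and>
     (\<forall>e\<in>edges G. openin (top_of_set {0..len G e}) {x \<in> {0..len G e}. edge_pt G e x \<in> U})"

definition graph_topology :: "('v, 'e) mgraph \<Rightarrow> ('v, 'e) gpoint topology" where
  "graph_topology G = topology (graph_open G)"

lemma istopology_graph_open: "istopology (graph_open G)"
  unfolding istopology_def
proof (intro conjI allI impI)
  fix S T assume S: "graph_open G S" and T: "graph_open G T"
  have "{x \<in> {0..len G e}. edge_pt G e x \<in> S \<inter> T} =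
      {x \<in> {0..len G e}. edge_pt G e x \<in> S} \<inter> {x \<in> {0..len G e}. edge_pt G e x \<in> T}" for e
    by blast
  then show "graph_open G (S \<inter> T)"
    using S T unfolding graph_open_def by (simp add: openin_Int le_infI1)
next
  fix K assume K: "\<forall>U\<in>K. graph_open G U"
  have "openin (top_of_set {0..len G e}) {x \<in> {0..len G e}. edge_pt G e x \<in> \<Union>K}"
    if "e \<in> edges G" for e
  proof -
    have "{x \<in> {0..len G e}. edge_pt G e x \<in> \<Union>K} =
        \<Union>((\<lambda>U. {x \<in> {0..len G e}. edge_pt G e x \<in> U}) ` K)"
      by blast
    moreover have "openin (top_of_set {0..len G e}) \<dots>"
      using K that unfolding graph_open_def by (intro openin_Union) blast
    ultimately show ?thesis by simp
  qed
  moreover have "\<Union>K \<subseteq> points G"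
    using K unfolding graph_open_def by blast
  ultimately show "graph_open G (\<Union>K)"
    unfolding graph_open_def by blast
qed

lemma openin_graph_topology: "openin (graph_topology G) U \<longleftrightarrow> graph_open G U"
  unfolding graph_topology_def by (simp add: istopology_graph_open topology_inverse')

definition connected_graph :: "('v, 'e) mgraph \<Rightarrow> bool" where
  "connected_graph G \<longleftrightarrow> connected_space (graph_topology G)"


section \<open>Girth\<close>

definition is_cycle :: "('v, 'e) mgraph \<Rightarrow> ('v, 'e) gpoint set \<Rightarrow> bool" where
  "is_cycle G C \<longleftrightarrow> (\<exists>\<gamma>. continuous_map (top_of_set {0..1::real}) (graph_topology G) \<gamma> \<and>
     \<gamma> 0 = \<gamma> 1 \<and> inj_on \<gamma> {0..<1} \<and> C = \<gamma> ` {0..1})"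

definition total_length :: "('v, 'e) mgraph \<Rightarrow> ('v, 'e) gpoint set \<Rightarrow> real" where
  "total_length G C =
     (\<Sum>e\<in>edges G. measure lebesgue {x. 0 < x \<and> x < len G e \<and> Inner e x \<in> C})"

text \<open>A connected graph without cycles is a tree, and then the girth is \<open>0\<close>.\<close>

definition girth :: "('v, 'e) mgraph \<Rightarrow> real" where
  "girth G = (if \<exists>C. is_cycle G C then INF C\<in>{C. is_cycle G C}. total_length G C else 0)"


section \<open>The Laplacian with standard vertex conditions\<close>

text \<open>One-sided at \<open>0\<close> and at \<open>l\<close>.\<close>

definition edge_deriv :: "real \<Rightarrow> (real \<Rightarrow> real) \<Rightarrow> real \<Rightarrow> real" where
  "edge_deriv l u x = vector_derivative u (at x within {0..l})"

text \<open>\<open>H2_deriv2 l u g\<close>: \<open>u\<close> is in the Sobolev space \<open>H\<^sup>2(0,l)\<close> and \<open>u'' = g\<close> almost everywhere, i.e.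
  \<open>u'\<close> is absolutely continuous with square integrable derivative \<open>g\<close>. Elements of \<open>H\<^sup>2(0,l)\<close> are
  represented by their continuously differentiable version on \<open>{0..l}\<close>, extended by \<open>0\<close>, so that
  distinct representatives are distinct elements of \<open>L\<^sup>2\<close>.\<close>

definition H2_deriv2 :: "real \<Rightarrow> (real \<Rightarrow> real) \<Rightarrow> (real \<Rightarrow> real) \<Rightarrow> bool" where
  "H2_deriv2 l u g \<longleftrightarrow>
     (\<forall>x. x \<notin> {0..l} \<longrightarrow> u x = 0) \<and>
     (\<forall>x\<in>{0..l}. u differentiable (at x within {0..l})) \<and>
     set_borel_measurable lebesgue {0..l} g \<and>
     set_integrable lebesgue {0..l} (\<lambda>x. (g x)\<^sup>2) \<and>
     (\<forall>x\<in>{0..l}. edge_deriv l u x = edge_deriv l u 0 + (LINT t:{0..x}|lebesgue. g t))"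

text \<open>A function on the graph is a family of functions on the edges. The last condition is that the
  derivatives pointing into the edges sum to zero at each vertex; a loop contributes both its ends.\<close>

definition standard_domain :: "('v, 'e) mgraph \<Rightarrow> ('e \<Rightarrow> real \<Rightarrow> real) set" where
  "standard_domain G = {f.
     (\<forall>e. e \<notin> edges G \<longrightarrow> f e = (\<lambda>_. 0)) \<and>
     (\<forall>e\<in>edges G. \<exists>g. H2_deriv2 (len G e) (f e) g) \<and>
     (\<exists>\<phi>. \<forall>e\<in>edges G. f e 0 = \<phi> (src G e) \<and> f e (len G e) = \<phi> (tgt G e)) \<and>
     (\<forall>v\<in>verts G.
        (\<Sum>e | e \<in> edges G \<and> src G e = v. edge_deriv (len G e) (f e) 0) +
        (\<Sum>e | e \<in> edges G \<and> tgt G e = v. - edge_deriv (len G e) (f e) (len G e)) = 0)}"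

text \<open>\<open>f\<close> is in the domain and \<open>- f'' = h\<close>.\<close>

definition has_laplacian ::
    "('v, 'e) mgraph \<Rightarrow> ('e \<Rightarrow> real \<Rightarrow> real) \<Rightarrow> ('e \<Rightarrow> real \<Rightarrow> real) \<Rightarrow> bool" where
  "has_laplacian G f h \<longleftrightarrow> f \<in> standard_domain G \<and>
     (\<forall>e\<in>edges G. H2_deriv2 (len G e) (f e) (\<lambda>x. - h e x))"

definition graph_scale :: "real \<Rightarrow> ('e \<Rightarrow> real \<Rightarrow> real) \<Rightarrow> ('e \<Rightarrow> real \<Rightarrow> real)" where
  "graph_scale c f = (\<lambda>e x. c * f e x)"

lemma vector_space_graph_scale: "vector_space graph_scale"
  by unfold_locales (auto simp: graph_scale_def fun_eq_iff algebra_simps)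

definition eigenspace :: "('v, 'e) mgraph \<Rightarrow> real \<Rightarrow> ('e \<Rightarrow> real \<Rightarrow> real) set" where
  "eigenspace G \<mu> = {f. has_laplacian G f (graph_scale \<mu> f)}"

definition multiplicity_of :: "('v, 'e) mgraph \<Rightarrow> real \<Rightarrow> nat" where
  "multiplicity_of G \<mu> = vector_space.dim graph_scale (eigenspace G \<mu>)"

text \<open>The \<open>k\<close>-th eigenvalue (\<open>k \<ge> 1\<close>) in increasing order counted with multiplicity: the least \<open>c\<close>
  such that at least \<open>k\<close> eigenvalues, counted with multiplicity, lie in \<open>{..c}\<close>. Real numbers that
  are not eigenvalues have multiplicity \<open>0\<close>.\<close>

definition eigenvalue :: "('v, 'e) mgraph \<Rightarrow> nat \<Rightarrow> real" where
  "eigenvalue G k =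
     Inf {c. \<exists>M. finite M \<and> M \<subseteq> {..c} \<and> k \<le> (\<Sum>\<mu>\<in>M. multiplicity_of G \<mu>)}"


section \<open>Dummy vertices, doubling, pumpkins\<close>

text \<open>\<open>K\<close> arises from \<open>G\<close> by declaring finitely many interior points of edges to be vertices, up to
  relabelling and reorienting edges: there is a bijection of the points that maps each edge of \<open>K\<close>
  isometrically onto a segment of an edge of \<open>G\<close>. Hence every vertex of \<open>G\<close> comes from a vertex of
  \<open>K\<close>, and the remaining vertices of \<open>K\<close> have degree two.\<close>

definition dummy_refinement :: "('v, 'e) mgraph \<Rightarrow> ('w, 'f) mgraph \<Rightarrow> bool" where
  "dummy_refinement G K \<longleftrightarrow> compact_metric_graph K \<and>
     (\<exists>\<phi>. bij_betw \<phi> (points K) (points G) \<and>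
       (\<forall>e'\<in>edges K. \<exists>e\<in>edges G. \<exists>a \<sigma>. \<sigma> \<in> {1, -1} \<and>
         (\<forall>x\<in>{0..len K e'}. a + \<sigma> * x \<in> {0..len G e} \<and>
            \<phi> (edge_pt K e' x) = edge_pt G e (a + \<sigma> * x))))"

text \<open>The same metric graph up to dummy vertices: there is a common refinement. As graphs are finite,
  it can be labelled by natural numbers.\<close>

definition same_metric_graph :: "('v, 'e) mgraph \<Rightarrow> ('w, 'f) mgraph \<Rightarrow> bool" where
  "same_metric_graph G H \<longleftrightarrow>
     (\<exists>K :: (nat, nat) mgraph. dummy_refinement G K \<and> dummy_refinement H K)"

text \<open>Two copies of \<open>H\<close>, tagged by booleans, with the two copies of each vertex in \<open>W\<close> identified.\<close>

definition glue :: "'v set \<Rightarrow> 'v \<Rightarrow> bool \<Rightarrow> 'v \<times> bool" where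
  "glue W v b = (v, if v \<in> W then False else b)"

definition double_graph :: "('v, 'e) mgraph \<Rightarrow> 'v set \<Rightarrow> ('v \<times> bool, 'e \<times> bool) mgraph" where
  "double_graph H W = \<lparr>
     verts = {glue W v b | v b. v \<in> verts H},
     edges = edges H \<times> UNIV,
     src = (\<lambda>(e, b). glue W (src H e) b),
     tgt = (\<lambda>(e, b). glue W (tgt H e) b),
     len = (\<lambda>(e, b). len H e)\<rparr>"

definition equilateral_pumpkin :: "nat \<Rightarrow> real \<Rightarrow> (bool, nat) mgraph" where
  "equilateral_pumpkin m l = \<lparr>
     verts = {False, True},
     edges = {..<m},
     src = (\<lambda>_. False),
     tgt = (\<lambda>_. True),
     len = (\<lambda>_. l)\<rparr>"

end

theory Submission
  imports Defs
begin

text \<open>Let the graph be glued from two copies of \<open>H\<close> along the vertex set \<open>W\<close>. Exchanging the copies is a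
symmetry, and an antisymmetric function is a function on \<open>H\<close> that vanishes on \<open>W\<close>, with opposite
signs on the two copies. An antisymmetric eigenfunction is never a multiple of the constant, so it
bounds the second eigenvalue. Let \<open>s\<close> be the girth and \<open>k = 2 \<pi> / s\<close>. It remains to find
an eigenvalue at most \<open>k\<^sup>2\<close> for functions on \<open>H\<close> with zero values on \<open>W\<close>.

The test function is \<open>sin (k d)\<close>, where \<open>d\<close> is the distance to \<open>W\<close>, cut off at \<open>s / 4\<close>, where the
sine has its maximum. On an edge that belongs to a shortest path to \<open>W\<close> it solves \<open>- f'' = k\<^sup>2 f\<close>. The
girth says that shortest paths meet only at distance at least \<open>s / 4\<close>: two shortest paths that meet
earlier, taken in both copies, contain a cycle shorter than \<open>s\<close>. So below the
cut-off every vertex has exactly one edge towards \<open>W\<close>, and if it is not a leaf, at least one edge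
away from \<open>W\<close>. After integration by parts the energy \<open>\<integral> f'\<^sup>2 - k\<^sup>2 f\<^sup>2\<close> is a sum of boundary terms
\<open>f f'\<close> at the vertices, and branching makes it nonpositive. Pendant trees carry constants and
contribute a nonpositive energy (\<open>test_function\<close>).

The eigenfunction comes from a finite-dimensional problem. Cut every edge into so many equal pieces
that \<open>k\<close> times the length of a piece is less than \<open>\<pi>\<close>. Then the minimum of the energy for given
values at the nodes is an explicit quadratic form in these values, continuous in the frequency. At the
least frequency at which it is not positive definite it has a null vector
(\<open>critical_function\<close>), and the vanishing of its gradient says that the trigonometric
interpolation is an eigenfunction (\<open>critical_function_on_edges\<close>). Frequency \<open>0\<close> means that the
eigenvalue \<open>0\<close> has multiplicity at least two.

The girth enters through edge sets without leaves: a nonempty finite set of edges in which no end of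
an edge is alone at its vertex. Such a set contains a cycle (\<open>cycle_in_leafless\<close>), because a walk
without reversals must return, and the edges of a topological cycle form such a set
(\<open>leafless_in_cycle\<close>), because a loop enters and leaves each of its points in different
directions. Dummy vertices change nothing since a refinement induces a bijection between the
directions at corresponding points (\<open>dmap_bij\<close>); Kirchhoff sums and leafless sets only depend on
directions.

For a pumpkin with edges of length \<open>l\<close>, a leafless set has at least two edges, so the girth is
\<open>2 l\<close>. A function with eigenvalue between \<open>0\<close> and \<open>(\<pi> / l)\<^sup>2\<close> is determined on every edge by
its values at the two ends, hence is the same on all edges, and the vertex conditions make it zero.\<close>

section \<open>Potentials on a finite multigraph without short cycles\<close>

text \<open>A multigraph is given by the map \<open>\<tau>\<close> from darts to nodes: the dart \<open>(e, b)\<close> is the end of \<open>e\<close>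
selected by \<open>b\<close>. A loop has two darts at the same node, so it is leafless by itself. At nodes in \<open>Z\<close>,
where functions will vanish, single ends are allowed.\<close>

definition leafless :: "('e \<Rightarrow> bool \<Rightarrow> 'n) \<Rightarrow> 'n set \<Rightarrow> 'e set \<Rightarrow> bool" where
  "leafless \<tau> Z F \<longleftrightarrow> F \<noteq> {} \<and>
     (\<forall>e\<in>F. \<forall>b. \<tau> e b \<notin> Z \<longrightarrow> (\<exists>e'\<in>F. \<exists>b'. (e', b') \<noteq> (e, b) \<and> \<tau> e' b' = \<tau> e b))"

lemma leaflessD:
  assumes "leafless \<tau> Z F" "e \<in> F" "\<tau> e b \<notin> Z"
  obtains e' b' where "e' \<in> F" "(e', b') \<noteq> (e, b)" "\<tau> e' b' = \<tau> e b"
  using assms unfolding leafless_def by blast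

text \<open>The distance to \<open>Z\<close>, cut off at \<open>R\<close>, is the largest function with slope at most one that is
bounded by \<open>R\<close> and zero on \<open>Z\<close>. This description avoids paths: if no edge at a node were tight, the
value there could be raised.\<close>

lemma truncated_distance:
  fixes \<tau> :: "'e \<Rightarrow> bool \<Rightarrow> 'n" and L :: "'e \<Rightarrow> real" and R :: real
  assumes fin: "finite E" and L: "\<And>e. e \<in> E \<Longrightarrow> 0 < L e" and R: "0 < R"
  shows "\<exists>A. (\<forall>n. 0 \<le> A n) \<and> (\<forall>n. A n \<le> R) \<and> (\<forall>n\<in>Z. A n = 0) \<and>
    (\<forall>e\<in>E. \<forall>b. A (\<tau> e b) \<le> A (\<tau> e (\<not> b)) + L e) \<and>
    (\<forall>n. n \<notin> Z \<longrightarrow> A n < R \<longrightarrow> (\<exists>e\<in>E. \<exists>b. \<tau> e b = n \<and> A n = A (\<tau> e (\<not> b)) + L e))"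
proof -
  define S where "S = {g :: 'n \<Rightarrow> real. (\<forall>n. 0 \<le> g n \<and> g n \<le> R) \<and> (\<forall>n\<in>Z. g n = 0) \<and>
      (\<forall>e\<in>E. \<forall>b. g (\<tau> e b) \<le> g (\<tau> e (\<not> b)) + L e)}"
  define A where "A = (\<lambda>n. SUP g\<in>S. g n)"
  have S0: "(\<lambda>_. 0) \<in> S"
    using R L by (auto simp: S_def intro: less_imp_le)
  have bdd: "bdd_above ((\<lambda>g. g n) ` S)" for n
    by (rule bdd_aboveI[of _ R]) (auto simp: S_def)
  have upper: "g n \<le> A n" if "g \<in> S" for g n
    unfolding A_def by (rule cSUP_upper[OF that bdd])
  have least: "A n \<le> c" if "\<And>g. g \<in> S \<Longrightarrow> g n \<le> c" for n c
    unfolding A_def by (rule cSUP_least) (use S0 that in auto)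
  have A0: "0 \<le> A n" for n using upper[OF S0] by simp
  have AR: "A n \<le> R" for n by (rule least) (auto simp: S_def)
  have AZ: "A n = 0" if "n \<in> Z" for n
    using A0[of n] least[of n 0] that by (force simp: S_def)
  have AL: "A (\<tau> e b) \<le> A (\<tau> e (\<not> b)) + L e" if "e \<in> E" for e b
  proof (rule least)
    fix g assume g: "g \<in> S"
    then have "g (\<tau> e b) \<le> g (\<tau> e (\<not> b)) + L e" using that by (auto simp: S_def)
    also have "\<dots> \<le> A (\<tau> e (\<not> b)) + L e" using upper[OF g] by simp
    finally show "g (\<tau> e b) \<le> A (\<tau> e (\<not> b)) + L e" .
  qed
  have tight: "\<exists>e\<in>E. \<exists>b. \<tau> e b = n \<and> A n = A (\<tau> e (\<not> b)) + L e" if n: "n \<notin> Z" "A n < R" for n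
  proof (rule ccontr)
    assume neg: "\<not> ?thesis"
    define D where "D = {(e, b). e \<in> E \<and> \<tau> e b = n}"
    define m where "m = Min (insert (R - A n) ((\<lambda>(e, b). A (\<tau> e (\<not> b)) + L e - A n) ` D))"
    have finD: "finite D" by (rule finite_subset[of _ "E \<times> UNIV"]) (auto simp: D_def fin)
    have pos: "0 < A (\<tau> e (\<not> b)) + L e - A n" if "(e, b) \<in> D" for e b
      using AL[of e b] neg that by (force simp: D_def)
    have m: "0 < m" unfolding m_def using finD n pos by (subst Min_gr_iff) auto
    have mR: "m \<le> R - A n" unfolding m_def using finD by auto
    have mD: "m \<le> A (\<tau> e (\<not> b)) + L e - A n" if "(e, b) \<in> D" for e b
      unfolding m_def using finD that by (intro Min_le) (auto intro!: rev_image_eqI)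
    \<comment> \<open>Without a tight edge at \<open>n\<close>, raising the value there by \<open>m\<close> respects all slopes.\<close>
    have "A(n := A n + m) \<in> S"
      unfolding S_def
    proof (safe, goal_cases)
      case (1 n') then show ?case using A0 m by (auto simp: add_nonneg_nonneg)
    next
      case (2 n') then show ?case using AR mR by auto
    next
      case (3 n') then show ?case using AZ n by auto
    next
      case (4 e b)
      show ?case
      proof (cases "\<tau> e b = n")
        case True
        then show ?thesis using mD[of e b] L[OF 4] 4 by (auto simp: D_def)
      next
        case False
        then show ?thesis using AL[OF 4, of b] m by (auto simp: fun_upd_def)
      qed
    qed
    from upper[OF this, of n] m show False by simp
  qed
  show ?thesis by (rule exI[of _ A]) (intro conjI allI ballI impI A0 AR AZ AL tight)
qed

text \<open>\<open>((x\<^sup>2 + y\<^sup>2) cos L - 2 x y) / sin L\<close> is the energy \<open>\<integral> f'\<^sup>2 - f\<^sup>2\<close> over an interval of length \<open>L\<close>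
of the solution of \<open>f'' = - f\<close> with end values \<open>x\<close> and \<open>y\<close>. Here the solution is a piece of the
sine, and the energy is the difference of \<open>f f'\<close>.\<close>

lemma energy_tree_edge:
  fixes A L :: real
  assumes "sin L \<noteq> 0"
  shows "(((sin A)\<^sup>2 + (sin (A + L))\<^sup>2) * cos L - 2 * sin A * sin (A + L)) / sin L =
    sin (A + L) * cos (A + L) - sin A * cos A"
proof -
  have 1: "sin A * cos L + cos A * sin L = sin (A + L)" by (simp add: sin_add)
  have 2: "sin (A + L) * cos L - cos (A + L) * sin L = sin A"
    using sin_diff[of "A + L" L] by simp
  have "((sin A)\<^sup>2 + (sin (A + L))\<^sup>2) * cos L - 2 * sin A * sin (A + L) -
      (sin (A + L) * cos (A + L) - sin A * cos A) * sin L =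
     sin A * (sin A * cos L + cos A * sin L) +
     sin (A + L) * (sin (A + L) * cos L - cos (A + L) * sin L) - 2 * sin A * sin (A + L)"
    by (simp add: algebra_simps power2_eq_square)
  also have "\<dots> = 0" unfolding 1 2 by simp
  finally show ?thesis using assms by (simp add: field_simps)
qed

lemma sin_le_of_add_ge_pi:
  assumes "0 \<le> A" "A \<le> pi / 2" "0 \<le> B" "B \<le> pi / 2" "L < pi" "A + B + L \<ge> pi"
  shows "sin (A + L) \<le> sin B"
proof -
  have "sin ((A + L) - pi) \<ge> sin (- B)"
    by (rule sin_monotone_2pi_le) (use assms in auto)
  then show ?thesis by (simp add: sin_diff)
qed

text \<open>If \<open>A + B + L = \<pi>\<close>, the sine itself interpolates, and both ends see it increase into the edge. A
longer edge only has a smaller energy, which is the monotonicity of the sine beyond \<open>\<pi> / 2\<close>.\<close>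

lemma energy_cross_edge:
  fixes A B L :: real
  assumes "0 \<le> A" "A \<le> pi / 2" "0 \<le> B" "B \<le> pi / 2" "0 < L" "L < pi" "A + B + L \<ge> pi"
  shows "(((sin A)\<^sup>2 + (sin B)\<^sup>2) * cos L - 2 * sin A * sin B) / sin L
     \<le> - (sin A * cos A) - sin B * cos B"
proof -
  have s: "0 < sin L" using assms by (intro sin_gt_zero) auto
  have A: "sin A * sin (A + L) \<le> sin A * sin B"
    by (rule mult_left_mono[OF sin_le_of_add_ge_pi]) (use assms in \<open>auto intro: sin_ge_zero\<close>)
  have B: "sin B * sin (B + L) \<le> sin B * sin A"
    by (rule mult_left_mono[OF sin_le_of_add_ge_pi]) (use assms in \<open>auto intro: sin_ge_zero\<close>)
  have "((sin A)\<^sup>2 + (sin B)\<^sup>2) * cos L - 2 * sin A * sin B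
      = sin A * sin (A + L) + sin B * sin (B + L) - 2 * sin A * sin B
       + (- (sin A * cos A) - sin B * cos B) * sin L"
    by (simp add: sin_add algebra_simps power2_eq_square)
  also have "\<dots> \<le> (- (sin A * cos A) - sin B * cos B) * sin L" using A B by (simp add: mult.commute[of "sin B" "sin A"])
  finally show ?thesis using s by (simp add: pos_divide_le_eq)
qed

text \<open>This lets leaves be pruned without losing a leafless subset.\<close>

lemma leaf_edge_not_in_leafless:
  assumes "leafless \<tau> Z F" "F \<subseteq> E" "e \<in> E" "\<tau> e b \<notin> Z"
    and only: "\<And>e' b'. e' \<in> E \<Longrightarrow> \<tau> e' b' = \<tau> e b \<Longrightarrow> e' = e \<and> b' = b"
  shows "e \<notin> F"
  using leaflessD[OF assms(1), of e b] assms by blast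

text \<open>Following parents from \<open>w\<close> down to \<open>Z\<close> gives a chain of total length at most \<open>A w\<close>. Distances
strictly decrease along it, so consecutive edges are different and \<open>w\<close> is the only possible leaf
outside \<open>Z\<close>. The induction is over the number of edges whose lower end lies below \<open>w\<close>.\<close>

lemma parent_chain:
  fixes \<tau> :: "'e \<Rightarrow> bool \<Rightarrow> 'n" and A :: "'n \<Rightarrow> real" and L :: "'e \<Rightarrow> real"
  assumes fin: "finite E" and L: "\<And>e. e \<in> E \<Longrightarrow> 0 < L e" and A0: "\<And>n. 0 \<le> A n"
    and par: "\<And>n. n \<notin> Z \<Longrightarrow> A n < R \<Longrightarrow> pe n \<in> E \<and> \<tau> (pe n) (pb n) = n \<and>
      A n = A (\<tau> (pe n) (\<not> pb n)) + L (pe n)"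
    and w: "A w < R"
  shows "\<exists>C\<subseteq>{pe n | n. n \<notin> Z \<and> A n < R}. finite C \<and> sum L C \<le> A w \<and> (w \<notin> Z \<longrightarrow> pe w \<in> C) \<and>
    (C = {} \<or> leafless \<tau> (insert w Z) C)"
  using w
proof (induction "card {e\<in>E. \<exists>b. A (\<tau> e b) < A w \<and> A (\<tau> e b) < A (\<tau> e (\<not> b))}" arbitrary: w rule: less_induct)
  case less
  let ?below = "\<lambda>w. {e\<in>E. \<exists>b. A (\<tau> e b) < A w \<and> A (\<tau> e b) < A (\<tau> e (\<not> b))}"
  show ?case
  proof (cases "w \<in> Z")
    case True
    then show ?thesis by (intro exI[of _ "{}"]) (use A0 in auto)
  next
    case False
    define u where "u = \<tau> (pe w) (\<not> pb w)"
    have p: "pe w \<in> E" "\<tau> (pe w) (pb w) = w" "A w = A u + L (pe w)"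
      using par[OF False less.prems] by (auto simp: u_def)
    have uw: "A u < A w" using p L[of "pe w"] by simp
    have "?below u \<subset> ?below w"
    proof
      show "?below u \<subseteq> ?below w" using uw by force
      have 1: "pe w \<in> ?below w"
        using p uw by (auto simp: u_def intro!: exI[of _ "\<not> pb w"])
      have "\<not> A (\<tau> (pe w) b) < A u" for b
        using p(2) uw unfolding u_def by (cases "b = pb w") auto
      then have "pe w \<notin> ?below u" by blast
      with 1 show "?below u \<noteq> ?below w" by blast
    qed
    then have "card (?below u) < card (?below w)" using fin by (intro psubset_card_mono) auto
    moreover have uR: "A u < R" using uw less.prems by simp
    ultimately have "\<exists>C\<subseteq>{pe n | n. n \<notin> Z \<and> A n < R}. finite C \<and> sum L C \<le> A u \<and> (u \<notin> Z \<longrightarrow> pe u \<in> C) \<and>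
      (C = {} \<or> leafless \<tau> (insert u Z) C)"
      by (rule less.hyps)
    then obtain C where
      C: "C \<subseteq> {pe n | n. n \<notin> Z \<and> A n < R}" "finite C" "sum L C \<le> A u" "u \<notin> Z \<longrightarrow> pe u \<in> C"
      and CL0: "C = {} \<or> leafless \<tau> (insert u Z) C"
      by (elim exE conjE)
    have CL: "\<exists>e'\<in>C. \<exists>b'. (e', b') \<noteq> (e, b) \<and> \<tau> e' b' = \<tau> e b"
      if "e \<in> C" "\<tau> e b \<notin> Z" "\<tau> e b \<noteq> u" for e b
      using CL0 that unfolding leafless_def by blast
    have pu: "pe u \<noteq> pe w \<and> \<tau> (pe u) (pb u) = u" if "u \<notin> Z"
    proof -
      note P = par[OF that uR]
      note q = P[THEN conjunct2, THEN conjunct1] P[THEN conjunct2, THEN conjunct2]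
        L[OF P[THEN conjunct1]]
      have "pe u \<noteq> pe w"
      proof
        assume eq: "pe u = pe w"
        show False
        proof (cases "pb u = pb w")
          case True
          have "u = \<tau> (pe w) (pb w)" using q(1)[symmetric] by (simp only: eq True)
          with uw p(2) show False by simp
        next
          case False
          then have "(\<not> pb u) = pb w" by auto
          then have "A u = A (\<tau> (pe w) (pb w)) + L (pe u)" using q(2) by (simp only: eq)
          then have "A u = A w + L (pe u)" by (simp only: p(2))
          with uw q(3) show False by simp
        qed
      qed
      with q(1) show ?thesis by (rule conjI[rotated])
    qed
    have "leafless \<tau> (insert w Z) (insert (pe w) C)"
      unfolding leafless_def
    proof (intro conjI ballI allI impI)
      fix e b assume e: "e \<in> insert (pe w) C" and "\<tau> e b \<notin> insert w Z"
      then have e': "\<tau> e b \<notin> Z" "\<tau> e b \<noteq> w" by auto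
      show "\<exists>e'\<in>insert (pe w) C. \<exists>b'. (e', b') \<noteq> (e, b) \<and> \<tau> e' b' = \<tau> e b"
      proof (cases "\<tau> e b = u")
        case True
        show ?thesis
        proof (cases "e = pe w")
          case True
          then show ?thesis using pu C \<open>\<tau> e b = u\<close> e'(1) by (intro bexI[of _ "pe u"] exI[of _ "pb u"]) auto
        next
          case False
          then show ?thesis using \<open>\<tau> e b = u\<close> e'(1)
            by (intro bexI[of _ "pe w"] exI[of _ "\<not> pb w"]) (auto simp: u_def)
        qed
      next
        case False
        have "e \<noteq> pe w" using False e e' p(2) unfolding u_def by (cases "b = pb w") auto
        with e e' CL False show ?thesis by blast
      qed
    qed simp
    moreover have "sum L (insert (pe w) C) \<le> A w"
      using C p L[of "pe w"] by (cases "pe w \<in> C") (auto simp: insert_absorb)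
    ultimately show ?thesis
      using C False less.prems by (intro exI[of _ "insert (pe w) C"]) blast
  qed
qed

text \<open>An edge that is nobody's parent edge, together with the chains from both of its ends, is leafless,
whether or not the chains meet.\<close>

lemma cross_edge_far:
  fixes \<tau> :: "'e \<Rightarrow> bool \<Rightarrow> 'n" and A :: "'n \<Rightarrow> real" and L :: "'e \<Rightarrow> real"
  assumes fin: "finite E" and L: "\<And>e. e \<in> E \<Longrightarrow> 0 < L e" and A0: "\<And>n. 0 \<le> A n"
    and par: "\<And>n. n \<notin> Z \<Longrightarrow> A n < R \<Longrightarrow> pe n \<in> E \<and> \<tau> (pe n) (pb n) = n \<and>
      A n = A (\<tau> (pe n) (\<not> pb n)) + L (pe n)"
    and big: "\<And>F. F \<subseteq> E \<Longrightarrow> leafless \<tau> Z F \<Longrightarrow> c \<le> sum L F"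
    and e: "e \<in> E" "\<And>n. n \<notin> Z \<Longrightarrow> A n < R \<Longrightarrow> pe n \<noteq> e"
    and R: "\<And>b. A (\<tau> e b) < R"
  shows "c \<le> A (\<tau> e True) + A (\<tau> e False) + L e"
proof -
  have ch: "\<forall>b. \<exists>C\<subseteq>{pe n | n. n \<notin> Z \<and> A n < R}. finite C \<and> sum L C \<le> A (\<tau> e b) \<and>
      (\<tau> e b \<notin> Z \<longrightarrow> pe (\<tau> e b) \<in> C) \<and> (C = {} \<or> leafless \<tau> (insert (\<tau> e b) Z) C)"
    by (intro allI) (rule parent_chain[OF fin L A0 par R])
  from choice[OF ch]
  obtain C where Call: "\<forall>b. C b \<subseteq> {pe n | n. n \<notin> Z \<and> A n < R} \<and> finite (C b) \<and>
      sum L (C b) \<le> A (\<tau> e b) \<and> (\<tau> e b \<notin> Z \<longrightarrow> pe (\<tau> e b) \<in> C b) \<and>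
      (C b = {} \<or> leafless \<tau> (insert (\<tau> e b) Z) (C b))"
    by (elim exE)
  have C: "C b \<subseteq> {pe n | n. n \<notin> Z \<and> A n < R}" "finite (C b)" "sum L (C b) \<le> A (\<tau> e b)"
      "\<tau> e b \<notin> Z \<Longrightarrow> pe (\<tau> e b) \<in> C b" for b
    using Call[THEN spec, of b] by simp_all
  have CL: "\<exists>e'\<in>C b. \<exists>b'. (e', b') \<noteq> (e1, b1) \<and> \<tau> e' b' = \<tau> e1 b1"
    if "e1 \<in> C b" "\<tau> e1 b1 \<notin> Z" "\<tau> e1 b1 \<noteq> \<tau> e b" for b e1 b1
    using Call[THEN spec, of b] that unfolding leafless_def by blast
  define F where "F = insert e (C True \<union> C False)"
  have CF: "C b \<subseteq> F" for b by (cases b) (auto simp: F_def)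
  have CE: "C b \<subseteq> E" for b using C(1)[of b] par by blast
  have eC: "e \<notin> C b" for b using C(1)[of b] e by blast
  have "leafless \<tau> Z F"
    unfolding leafless_def
  proof (intro conjI ballI allI impI)
    show "F \<noteq> {}" by (simp add: F_def)
    fix e1 b1 assume e1: "e1 \<in> F" "\<tau> e1 b1 \<notin> Z"
    show "\<exists>e'\<in>F. \<exists>b'. (e', b') \<noteq> (e1, b1) \<and> \<tau> e' b' = \<tau> e1 b1"
    proof (cases "\<exists>b. \<tau> e1 b1 = \<tau> e b")
      case True
      then obtain b where b: "\<tau> e1 b1 = \<tau> e b" by blast
      define n where "n = \<tau> e b"
      have n: "n \<notin> Z" "A n < R" using e1 b R by (auto simp: n_def)
      have pn: "pe n \<in> F" "pe n \<noteq> e" "\<tau> (pe n) (pb n) = n"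
        using C(4)[of b] CF n e(2) par[OF n] by (auto simp: n_def)
      show ?thesis
      proof (cases "e1 = e")
        case True
        then show ?thesis using pn b n_def by (intro bexI[of _ "pe n"] exI[of _ "pb n"]) auto
      next
        case False
        then show ?thesis using b by (intro bexI[of _ e] exI[of _ b]) (auto simp: F_def)
      qed
    next
      case False
      then have "e1 \<noteq> e" by blast
      then obtain b where "e1 \<in> C b" using e1 by (auto simp: F_def)
      from CL[OF this e1(2)] False CF[of b] show ?thesis by blast
    qed
  qed
  moreover have "F \<subseteq> E" using CE e by (auto simp: F_def)
  ultimately have "c \<le> sum L F" using big by blast
  also have "\<dots> = L e + sum L (C True \<union> C False)"
    using C(2) eC by (auto simp: F_def)
  also have "sum L (C True \<union> C False) \<le> sum L (C True) + sum L (C False)"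
  proof -
    have "0 \<le> sum L (C True \<inter> C False)"
      using CE L by (intro sum_nonneg) (blast intro: less_imp_le)
    then show ?thesis using C(2) by (simp add: sum_Un)
  qed
  finally show ?thesis using C(3)[of True] C(3)[of False] by linarith
qed

lemma sum_darts: "(\<Sum>d\<in>E \<times> UNIV. g d) = (\<Sum>e\<in>E. g (e, True) + g (e, False))"
  using sum.cartesian_product[of "\<lambda>e b. g (e, b)" UNIV E] by (simp add: UNIV_bool add.commute)

text \<open>In units of the frequency: \<open>L e\<close> is the frequency times the length of \<open>e\<close>.\<close>

definition energy :: "'e set \<Rightarrow> ('e \<Rightarrow> bool \<Rightarrow> 'n) \<Rightarrow> ('e \<Rightarrow> real) \<Rightarrow> ('n \<Rightarrow> real) \<Rightarrow> real" where
  "energy E \<tau> L f = (\<Sum>e\<in>E. (((f (\<tau> e True))\<^sup>2 + (f (\<tau> e False))\<^sup>2) * cos (L e)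
      - 2 * f (\<tau> e True) * f (\<tau> e False)) / sin (L e))"

text \<open>With \<open>f = sin A\<close> and boundary terms \<open>t = sin A cos A\<close>, a parent edge contributes \<open>t\<close> at its upper
end minus \<open>t\<close> at its lower end, and every other edge at most minus the sum of \<open>t\<close> over its ends. In
the total, a node gets \<open>t\<close> with factor at most two minus its degree. Nodes with \<open>A = \<pi> / 2\<close> or in \<open>Z\<close>
have \<open>t = 0\<close>.\<close>

lemma test_function_no_leaf:
  fixes \<tau> :: "'e \<Rightarrow> bool \<Rightarrow> 'n" and L :: "'e \<Rightarrow> real"
  assumes fin: "finite E" and L: "\<And>e. e \<in> E \<Longrightarrow> 0 < L e \<and> L e < pi"
    and big: "\<And>F. F \<subseteq> E \<Longrightarrow> leafless \<tau> Z F \<Longrightarrow> pi \<le> sum L F"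
    and nl: "leafless \<tau> Z E"
  shows "\<exists>f. (\<forall>n\<in>Z. f n = 0) \<and> (\<exists>e\<in>E. \<exists>b. f (\<tau> e b) \<noteq> 0) \<and> energy E \<tau> L f \<le> 0"
proof -
  have L': "\<And>e. e \<in> E \<Longrightarrow> 0 < L e" and pi2: "0 < pi / 2" using L by auto
  have "\<exists>A. (\<forall>n. 0 \<le> A n) \<and> (\<forall>n. A n \<le> pi / 2) \<and> (\<forall>n\<in>Z. A n = 0) \<and>
    (\<forall>e\<in>E. \<forall>b. A (\<tau> e b) \<le> A (\<tau> e (\<not> b)) + L e) \<and>
    (\<forall>n. n \<notin> Z \<longrightarrow> A n < pi / 2 \<longrightarrow> (\<exists>e\<in>E. \<exists>b. \<tau> e b = n \<and> A n = A (\<tau> e (\<not> b)) + L e))"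
    by (rule truncated_distance[OF fin L' pi2])
  then obtain A where A: "\<forall>n. 0 \<le> A n" "\<forall>n. A n \<le> pi / 2" "\<forall>n\<in>Z. A n = 0"
    "\<forall>e\<in>E. \<forall>b. A (\<tau> e b) \<le> A (\<tau> e (\<not> b)) + L e"
    "\<forall>n. n \<notin> Z \<longrightarrow> A n < pi / 2 \<longrightarrow> (\<exists>e\<in>E. \<exists>b. \<tau> e b = n \<and> A n = A (\<tau> e (\<not> b)) + L e)"
    by (elim exE conjE)
  note A0 = A(1)[rule_format] and AR = A(2)[rule_format] and AZ = A(3)[rule_format]
    and AL = A(4)[rule_format] and Apar = A(5)[rule_format]
  define pd where "pd = (\<lambda>n. SOME d. fst d \<in> E \<and> \<tau> (fst d) (snd d) = n \<and> A n = A (\<tau> (fst d) (\<not> snd d)) + L (fst d))"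
  define pe pb where "pe = (\<lambda>n. fst (pd n))" and "pb = (\<lambda>n. snd (pd n))"
  have par: "pe n \<in> E \<and> \<tau> (pe n) (pb n) = n \<and> A n = A (\<tau> (pe n) (\<not> pb n)) + L (pe n)"
    if n: "n \<notin> Z" "A n < pi / 2" for n
  proof -
    have "\<exists>d. fst d \<in> E \<and> \<tau> (fst d) (snd d) = n \<and> A n = A (\<tau> (fst d) (\<not> snd d)) + L (fst d)"
      using Apar[OF n] by (simp add: Bex_def)
    from someI_ex[OF this] show ?thesis unfolding pe_def pb_def pd_def .
  qed
  have Apos: "0 < A n" if "n \<notin> Z" for n
  proof (cases "A n < pi / 2")
    case True
    from par[OF that this] A0[of "\<tau> (pe n) (\<not> pb n)"] L[of "pe n"] show ?thesis by linarith
  next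
    case False
    with pi_gt_zero show ?thesis by linarith
  qed
  define f where "f = (\<lambda>n. sin (A n))"
  define t where "t = (\<lambda>n. sin (A n) * cos (A n))"
  have t0: "0 \<le> t n" for n
    unfolding t_def using A0[of n] AR[of n] pi_gt_zero
    by (intro mult_nonneg_nonneg sin_ge_zero cos_ge_zero) linarith+
  define N where "N = {n. n \<notin> Z \<and> A n < pi / 2}"
  have NE: "N \<subseteq> (\<lambda>(e, b). \<tau> e b) ` (E \<times> UNIV)"
  proof
    fix n assume "n \<in> N"
    then have "pe n \<in> E" "n = \<tau> (pe n) (pb n)" using par by (auto simp: N_def)
    then show "n \<in> (\<lambda>(e, b). \<tau> e b) ` (E \<times> UNIV)" by (intro image_eqI[of _ _ "(pe n, pb n)"]) auto
  qed
  have finN: "finite N" by (rule finite_subset[OF NE]) (use fin in auto)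
  have parN: "pe n \<in> E" "\<tau> (pe n) (pb n) = n" "A n = A (\<tau> (pe n) (\<not> pb n)) + L (pe n)"
    if "n \<in> N" for n using par[of n] that by (auto simp only: N_def mem_Collect_eq)
  have pe_inj: "n = m" if nm: "n \<in> N" "m \<in> N" "pe n = pe m" for n m
  proof (cases "pb n = pb m")
    case True
    have "n = \<tau> (pe n) (pb n)" using parN(2)[OF nm(1)] by simp
    also have "\<dots> = \<tau> (pe m) (pb m)" by (simp only: nm(3) True)
    finally show ?thesis using parN(2)[OF nm(2)] by simp
  next
    case False
    then have b: "(\<not> pb n) = pb m" "(\<not> pb m) = pb n" by auto
    have "A n = A m + L (pe n)" using parN(3)[OF nm(1)] parN(2)[OF nm(2)] by (simp only: b nm(3))
    moreover have "A m = A n + L (pe m)"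
      using parN(3)[OF nm(2)] parN(2)[OF nm(1)] by (simp only: b nm(3)[symmetric])
    ultimately show ?thesis using L[OF parN(1)[OF nm(1)]] L[OF parN(1)[OF nm(2)]] by linarith
  qed
  have edge: "(((f (\<tau> e True))\<^sup>2 + (f (\<tau> e False))\<^sup>2) * cos (L e)
      - 2 * f (\<tau> e True) * f (\<tau> e False)) / sin (L e)
      \<le> 2 * sum t {n\<in>N. pe n = e} - (t (\<tau> e True) + t (\<tau> e False))" if e: "e \<in> E" for e
  proof (cases "\<exists>n\<in>N. pe n = e")
    case True
    then obtain n where n: "n \<in> N" "pe n = e" by blast
    have set: "{n\<in>N. pe n = e} = {n}" using n pe_inj by blast
    define u where "u = \<tau> e (\<not> pb n)"
    have An: "A n = A u + L e" using parN(3)[OF n(1)] n(2) by (simp add: u_def)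
    have s: "sin (L e) \<noteq> 0" using L[OF e] sin_gt_zero[of "L e"] by simp
    have q: "(((f u)\<^sup>2 + (f n)\<^sup>2) * cos (L e) - 2 * f u * f n) / sin (L e) = t n - t u"
      unfolding f_def t_def An by (rule energy_tree_edge[OF s])
    have ends: "(\<tau> e True = n \<and> \<tau> e False = u) \<or> (\<tau> e True = u \<and> \<tau> e False = n)"
      using parN(2)[OF n(1)] n(2) unfolding u_def by (cases "pb n") auto
    then show ?thesis
    proof
      assume "\<tau> e True = u \<and> \<tau> e False = n"
      then show ?thesis using q by (simp add: set)
    next
      assume "\<tau> e True = n \<and> \<tau> e False = u"
      then show ?thesis using q by (simp add: set algebra_simps)
    qed
  next
    case False
    then have set: "{n\<in>N. pe n = e} = {}" by blast
    have "pi \<le> A (\<tau> e True) + A (\<tau> e False) + L e"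
    proof (cases "\<forall>b. A (\<tau> e b) < pi / 2")
      case True
      show ?thesis
        by (rule cross_edge_far[where E = E and R = "pi/2" and pe = pe and pb = pb and Z = Z])
           (use fin L A0 par big e True False in \<open>auto simp only: N_def\<close>)
    next
      case far: False
      then obtain b where b: "A (\<tau> e b) = pi / 2" using AR by (meson not_less antisym)
      then have "pi / 2 \<le> A (\<tau> e (\<not> b)) + L e" using AL[OF e, of b] by simp
      then show ?thesis using b by (cases b) auto
    qed
    then have "(((sin (A (\<tau> e True)))\<^sup>2 + (sin (A (\<tau> e False)))\<^sup>2) * cos (L e)
         - 2 * sin (A (\<tau> e True)) * sin (A (\<tau> e False))) / sin (L e)
         \<le> - (sin (A (\<tau> e True)) * cos (A (\<tau> e True))) - sin (A (\<tau> e False)) * cos (A (\<tau> e False))"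
      using L[OF e] by (intro energy_cross_edge A0 AR) auto
    then show ?thesis unfolding set f_def t_def by simp
  qed
  define od where "od = (\<lambda>n. SOME d. fst d \<in> E \<and> d \<noteq> (pe n, pb n) \<and> \<tau> (fst d) (snd d) = n)"
  have od: "fst (od n) \<in> E" "od n \<noteq> (pe n, pb n)" "\<tau> (fst (od n)) (snd (od n)) = n" if n: "n \<in> N" for n
  proof -
    have "n \<notin> Z" using n by (simp add: N_def)
    then have "\<exists>d. fst d \<in> E \<and> d \<noteq> (pe n, pb n) \<and> \<tau> (fst d) (snd d) = n"
      using leaflessD[OF nl parN(1)[OF n], of "pb n"] parN(2)[OF n] by (metis fst_conv snd_conv)
    from someI_ex[OF this]
    have "fst (od n) \<in> E \<and> od n \<noteq> (pe n, pb n) \<and> \<tau> (fst (od n)) (snd (od n)) = n"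
      unfolding od_def .
    then show "fst (od n) \<in> E" "od n \<noteq> (pe n, pb n)" "\<tau> (fst (od n)) (snd (od n)) = n" by auto
  qed
  let ?T = "\<lambda>d. t (\<tau> (fst d) (snd d))"
  have "2 * sum t N = sum t N + sum t N" by simp
  also have "\<dots> = sum ?T ((\<lambda>n. (pe n, pb n)) ` N) + sum ?T (od ` N)"
  proof -
    have "inj_on (\<lambda>n. (pe n, pb n)) N" by (rule inj_onI) (use pe_inj in auto)
    moreover have "inj_on od N" by (rule inj_onI) (metis od(3))
    ultimately show ?thesis using od(3) parN(2) by (simp add: sum.reindex)
  qed
  also have "\<dots> = sum ?T ((\<lambda>n. (pe n, pb n)) ` N \<union> od ` N)"
  proof -
    have "(\<lambda>n. (pe n, pb n)) ` N \<inter> od ` N = {}"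
    proof (intro equals0I, elim IntE imageE)
      fix d n m assume *: "d = (pe n, pb n)" "n \<in> N" "d = od m" "m \<in> N"
      have "n = m" using parN(2)[OF *(2)] od(3)[OF *(4)] *(1) *(3)[symmetric] by simp
      then show False using * od(2)[OF *(4)] by simp
    qed
    then show ?thesis using finN by (simp add: sum.union_disjoint)
  qed
  also have "\<dots> \<le> sum ?T (E \<times> UNIV)"
  proof (rule sum_mono2)
    show "(\<lambda>n. (pe n, pb n)) ` N \<union> od ` N \<subseteq> E \<times> UNIV"
      using parN(1) od(1) by (intro Un_least image_subsetI) (auto simp: mem_Times_iff)
  qed (use fin t0 in auto)
  also have "\<dots> = (\<Sum>e\<in>E. t (\<tau> e True) + t (\<tau> e False))"
    by (simp add: sum_darts)
  finally have darts: "2 * sum t N \<le> (\<Sum>e\<in>E. t (\<tau> e True) + t (\<tau> e False))" .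
  have "energy E \<tau> L f \<le> (\<Sum>e\<in>E. 2 * sum t {n\<in>N. pe n = e} - (t (\<tau> e True) + t (\<tau> e False)))"
    unfolding energy_def by (rule sum_mono[OF edge])
  also have "\<dots> = 2 * (\<Sum>e\<in>E. sum t {n\<in>N. pe n = e}) - (\<Sum>e\<in>E. t (\<tau> e True) + t (\<tau> e False))"
    by (simp add: sum_subtractf sum_distrib_left)
  also have "(\<Sum>e\<in>E. sum t {n\<in>N. pe n = e}) = sum t N"
    by (rule sum.group) (use finN fin parN(1) in auto)
  finally have "energy E \<tau> L f \<le> 0" using darts by linarith
  moreover have "f n = 0" if "n \<in> Z" for n using AZ that by (simp add: f_def)
  moreover have "\<exists>e\<in>E. \<exists>b. f (\<tau> e b) \<noteq> 0"
  proof -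
    obtain e where e: "e \<in> E" using nl by (auto simp: leafless_def)
    \<comment> \<open>An edge with both ends in \<open>Z\<close> is leafless and would have length at least \<open>\<pi>\<close>.\<close>
    have "\<exists>b. \<tau> e b \<notin> Z"
    proof (rule ccontr)
      assume "\<nexists>b. \<tau> e b \<notin> Z"
      then have "leafless \<tau> Z {e}" by (auto simp: leafless_def)
      from big[OF _ this] e L[OF e] show False by simp
    qed
    then obtain b where "\<tau> e b \<notin> Z" by blast
    from Apos[OF this] AR[of "\<tau> e b"] pi_gt_zero have "0 < f (\<tau> e b)"
      unfolding f_def by (intro sin_gt_zero) linarith+
    with e show ?thesis by (metis less_irrefl)
  qed
  ultimately show ?thesis by blast
qed

text \<open>Leaves outside \<open>Z\<close> are removed one by one and restored with the value of their neighbour: constant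
end values give a nonpositive energy. The leafless subset survives the pruning.\<close>

theorem test_function:
  fixes \<tau> :: "'e \<Rightarrow> bool \<Rightarrow> 'n" and L :: "'e \<Rightarrow> real"
  assumes fin: "finite E" and L: "\<And>e. e \<in> E \<Longrightarrow> 0 < L e \<and> L e < pi"
    and big: "\<And>F. F \<subseteq> E \<Longrightarrow> leafless \<tau> Z F \<Longrightarrow> pi \<le> sum L F"
    and ex: "F0 \<subseteq> E" "leafless \<tau> Z F0"
  shows "\<exists>f. (\<forall>n\<in>Z. f n = 0) \<and> (\<exists>e\<in>E. \<exists>b. f (\<tau> e b) \<noteq> 0) \<and> energy E \<tau> L f \<le> 0"
  using assms
proof (induction "card E" arbitrary: E rule: less_induct)
  case less
  show ?case
  proof (cases "leafless \<tau> Z E")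
    case True
    show ?thesis by (rule test_function_no_leaf) (use less.prems True in auto)
  next
    case False
    have "E \<noteq> {}" using less.prems by (auto simp: leafless_def)
    with False obtain e b where e: "e \<in> E" "\<tau> e b \<notin> Z"
      and only: "\<And>e' b'. e' \<in> E \<Longrightarrow> \<tau> e' b' = \<tau> e b \<Longrightarrow> e' = e \<and> b' = b"
      unfolding leafless_def by blast
    define n u where "n = \<tau> e b" and "u = \<tau> e (\<not> b)"
    have un: "u \<noteq> n" using only[OF e(1), of "\<not> b"] by (auto simp: n_def u_def)
    have "F0 \<subseteq> E - {e}" using leaf_edge_not_in_leafless[OF less.prems(5,4) e only] less.prems by blast
    moreover have "card (E - {e}) < card E" using e less.prems by (intro psubset_card_mono) auto
    ultimately obtain f where f: "\<And>m. m \<in> Z \<Longrightarrow> f m = 0" "\<exists>e\<in>E - {e}. \<exists>b. f (\<tau> e b) \<noteq> 0"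
        "energy (E - {e}) \<tau> L f \<le> 0"
      using less.hyps[of "E - {e}"] less.prems by blast
    \<comment> \<open>Constant on the pendant edge.\<close>
    define g where "g = f(n := f u)"
    have same: "g (\<tau> e' b') = f (\<tau> e' b')" if "e' \<in> E - {e}" for e' b'
      using only[of e' b'] that by (auto simp: g_def n_def)
    have "energy (E - {e}) \<tau> L g = energy (E - {e}) \<tau> L f"
      unfolding energy_def by (rule sum.cong) (simp_all add: same)
    moreover have "energy E \<tau> L g = energy (E - {e}) \<tau> L g +
        (((g (\<tau> e True))\<^sup>2 + (g (\<tau> e False))\<^sup>2) * cos (L e) - 2 * g (\<tau> e True) * g (\<tau> e False)) / sin (L e)"
      unfolding energy_def using less.prems e by (subst sum.remove[of _ e]) auto
    moreover have "g (\<tau> e b') = f u" for b'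
      using un by (cases "b' = b") (auto simp: g_def n_def u_def)
    moreover have "(((f u)\<^sup>2 + (f u)\<^sup>2) * cos (L e) - 2 * f u * f u) / sin (L e) \<le> 0"
    proof -
      have "0 < sin (L e)" using less.prems e by (intro sin_gt_zero) auto
      moreover have "(f u)\<^sup>2 * cos (L e) \<le> (f u)\<^sup>2" by (intro mult_left_le) auto
      ultimately show ?thesis by (intro divide_nonpos_pos) (auto simp: algebra_simps power2_eq_square)
    qed
    ultimately have "energy E \<tau> L g \<le> 0" using f(3) by simp
    moreover have "\<forall>m\<in>Z. g m = 0" using f(1) e by (auto simp: g_def n_def)
    moreover have "\<exists>e\<in>E. \<exists>b. g (\<tau> e b) \<noteq> 0" using f(2) same by (metis DiffD1)
    ultimately show ?thesis by blast
  qed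
qed

section \<open>The energy form and its critical frequency\<close>

text \<open>The solution of \<open>u'' = - k\<^sup>2 u\<close> with \<open>u 0 = 0\<close> and \<open>u' 0 = 1\<close>. The case \<open>k = 0\<close> makes it continuous in
the frequency.\<close>

definition sn :: "real \<Rightarrow> real \<Rightarrow> real" where
  "sn k x = (if k = 0 then x else sin (k * x) / k)"

lemma sn_0 [simp]: "sn k 0 = 0" by (simp add: sn_def)

lemma sn_pos:
  assumes "0 \<le> k" "0 < x" "k * x < pi"
  shows "0 < sn k x"
  using assms by (auto simp: sn_def intro!: divide_pos_pos sin_gt_zero)

lemma isCont_sn: "isCont (\<lambda>k. sn k x) k"
proof (cases "k = 0")
  case True
  have "((\<lambda>k. sin (k * x)) has_real_derivative x) (at 0)"
    by (auto intro!: derivative_eq_intros)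
  then have "(\<lambda>k. sin (k * x) / k) \<midarrow>0\<rightarrow> x"
    by (simp add: has_field_derivative_iff)
  then have "(\<lambda>k. sn k x) \<midarrow>0\<rightarrow> x"
    by (rule Lim_transform_eventually) (auto simp: eventually_at_filter sn_def)
  then show ?thesis using True by (simp add: isCont_def sn_def)
next
  case False
  have "isCont (\<lambda>k. sin (k * x) / k) k" using False by (intro continuous_intros)
  moreover have "\<forall>\<^sub>F k' in nhds k. sn k' x = sin (k' * x) / k'"
    using t1_space_nhds[OF False] by eventually_elim (simp add: sn_def)
  ultimately show ?thesis by (simp add: isCont_cong)
qed

text \<open>The symmetric bilinear form of the energy \<open>\<integral> u'\<^sup>2 - k\<^sup>2 u\<^sup>2\<close> of functions that solve
\<open>u'' = - k\<^sup>2 u\<close> on every edge, in terms of the values at the nodes; \<open>h e\<close> is the length of \<open>e\<close>.\<close>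

definition form :: "'e set \<Rightarrow> ('e \<Rightarrow> bool \<Rightarrow> 'n) \<Rightarrow> ('e \<Rightarrow> real) \<Rightarrow> real \<Rightarrow> ('n \<Rightarrow> real) \<Rightarrow> ('n \<Rightarrow> real) \<Rightarrow> real" where
  "form E \<tau> h k f g = (\<Sum>e\<in>E. ((f (\<tau> e True) * g (\<tau> e True) + f (\<tau> e False) * g (\<tau> e False)) * cos (k * h e)
      - f (\<tau> e True) * g (\<tau> e False) - f (\<tau> e False) * g (\<tau> e True)) / sn k (h e))"

lemma form_add_scaled:
  "form E \<tau> h k (\<lambda>n. f n + c * g n) (\<lambda>n. f n + c * g n) =
     form E \<tau> h k f f + 2 * c * form E \<tau> h k f g + c\<^sup>2 * form E \<tau> h k g g"
  unfolding form_def sum_distrib_left sum.distrib[symmetric]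
  by (intro sum.cong refl) (simp add: divide_inverse algebra_simps power2_eq_square)

lemma form_scaled: "form E \<tau> h k (\<lambda>n. c * f n) (\<lambda>n. c * f n) = c\<^sup>2 * form E \<tau> h k f f"
  unfolding form_def sum_distrib_left
  by (intro sum.cong refl) (simp add: divide_inverse algebra_simps power2_eq_square)

lemma form_cong:
  assumes "\<And>e b. e \<in> E \<Longrightarrow> f (\<tau> e b) = f' (\<tau> e b)" "\<And>e b. e \<in> E \<Longrightarrow> g (\<tau> e b) = g' (\<tau> e b)"
  shows "form E \<tau> h k f g = form E \<tau> h k f' g'"
  unfolding form_def by (intro sum.cong refl) (simp add: assms)

lemma form_0_nonneg:
  assumes "\<And>e. e \<in> E \<Longrightarrow> 0 < h e"
  shows "0 \<le> form E \<tau> h 0 f f"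
  unfolding form_def
proof (rule sum_nonneg)
  fix e assume "e \<in> E"
  have "(f (\<tau> e True) * f (\<tau> e True) + f (\<tau> e False) * f (\<tau> e False)) * cos (0 * h e) -
      f (\<tau> e True) * f (\<tau> e False) - f (\<tau> e False) * f (\<tau> e True) = (f (\<tau> e True) - f (\<tau> e False))\<^sup>2"
    by (simp add: power2_eq_square algebra_simps)
  then show "0 \<le> ((f (\<tau> e True) * f (\<tau> e True) + f (\<tau> e False) * f (\<tau> e False)) * cos (0 * h e) -
      f (\<tau> e True) * f (\<tau> e False) - f (\<tau> e False) * f (\<tau> e True)) / sn 0 (h e)"
    using assms[OF \<open>e \<in> E\<close>] by (simp add: sn_def)
qed

text \<open>Each summand is, up to sign, the derivative at the node of the interpolating solution, taken into the
edge. So a null direction of the form satisfies the Kirchhoff condition at the node.\<close>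

lemma form_indicator:
  assumes "finite E"
  shows "form E \<tau> h k f (\<lambda>m. if m = n then 1 else 0) =
    (\<Sum>(e, b) | e \<in> E \<and> \<tau> e b = n. (f n * cos (k * h e) - f (\<tau> e (\<not> b))) / sn k (h e))"
proof -
  let ?t = "\<lambda>e b. if \<tau> e b = n then (f n * cos (k * h e) - f (\<tau> e (\<not> b))) / sn k (h e) else 0"
  have "form E \<tau> h k f (\<lambda>m. if m = n then 1 else 0) = (\<Sum>e\<in>E. ?t e True + ?t e False)"
    unfolding form_def
    by (intro sum.cong refl) (auto simp: diff_divide_distrib add_divide_distrib algebra_simps)
  also have "\<dots> = (\<Sum>e\<in>E. \<Sum>b\<in>UNIV. ?t e b)" by (simp add: UNIV_bool add.commute)
  also have "\<dots> = (\<Sum>(e, b)\<in>E \<times> UNIV. ?t e b)" by (simp add: sum.cartesian_product)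
  also have "\<dots> = (\<Sum>(e, b) | e \<in> E \<and> \<tau> e b = n. (f n * cos (k * h e) - f (\<tau> e (\<not> b))) / sn k (h e))"
    using assms by (intro sum.mono_neutral_cong_right) (auto split: if_splits)
  finally show ?thesis .
qed

text \<open>The pairs of a frequency and a normalised node function with nonpositive energy form a compact set.
A pair with the least frequency works: by minimality the form is positive semidefinite there, so a
null vector lies in its kernel.\<close>

theorem critical_function:
  fixes \<tau> :: "'e \<Rightarrow> bool \<Rightarrow> 'n"
  assumes fin: "finite E" and h: "\<And>e. e \<in> E \<Longrightarrow> 0 < h e" and K: "0 \<le> K" "\<And>e. e \<in> E \<Longrightarrow> K * h e < pi"
    and f0: "\<And>n. n \<in> Z \<Longrightarrow> f0 n = 0" "\<exists>e\<in>E. \<exists>b. f0 (\<tau> e b) \<noteq> 0" "form E \<tau> h K f0 f0 \<le> 0"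
  shows "\<exists>k f. 0 \<le> k \<and> k \<le> K \<and> (\<forall>n\<in>Z. f n = 0) \<and> (\<exists>e\<in>E. \<exists>b. f (\<tau> e b) \<noteq> 0) \<and>
    (\<forall>n. n \<notin> Z \<longrightarrow>
      (\<Sum>(e, b) | e \<in> E \<and> \<tau> e b = n. (f n * cos (k * h e) - f (\<tau> e (\<not> b))) / sn k (h e)) = 0)"
proof -
  define V where "V = (\<lambda>(e, b). \<tau> e b) ` (E \<times> UNIV)"
  have finV: "finite V" unfolding V_def using fin by simp
  have V: "\<tau> e b \<in> V" if "e \<in> E" for e b unfolding V_def using that by force
  define B where "B = Pi\<^sub>E UNIV (\<lambda>n. if n \<in> V - Z then {-1..1::real} else {0})"
  define S where "S = {0..K} \<times> B"
  have "compactin (product_topology (\<lambda>i. euclidean) UNIV) B"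
    unfolding B_def compactin_PiE by auto
  then have "compact B" by (simp add: euclidean_product_topology)
  then have S: "compact S" unfolding S_def by (intro compact_Times) auto
  define N where "N = (\<lambda>f. \<Sum>n\<in>V. (f n)\<^sup>2 :: real)"
  have coord: "continuous_on X (\<lambda>x. snd x n :: real)" for X :: "(real \<times> ('n \<Rightarrow> real)) set" and n
    by (rule continuous_on_compose2[OF continuous_on_product_coordinates continuous_on_snd])
       (auto intro: continuous_intros)
  have contN: "continuous_on S (\<lambda>x. N (snd x))"
    unfolding N_def by (intro continuous_intros coord)
  have contQ: "continuous_on S (\<lambda>x. form E \<tau> h (fst x) (snd x) (snd x))"
  proof -
    have sc: "continuous_on S (\<lambda>x. sn (fst x) (h e))" for e
    proof (rule continuous_on_compose2[of UNIV "\<lambda>k. sn k (h e)"])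
      show "continuous_on UNIV (\<lambda>k. sn k (h e))"
        by (simp add: continuous_on_eq_continuous_at isCont_sn)
    qed (auto intro: continuous_intros)
    have "sn (fst x) (h e) \<noteq> 0" if "e \<in> E" "x \<in> S" for e x
    proof -
      have k: "0 \<le> fst x" "fst x \<le> K" using that by (auto simp: S_def)
      then have "fst x * h e \<le> K * h e" using h[OF that(1)] by (intro mult_right_mono) auto
      with K(2)[OF that(1)] have "fst x * h e < pi" by linarith
      from sn_pos[OF k(1) h[OF that(1)] this] show "sn (fst x) (h e) \<noteq> 0" by simp
    qed
    moreover have "continuous_on S (\<lambda>x. cos (fst x * h e))" for e
    proof (rule continuous_on_compose2[of UNIV "\<lambda>k. cos (k * h e)" S fst])
      show "continuous_on UNIV (\<lambda>k. cos (k * h e))" by (intro continuous_intros)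
      show "continuous_on S fst" by (intro continuous_intros)
    qed simp
    ultimately show ?thesis
      unfolding form_def by (intro continuous_on_sum continuous_on_divide continuous_on_diff continuous_on_add
          continuous_on_mult coord sc) auto
  qed
  define M where "M = S \<inter> (\<lambda>x. (N (snd x), form E \<tau> h (fst x) (snd x) (snd x))) -` ({1} \<times> {..0})"
  have "compact M"
    unfolding M_def
    by (intro closedin_compact[OF S] continuous_closedin_preimage continuous_on_Pair contN contQ)
       (auto intro: closed_Times)
  moreover have scaled: "\<exists>c>0. (k, (\<lambda>n. c * (if n \<in> V - Z then f n else 0))) \<in> M"
    if f: "\<And>n. n \<in> Z \<Longrightarrow> f n = 0" "\<exists>e\<in>E. \<exists>b. f (\<tau> e b) \<noteq> 0" "form E \<tau> h k f f \<le> 0"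
      and k: "0 \<le> k" "k \<le> K" for f k
  proof -
    let ?f = "\<lambda>n. if n \<in> V - Z then f n else 0"
    obtain e b where eb: "e \<in> E" "f (\<tau> e b) \<noteq> 0" using f by blast
    then have "\<tau> e b \<in> V" "?f (\<tau> e b) \<noteq> 0" using f(1) V by auto
    then have pos: "0 < N ?f" unfolding N_def using finV
      by (intro sum_pos2[of _ "\<tau> e b"]) auto
    define c where "c = 1 / sqrt (N ?f)"
    have c: "0 < c" "c\<^sup>2 * N ?f = 1" using pos by (auto simp: c_def power_divide)
    let ?g = "\<lambda>n. c * ?f n"
    have Ng: "N ?g = 1" using c(2) unfolding N_def by (simp add: sum_distrib_left power_mult_distrib)
    have le: "(?g n)\<^sup>2 \<le> 1" for n
    proof (cases "n \<in> V - Z")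
      case True
      then have "(?g n)\<^sup>2 \<le> N ?g" unfolding N_def using finV
        by (intro member_le_sum[of n V "\<lambda>n. (?g n)\<^sup>2"]) auto
      with Ng show ?thesis by simp
    qed auto
    have "?g \<in> B"
      unfolding B_def
    proof (rule PiE_I)
      fix n
      show "?g n \<in> (if n \<in> V - Z then {- 1..1} else {0})"
        using abs_le_square_iff[of "?g n" 1] le[of n] by (auto simp: abs_le_iff)
    qed auto
    moreover have "form E \<tau> h k ?g ?g \<le> 0"
    proof -
      have "form E \<tau> h k ?f ?f = form E \<tau> h k f f"
        by (rule form_cong) (use V f(1) in auto)
      then show ?thesis unfolding form_scaled using f(3) by (simp add: mult_nonneg_nonpos)
    qed
    ultimately have "(k, ?g) \<in> M" unfolding M_def S_def using Ng k by simp
    with c(1) show ?thesis by blast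
  qed
  moreover have "M \<noteq> {}" using scaled[OF f0 K(1) order_refl] by blast
  ultimately obtain x where x: "x \<in> M" "\<And>y. y \<in> M \<Longrightarrow> fst x \<le> fst y"
    using continuous_attains_inf[of M fst] continuous_on_fst[OF continuous_on_id] by blast
  define k f where "k = fst x" and "f = snd x"
  have kf: "0 \<le> k" "k \<le> K" "f \<in> B" "N f = 1" "form E \<tau> h k f f \<le> 0"
    using x(1) by (auto simp: M_def S_def k_def f_def)
  have fZ: "f n = 0" if "n \<notin> V - Z" for n using kf(3) that by (auto simp: B_def PiE_iff dest: spec[of _ n])
  have pos: "0 < form E \<tau> h k' g g"
    if g: "\<And>n. n \<in> Z \<Longrightarrow> g n = 0" "\<exists>e\<in>E. \<exists>b. g (\<tau> e b) \<noteq> 0" and k': "0 \<le> k'" "k' < k" for g k'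
  proof (rule ccontr)
    assume "\<not> ?thesis"
    then obtain c where "(k', (\<lambda>n. c * (if n \<in> V - Z then g n else 0))) \<in> M"
      using scaled[OF g _ k'(1)] k'(2) kf(2) by auto
    from x(2)[OF this] k'(2) show False by (simp add: k_def)
  qed
  have psd: "0 \<le> form E \<tau> h k g g" if g: "\<And>n. n \<in> Z \<Longrightarrow> g n = 0" for g
  proof (cases "\<exists>e\<in>E. \<exists>b. g (\<tau> e b) \<noteq> 0")
    case False
    then have "form E \<tau> h k g g = 0" by (auto simp: form_def)
    then show ?thesis by simp
  next
    case True
    show ?thesis
    proof (cases "k = 0")
      case True
      then show ?thesis using form_0_nonneg h by blast
    next
      case False
      then have k: "0 < k" using kf by simp
      have "((\<lambda>k. form E \<tau> h k g g) \<longlongrightarrow> form E \<tau> h k g g) (at_left k)"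
      proof (rule tendsto_mono[OF at_le])
        have "isCont (\<lambda>k. form E \<tau> h k g g) k"
          unfolding form_def
        proof (intro continuous_intros isCont_sn)
          fix e assume e: "e \<in> E"
          then have "k * h e \<le> K * h e" using h[OF e] kf by (intro mult_right_mono) auto
          with sn_pos[OF kf(1) h[OF e]] K(2)[OF e] show "sn k (h e) \<noteq> 0" by simp
        qed
        then show "((\<lambda>k. form E \<tau> h k g g) \<longlongrightarrow> form E \<tau> h k g g) (at k)" by (simp add: isCont_def)
      qed auto
      moreover have "\<forall>\<^sub>F k' in at_left k. 0 \<le> form E \<tau> h k' g g"
        using eventually_at_left_real[OF k] by eventually_elim (use pos[OF g True] in \<open>auto intro: less_imp_le\<close>)
      ultimately show ?thesis by (rule tendsto_lowerbound) auto
    qed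
  qed
  have zero: "form E \<tau> h k f g = 0" if g: "\<And>n. n \<in> Z \<Longrightarrow> g n = 0" for g
  proof -
    have q0: "form E \<tau> h k f f = 0" using psd[of f] kf(5) fZ by force
    let ?b = "form E \<tau> h k f g" and ?q = "form E \<tau> h k g g"
    \<comment> \<open>A nonnegative quadratic polynomial without constant term has no linear term.\<close>
    have quad: "0 \<le> 2 * c * ?b + c\<^sup>2 * ?q" for c
      using psd[of "\<lambda>n. f n + c * g n"] g fZ unfolding form_add_scaled q0 by auto
    have q: "0 \<le> ?q" using psd[OF g] by simp
    have "0 \<le> 2 * (- (?b / (?q + 1))) * ?b + (- (?b / (?q + 1)))\<^sup>2 * ?q" by (rule quad)
    also have "\<dots> = - (?b\<^sup>2 * (?q + 2) / (?q + 1)\<^sup>2)"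
      using q by (simp add: power2_eq_square divide_simps) (simp add: algebra_simps)
    finally have "?b\<^sup>2 * (?q + 2) / (?q + 1)\<^sup>2 \<le> 0" by simp
    moreover have "0 < (?q + 2) / (?q + 1)\<^sup>2" using q by (intro divide_pos_pos) auto
    ultimately have "?b\<^sup>2 \<le> 0" by (metis mult_le_0_iff not_le times_divide_eq_right zero_le_power2)
    then show ?thesis by simp
  qed
  have nz: "\<exists>e\<in>E. \<exists>b. f (\<tau> e b) \<noteq> 0"
  proof (rule ccontr)
    assume "\<not> ?thesis"
    then have "N f = 0" unfolding N_def V_def by (intro sum.neutral) auto
    with kf(4) show False by simp
  qed
  have "(\<Sum>(e, b) | e \<in> E \<and> \<tau> e b = n. (f n * cos (k * h e) - f (\<tau> e (\<not> b))) / sn k (h e)) = 0"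
    if "n \<notin> Z" for n
  proof -
    have "form E \<tau> h k f (\<lambda>m. if m = n then 1 else 0) = 0" by (rule zero) (use that in auto)
    then show ?thesis unfolding form_indicator[OF fin] .
  qed
  with kf nz fZ show ?thesis by blast
qed

section \<open>Eigenfunctions as solutions of an ordinary differential equation\<close>

text \<open>The equation \<open>u'' = - \<mu> u\<close> on \<open>{0..l}\<close> as a first-order system with \<open>v = u'\<close>.\<close>

definition helmholtz :: "real \<Rightarrow> real \<Rightarrow> (real \<Rightarrow> real) \<Rightarrow> (real \<Rightarrow> real) \<Rightarrow> bool" where
  "helmholtz \<mu> l u v \<longleftrightarrow> (\<forall>x\<in>{0..l}. (u has_real_derivative v x) (at x within {0..l}) \<and>
     (v has_real_derivative - \<mu> * u x) (at x within {0..l}))"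

lemma edge_deriv_eq:
  assumes "0 < l" "x \<in> {0..l}" "(u has_real_derivative d) (at x within {0..l})"
  shows "edge_deriv l u x = d"
  unfolding edge_deriv_def
  using assms vector_derivative_within_cbox[of 0 l x u d]
  by (simp add: has_real_derivative_iff_has_vector_derivative)

text \<open>An eigenfunction is smooth: its second derivative \<open>- \<mu> u\<close> is continuous, so the integral identity
defining \<open>H\<^sup>2\<close> can be differentiated everywhere.\<close>

lemma H2_deriv2_helmholtz:
  assumes l: "0 < l"
  shows "H2_deriv2 l u (\<lambda>x. - (\<mu> * u x)) \<longleftrightarrow>
    (\<forall>x. x \<notin> {0..l} \<longrightarrow> u x = 0) \<and> helmholtz \<mu> l u (edge_deriv l u)"
proof (intro iffI conjI)
  assume H: "H2_deriv2 l u (\<lambda>x. - (\<mu> * u x))"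
  then show "\<forall>x. x \<notin> {0..l} \<longrightarrow> u x = 0" by (auto simp: H2_deriv2_def)
  have du: "(u has_real_derivative edge_deriv l u x) (at x within {0..l})" if "x \<in> {0..l}" for x
  proof -
    have "u differentiable (at x within {0..l})" using H that unfolding H2_deriv2_def by blast
    then show ?thesis
      unfolding edge_deriv_def has_real_derivative_iff_has_vector_derivative vector_derivative_works .
  qed
  then have cont: "continuous_on {0..l} (\<lambda>x. - (\<mu> * u x))"
    by (intro continuous_intros DERIV_continuous_on[OF du])
  have int: "(LINT t:{0..x}|lebesgue. - (\<mu> * u t)) = integral {0..x} (\<lambda>t. - (\<mu> * u t))" if "x \<in> {0..l}" for x
    by (rule set_lebesgue_integral_eq_integral, rule absolutely_integrable_continuous_real,
        rule continuous_on_subset[OF cont]) (use that in auto)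
  have "(edge_deriv l u has_real_derivative - \<mu> * u x) (at x within {0..l})" if x: "x \<in> {0..l}" for x
  proof -
    have "((\<lambda>x. edge_deriv l u 0 + integral {0..x} (\<lambda>t. - (\<mu> * u t))) has_real_derivative - (\<mu> * u x)) (at x within {0..l})"
      by (rule DERIV_cong[OF DERIV_add[OF DERIV_const integral_has_real_derivative[OF cont x]]]) simp
    then have "((\<lambda>x. edge_deriv l u 0 + integral {0..x} (\<lambda>t. - (\<mu> * u t))) has_real_derivative - \<mu> * u x) (at x within {0..l})"
      by simp
    then show ?thesis
    proof (rule has_field_derivative_transform_within[OF _ zero_less_one x])
      fix y assume y: "y \<in> {0..l}"
      then have "edge_deriv l u y = edge_deriv l u 0 + (LINT t:{0..y}|lebesgue. - (\<mu> * u t))"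
        using H unfolding H2_deriv2_def by blast
      then show "edge_deriv l u 0 + integral {0..y} (\<lambda>t. - (\<mu> * u t)) = edge_deriv l u y"
        using int[OF y] by linarith
    qed
  qed
  with du show "helmholtz \<mu> l u (edge_deriv l u)" by (simp add: helmholtz_def)
next
  assume H: "(\<forall>x. x \<notin> {0..l} \<longrightarrow> u x = 0) \<and> helmholtz \<mu> l u (edge_deriv l u)"
  then have du: "\<And>x. x \<in> {0..l} \<Longrightarrow> (u has_real_derivative edge_deriv l u x) (at x within {0..l})"
    and dv: "\<And>x. x \<in> {0..l} \<Longrightarrow> (edge_deriv l u has_real_derivative - (\<mu> * u x)) (at x within {0..l})"
    by (auto simp: helmholtz_def)
  have cont: "continuous_on {0..l} (\<lambda>x. - (\<mu> * u x))"
    by (intro continuous_intros DERIV_continuous_on[OF du])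
  have int: "(LINT t:{0..x}|lebesgue. - (\<mu> * u t)) = integral {0..x} (\<lambda>t. - (\<mu> * u t))" if "x \<in> {0..l}" for x
    by (rule set_lebesgue_integral_eq_integral, rule absolutely_integrable_continuous_real,
        rule continuous_on_subset[OF cont]) (use that in auto)
  have ftc: "integral {0..x} (\<lambda>t. - (\<mu> * u t)) = edge_deriv l u x - edge_deriv l u 0" if x: "x \<in> {0..l}" for x
  proof (rule integral_unique, rule fundamental_theorem_of_calculus)
    fix y assume "y \<in> {0..x}"
    then show "(edge_deriv l u has_vector_derivative - (\<mu> * u y)) (at y within {0..x})"
      unfolding has_real_derivative_iff_has_vector_derivative[symmetric]
      using x by (intro has_field_derivative_subset[OF dv]) auto
  qed (use x in auto)
  have "set_integrable lebesgue {0..l} (\<lambda>x. - (\<mu> * u x))"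
    by (rule absolutely_integrable_continuous_real[OF cont])
  moreover have "set_integrable lebesgue {0..l} (\<lambda>x. (- (\<mu> * u x))\<^sup>2)"
    by (intro absolutely_integrable_continuous_real continuous_intros cont)
  ultimately show "H2_deriv2 l u (\<lambda>x. - (\<mu> * u x))"
    unfolding H2_deriv2_def
  proof (intro conjI ballI)
    show "\<forall>x. x \<notin> {0..l} \<longrightarrow> u x = 0" using H by blast
    fix x assume x: "x \<in> {0..l}"
    show "u differentiable at x within {0..l}"
      using du[OF x] by (metis real_differentiable_def)
    show "edge_deriv l u x = edge_deriv l u 0 + (LINT t:{0..x}|lebesgue. - (\<mu> * u t))"
      using int[OF x] ftc[OF x] by linarith
  next
    show "set_borel_measurable lebesgue {0..l} (\<lambda>x. - (\<mu> * u x))"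
      if "set_integrable lebesgue {0..l} (\<lambda>x. - (\<mu> * u x))"
      using that unfolding set_integrable_def set_borel_measurable_def by (rule borel_measurable_integrable)
  qed
qed

lemma has_derivative_sn: "((\<lambda>x. sn k x) has_real_derivative cos (k * x)) (at x within S)"
proof (cases "k = 0")
  case True
  then show ?thesis by (simp add: sn_def[abs_def])
next
  case False
  then have "((\<lambda>x. sin (k * x) / k) has_real_derivative cos (k * x)) (at x within S)"
    by (auto intro!: derivative_eq_intros)
  with False show ?thesis by (simp add: sn_def[abs_def])
qed

lemma helmholtz_trig:
  "helmholtz (k\<^sup>2) l (\<lambda>x. A * cos (k * x) + B * sn k x) (\<lambda>x. B * cos (k * x) - A * k\<^sup>2 * sn k x)"
  unfolding helmholtz_def
  by (auto intro!: derivative_eq_intros has_derivative_sn simp: algebra_simps sn_def power2_eq_square)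

lemma helmholtz_linear:
  assumes "helmholtz \<mu> l u v" "helmholtz \<mu> l u' v'"
  shows "helmholtz \<mu> l (\<lambda>x. a * u x + b * u' x) (\<lambda>x. a * v x + b * v' x)"
  using assms unfolding helmholtz_def
  by (auto intro!: derivative_eq_intros simp: algebra_simps)

lemma const_if_derivative_zero:
  assumes "\<And>x. x \<in> {0..l} \<Longrightarrow> (f has_real_derivative 0) (at x within {0..l})" "x \<in> {0..l}"
  shows "f x = (f 0 :: real)"
  using has_derivative_zero_unique[of "{0..l}" f x 0] assms
  by (auto simp: has_field_derivative_def lambda_zero mult_zero_left)

text \<open>The quantity \<open>v\<^sup>2 + k\<^sup>2 u\<^sup>2\<close> is conserved.\<close>

lemma helmholtz_zero:
  assumes H: "helmholtz (k\<^sup>2) l u v" and "u 0 = 0" "v 0 = 0" and x: "x \<in> {0..l}"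
  shows "u x = 0 \<and> v x = 0"
proof -
  have d: "((\<lambda>x. (v x)\<^sup>2 + k\<^sup>2 * (u x)\<^sup>2) has_real_derivative 0) (at x within {0..l})" if "x \<in> {0..l}" for x
    using H that unfolding helmholtz_def
    by (auto intro!: derivative_eq_intros simp: algebra_simps)
  have e: "(v x)\<^sup>2 + k\<^sup>2 * (u x)\<^sup>2 = 0" if "x \<in> {0..l}" for x
    using const_if_derivative_zero[OF d that] assms by simp
  have v: "v x = 0" if "x \<in> {0..l}" for x
    using e[OF that] by (metis add_nonneg_eq_0_iff mult_nonneg_nonneg power_eq_0_iff zero_le_power2)
  have "(u has_real_derivative 0) (at x within {0..l})" if "x \<in> {0..l}" for x
  proof -
    have "(u has_real_derivative v x) (at x within {0..l})" using H that unfolding helmholtz_def by blast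
    then show ?thesis by (simp only: v[OF that])
  qed
  from const_if_derivative_zero[OF this x] v[OF x] assms show ?thesis by simp
qed

lemma helmholtz_unique:
  assumes "helmholtz (k\<^sup>2) l u v" "x \<in> {0..l}"
  shows "u x = u 0 * cos (k * x) + v 0 * sn k x" "v x = v 0 * cos (k * x) - u 0 * k\<^sup>2 * sn k x"
proof -
  have "helmholtz (k\<^sup>2) l (\<lambda>x. 1 * u x + (-1) * (u 0 * cos (k * x) + v 0 * sn k x))
    (\<lambda>x. 1 * v x + (-1) * (v 0 * cos (k * x) - u 0 * k\<^sup>2 * sn k x))"
    by (rule helmholtz_linear[OF assms(1) helmholtz_trig])
  from helmholtz_zero[OF this _ _ assms(2)]
  show "u x = u 0 * cos (k * x) + v 0 * sn k x" "v x = v 0 * cos (k * x) - u 0 * k\<^sup>2 * sn k x"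
    by simp_all
qed

text \<open>The selector \<open>b\<close> of the dart \<open>(e, b)\<close> is true at the source, where the coordinate is \<open>0\<close>, so that
\<open>sg b\<close> is the direction of the coordinate that points into the edge.\<close>

definition endpt :: "('v, 'e) mgraph \<Rightarrow> 'e \<Rightarrow> bool \<Rightarrow> 'v" where
  "endpt G e b = (if b then src G e else tgt G e)"

definition end_pos :: "('v, 'e) mgraph \<Rightarrow> 'e \<Rightarrow> bool \<Rightarrow> real" where
  "end_pos G e b = (if b then 0 else len G e)"

definition sg :: "bool \<Rightarrow> real" where "sg b = (if b then 1 else - 1)"

definition darts :: "('v, 'e) mgraph \<Rightarrow> 'v \<Rightarrow> ('e \<times> bool) set" where
  "darts G w = {(e, b). e \<in> edges G \<and> endpt G e b = w}"

lemma sum_darts_at: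
  assumes "finite (edges G)"
  shows "(\<Sum>(e, b)\<in>darts G w. g e b) =
    (\<Sum>e | e \<in> edges G \<and> src G e = w. g e True) + (\<Sum>e | e \<in> edges G \<and> tgt G e = w. g e False)"
proof -
  have *: "darts G w = (\<lambda>e. (e, True)) ` {e. e \<in> edges G \<and> src G e = w} \<union>
      (\<lambda>e. (e, False)) ` {e. e \<in> edges G \<and> tgt G e = w}"
    by (auto simp: darts_def endpt_def split: if_splits)
  show ?thesis
    unfolding * using assms by (subst sum.union_disjoint) (auto simp: sum.reindex inj_on_def)
qed

text \<open>The function \<open>v\<close> is the derivative along the edges, and \<open>\<phi>\<close> gives the values at the vertices.\<close>

definition eigen_data :: "('v, 'e) mgraph \<Rightarrow> real \<Rightarrow> ('e \<Rightarrow> real \<Rightarrow> real) \<Rightarrow> ('e \<Rightarrow> real \<Rightarrow> real) \<Rightarrow> ('v \<Rightarrow> real) \<Rightarrow> bool" where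
  "eigen_data G \<mu> f v \<phi> \<longleftrightarrow>
    (\<forall>e. e \<notin> edges G \<longrightarrow> f e = (\<lambda>_. 0)) \<and>
    (\<forall>e\<in>edges G. (\<forall>x. x \<notin> {0..len G e} \<longrightarrow> f e x = 0) \<and> helmholtz \<mu> (len G e) (f e) (v e) \<and>
       (\<forall>b. f e (end_pos G e b) = \<phi> (endpt G e b))) \<and>
    (\<forall>w\<in>verts G. (\<Sum>(e, b)\<in>darts G w. sg b * v e (end_pos G e b)) = 0)"

lemma kirchhoff_eq:
  assumes G: "compact_metric_graph G"
    and v: "\<And>e. e \<in> edges G \<Longrightarrow> helmholtz \<mu> (len G e) (f e) (v e)"
  shows "(\<Sum>e | e \<in> edges G \<and> src G e = w. edge_deriv (len G e) (f e) 0) +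
        (\<Sum>e | e \<in> edges G \<and> tgt G e = w. - edge_deriv (len G e) (f e) (len G e)) =
     (\<Sum>(e, b)\<in>darts G w. sg b * v e (end_pos G e b))"
proof -
  have "edge_deriv (len G e) (f e) x = v e x" if "e \<in> edges G" "x \<in> {0..len G e}" for e x
  proof (rule edge_deriv_eq)
    show "0 < len G e" using G that by (auto simp: compact_metric_graph_def)
    show "(f e has_real_derivative v e x) (at x within {0..len G e})"
      using v[OF that(1)] that(2) by (auto simp: helmholtz_def)
  qed (use that in auto)
  then have "edge_deriv (len G e) (f e) 0 = v e 0" "edge_deriv (len G e) (f e) (len G e) = v e (len G e)"
    if "e \<in> edges G" for e using that G by (auto simp: compact_metric_graph_def less_imp_le)
  moreover have "finite (edges G)" using G by (simp add: compact_metric_graph_def)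
  ultimately show ?thesis by (simp add: sum_darts_at sg_def end_pos_def)
qed

lemma helmholtz_cong:
  assumes "helmholtz \<mu> l u v" "\<And>x. x \<in> {0..l} \<Longrightarrow> v x = v' x"
  shows "helmholtz \<mu> l u v'"
  unfolding helmholtz_def
proof (intro ballI conjI)
  fix x assume x: "x \<in> {0..l}"
  show "(u has_real_derivative v' x) (at x within {0..l})"
    using assms x unfolding helmholtz_def by metis
  show "(v' has_real_derivative - \<mu> * u x) (at x within {0..l})"
    by (rule has_field_derivative_transform_within[of v _ _ _ 1]) (use assms x in \<open>auto simp: helmholtz_def\<close>)
qed

lemma eigenspace_iff:
  assumes G: "compact_metric_graph G"
  shows "f \<in> eigenspace G \<mu> \<longleftrightarrow> (\<exists>v \<phi>. eigen_data G \<mu> f v \<phi>)"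
proof
  have len: "0 < len G e" if "e \<in> edges G" for e using G that by (auto simp: compact_metric_graph_def)
  {
    assume f: "f \<in> eigenspace G \<mu>"
    then have dom: "f \<in> standard_domain G"
      and H2: "\<And>e. e \<in> edges G \<Longrightarrow> H2_deriv2 (len G e) (f e) (\<lambda>x. - (\<mu> * f e x))"
      by (auto simp: eigenspace_def has_laplacian_def graph_scale_def)
    from dom obtain \<phi> where \<phi>: "\<forall>e\<in>edges G. f e 0 = \<phi> (src G e) \<and> f e (len G e) = \<phi> (tgt G e)"
      by (auto simp: standard_domain_def)
    have hz: "\<forall>x. x \<notin> {0..len G e} \<longrightarrow> f e x = 0"
      "helmholtz \<mu> (len G e) (f e) (edge_deriv (len G e) (f e))" if "e \<in> edges G" for e
      using H2[OF that] unfolding H2_deriv2_helmholtz[OF len[OF that]] by auto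
    have "eigen_data G \<mu> f (\<lambda>e. edge_deriv (len G e) (f e)) \<phi>"
      unfolding eigen_data_def
    proof (intro conjI ballI allI impI)
      show "f e = (\<lambda>_. 0)" if "e \<notin> edges G" for e using dom that by (auto simp: standard_domain_def)
      show "f e (end_pos G e b) = \<phi> (endpt G e b)" if "e \<in> edges G" for e b
        using \<phi> that by (auto simp: end_pos_def endpt_def)
      show "(\<Sum>(e, b)\<in>darts G w. sg b * edge_deriv (len G e) (f e) (end_pos G e b)) = 0" if "w \<in> verts G" for w
        unfolding kirchhoff_eq[OF G hz(2), symmetric, simplified] using dom that
        by (simp add: standard_domain_def)
    qed (use hz in auto)
    then show "\<exists>v \<phi>. eigen_data G \<mu> f v \<phi>" by blast
  next
    assume "\<exists>v \<phi>. eigen_data G \<mu> f v \<phi>"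
    then obtain v \<phi> where D: "eigen_data G \<mu> f v \<phi>" by blast
    then have hz: "\<And>e. e \<in> edges G \<Longrightarrow> helmholtz \<mu> (len G e) (f e) (v e)" by (auto simp: eigen_data_def)
    have "helmholtz \<mu> (len G e) (f e) (edge_deriv (len G e) (f e))" if "e \<in> edges G" for e
    proof (rule helmholtz_cong[OF hz[OF that]])
      fix x assume "x \<in> {0..len G e}"
      then show "v e x = edge_deriv (len G e) (f e) x"
        using edge_deriv_eq[OF len[OF that], of x "f e" "v e x"] hz[OF that] by (simp add: helmholtz_def)
    qed
    then have H2: "H2_deriv2 (len G e) (f e) (\<lambda>x. - (\<mu> * f e x))" if "e \<in> edges G" for e
      unfolding H2_deriv2_helmholtz[OF len[OF that]] using D that by (auto simp: eigen_data_def)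
    have end0: "f e 0 = \<phi> (src G e) \<and> f e (len G e) = \<phi> (tgt G e)" if "e \<in> edges G" for e
    proof -
      have "f e (end_pos G e b) = \<phi> (endpt G e b)" for b using D that by (auto simp: eigen_data_def)
      from this[of True] this[of False] show ?thesis by (simp add: end_pos_def endpt_def)
    qed
    have "f \<in> standard_domain G"
      unfolding standard_domain_def kirchhoff_eq[OF G hz]
    proof (intro CollectI conjI)
      show "\<exists>\<phi>. \<forall>e\<in>edges G. f e 0 = \<phi> (src G e) \<and> f e (len G e) = \<phi> (tgt G e)" using end0 by blast
      show "\<forall>w\<in>verts G. (\<Sum>e | e \<in> edges G \<and> src G e = w. edge_deriv (len G e) (f e) 0) +
        (\<Sum>e | e \<in> edges G \<and> tgt G e = w. - edge_deriv (len G e) (f e) (len G e)) = 0"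
        using kirchhoff_eq[OF G hz] D by (simp add: eigen_data_def)
    qed (use D H2 in \<open>auto simp: eigen_data_def\<close>)
    with H2 show "f \<in> eigenspace G \<mu>" by (auto simp: eigenspace_def has_laplacian_def graph_scale_def)
  }
qed

section \<open>Counting eigenvalues\<close>

interpretation gs: vector_space graph_scale by (rule vector_space_graph_scale)

lemma graph_scale_apply [simp]: "graph_scale c f e x = c * f e x" by (simp add: graph_scale_def)

lemma compact_metric_graphD:
  assumes "compact_metric_graph G"
  shows "finite (edges G)" "finite (verts G)" "e \<in> edges G \<Longrightarrow> 0 < len G e" "e \<in> edges G \<Longrightarrow> endpt G e b \<in> verts G"
  using assms by (auto simp: compact_metric_graph_def endpt_def)

lemma eigen_dataD:
  assumes "eigen_data G \<mu> f v \<phi>"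
  shows "e \<notin> edges G \<Longrightarrow> f e x = 0" "e \<in> edges G \<Longrightarrow> x \<notin> {0..len G e} \<Longrightarrow> f e x = 0"
    "e \<in> edges G \<Longrightarrow> helmholtz \<mu> (len G e) (f e) (v e)"
    "e \<in> edges G \<Longrightarrow> f e (end_pos G e b) = \<phi> (endpt G e b)"
    "w \<in> verts G \<Longrightarrow> (\<Sum>(e, b)\<in>darts G w. sg b * v e (end_pos G e b)) = 0"
  using assms by (auto simp: eigen_data_def)

lemma zero_in_eigenspace: "compact_metric_graph G \<Longrightarrow> 0 \<in> eigenspace G \<mu>"
  unfolding eigenspace_iff
  by (rule exI[of _ "\<lambda>_ _. 0"], rule exI[of _ "\<lambda>_. 0"]) (auto simp: eigen_data_def helmholtz_def zero_fun_def)

lemma dart_sum_swap: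
  assumes G: "compact_metric_graph G"
  shows "(\<Sum>w\<in>verts G. \<Sum>(e, b)\<in>darts G w. g e b) = (\<Sum>e\<in>edges G. g e True + g e False)"
proof -
  have "(\<Sum>w\<in>verts G. \<Sum>(e, b)\<in>darts G w. g e b) =
      (\<Sum>w\<in>verts G. sum (\<lambda>(e, b). g e b) {d \<in> edges G \<times> UNIV. endpt G (fst d) (snd d) = w})"
    by (intro sum.cong refl) (auto simp: darts_def)
  also have "\<dots> = (\<Sum>(e, b)\<in>edges G \<times> UNIV. g e b)"
    by (rule sum.group) (use compact_metric_graphD[OF G] in auto)
  also have "\<dots> = (\<Sum>e\<in>edges G. g e True + g e False)" by (simp add: sum_darts)
  finally show ?thesis .
qed

text \<open>The function \<open>f f'\<close> has derivative \<open>f'\<^sup>2 - \<mu> f\<^sup>2\<close>, which is nonnegative for \<open>\<mu> \<le> 0\<close>. The vertex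
conditions make the total increment of \<open>f f'\<close> over all edges zero, so \<open>f f'\<close> is constant on each
edge.\<close>

lemma nonpos_eigen_derivative_zero:
  assumes G: "compact_metric_graph G" and D: "eigen_data G \<mu> f v \<phi>" and \<mu>: "\<mu> \<le> 0"
    and e: "e \<in> edges G" "x \<in> {0..len G e}"
  shows "(v e x)\<^sup>2 - \<mu> * (f e x)\<^sup>2 = 0"
proof -
  let ?p = "\<lambda>e x. f e x * v e x"
  have der: "(?p e has_real_derivative (v e x)\<^sup>2 - \<mu> * (f e x)\<^sup>2) (at x within {0..len G e})"
    if "e \<in> edges G" "x \<in> {0..len G e}" for e x
    using eigen_dataD(3)[OF D that(1)] that(2) unfolding helmholtz_def
    by (auto intro!: derivative_eq_intros simp: power2_eq_square algebra_simps)
  have nn: "0 \<le> (v e x)\<^sup>2 - \<mu> * (f e x)\<^sup>2" for e x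
    using mult_nonpos_nonneg[OF \<mu> zero_le_power2[of "f e x"]] zero_le_power2[of "v e x"] by linarith
  have mono: "?p e x \<le> ?p e y" if "e \<in> edges G" "0 \<le> x" "x \<le> y" "y \<le> len G e" for e x y
  proof (rule DERIV_nonneg_imp_increasing_open[OF that(3)])
    fix z assume z: "x < z" "z < y"
    then have "at z within {0..len G e} = at z" using that by (intro at_within_interior) auto
    with der[OF that(1), of z] nn z that show "\<exists>d. (?p e has_real_derivative d) (at z) \<and> 0 \<le> d" by auto
  next
    show "continuous_on {x..y} (?p e)"
      by (rule continuous_on_subset[OF DERIV_continuous_on[OF der[OF that(1)]]]) (use that in auto)
  qed
  have "(\<Sum>e\<in>edges G. ?p e (len G e) - ?p e 0) =
      - (\<Sum>w\<in>verts G. \<Sum>(e, b)\<in>darts G w. f e (end_pos G e b) * (sg b * v e (end_pos G e b)))"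
    unfolding dart_sum_swap[OF G] by (simp add: sum_negf[symmetric] end_pos_def sg_def)
  also have "(\<Sum>w\<in>verts G. \<Sum>(e, b)\<in>darts G w. f e (end_pos G e b) * (sg b * v e (end_pos G e b))) =
     (\<Sum>w\<in>verts G. \<phi> w * (\<Sum>(e, b)\<in>darts G w. sg b * v e (end_pos G e b)))"
    unfolding sum_distrib_left using eigen_dataD(4)[OF D]
    by (intro sum.cong refl) (auto simp: darts_def)
  also have "\<dots> = 0" using eigen_dataD(5)[OF D] by simp
  finally have "(\<Sum>e\<in>edges G. ?p e (len G e) - ?p e 0) = 0" by simp
  moreover have "0 \<le> ?p e (len G e) - ?p e 0" if "e \<in> edges G" for e
    using mono[OF that, of 0 "len G e"] compact_metric_graphD(3)[OF G that] by simp
  ultimately have "?p e (len G e) = ?p e 0"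
    using compact_metric_graphD(1)[OF G] e by (simp add: sum_nonneg_eq_0_iff)
  then have const: "?p e y = ?p e 0" if "y \<in> {0..len G e}" for y
    using mono[OF e(1), of 0 y] mono[OF e(1), of y "len G e"] that by auto
  have "(?p e has_real_derivative 0) (at x within {0..len G e})"
  proof (rule has_field_derivative_transform_within[OF DERIV_const zero_less_one e(2)])
    show "?p e 0 = ?p e y" if "y \<in> {0..len G e}" for y using const[OF that] by (rule sym)
  qed
  from edge_deriv_eq[OF compact_metric_graphD(3)[OF G e(1)] e(2) this]
    edge_deriv_eq[OF compact_metric_graphD(3)[OF G e(1)] e(2) der[OF e]]
  show ?thesis by linarith
qed

lemma multiplicity_negative:
  assumes G: "compact_metric_graph G" and \<mu>: "\<mu> < 0"
  shows "multiplicity_of G \<mu> = 0"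
proof -
  have "f = 0" if f: "f \<in> eigenspace G \<mu>" for f
  proof (intro ext)
    fix e x
    obtain v \<phi> where D: "eigen_data G \<mu> f v \<phi>" using f unfolding eigenspace_iff[OF G] by blast
    show "f e x = 0 e x"
    proof (cases "e \<in> edges G \<and> x \<in> {0..len G e}")
      case True
      then have "(v e x)\<^sup>2 - \<mu> * (f e x)\<^sup>2 = 0"
        using nonpos_eigen_derivative_zero[OF G D] \<mu> by simp
      moreover have "0 \<le> - \<mu> * (f e x)\<^sup>2" using \<mu> by (intro mult_nonneg_nonneg) auto
      ultimately have "\<mu> * (f e x)\<^sup>2 = 0" using zero_le_power2[of "v e x"] by linarith
      then show ?thesis using \<mu> by simp
    next
      case False
      then show ?thesis using eigen_dataD(1,2)[OF D] by auto
    qed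
  qed
  then have "eigenspace G \<mu> = {0}" using zero_in_eigenspace[OF G] by blast
  then show ?thesis unfolding multiplicity_of_def using gs.dim_unique[of "{}" "{0}" 0] by (simp add: gs.span_empty gs.independent_empty)
qed

text \<open>An eigenfunction is determined on each edge by its value and derivative at \<open>0\<close>. Finite dimension
matters because the dimension of an infinite-dimensional space is \<open>0\<close> by convention.\<close>

lemma eigenspace_finite_span:
  assumes G: "compact_metric_graph G" and \<mu>: "0 \<le> \<mu>"
  shows "\<exists>T. finite T \<and> eigenspace G \<mu> \<subseteq> gs.span T"
proof -
  define k where "k = sqrt \<mu>"
  have k: "k\<^sup>2 = \<mu>" using \<mu> by (simp add: k_def)
  define bc where "bc = (\<lambda>e0 e x. if e = e0 \<and> x \<in> {0..len G e} then cos (k * x) else (0::real))"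
  define bs where "bs = (\<lambda>e0 e x. if e = e0 \<and> x \<in> {0..len G e} then sn k x else (0::real))"
  define T where "T = bc ` edges G \<union> bs ` edges G"
  have fin: "finite (edges G)" using compact_metric_graphD[OF G] by blast
  have "f \<in> gs.span T" if f: "f \<in> eigenspace G \<mu>" for f
  proof -
    obtain v \<phi> where D: "eigen_data G \<mu> f v \<phi>" using f unfolding eigenspace_iff[OF G] by blast
    have "f = (\<Sum>e\<in>edges G. graph_scale (f e 0) (bc e) + graph_scale (v e 0) (bs e))"
    proof (intro ext)
      fix e x
      have ev: "(\<Sum>a\<in>A. F a) e x = (\<Sum>a\<in>A. F a e x)" if "finite A" for A and F :: "'b \<Rightarrow> 'b \<Rightarrow> real \<Rightarrow> real"
        using that by (induction A rule: finite_induct) auto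
      have "(\<Sum>a\<in>edges G. graph_scale (f a 0) (bc a) + graph_scale (v a 0) (bs a)) e x =
        (\<Sum>a\<in>edges G. if a = e then (if x \<in> {0..len G e} then f e 0 * cos (k * x) + v e 0 * sn k x else 0) else 0)"
        unfolding ev[OF fin] by (intro sum.cong refl) (auto simp: bc_def bs_def)
      also have "\<dots> = (if e \<in> edges G \<and> x \<in> {0..len G e} then f e 0 * cos (k * x) + v e 0 * sn k x else 0)"
        using fin by simp
      also have "\<dots> = f e x"
      proof (cases "e \<in> edges G \<and> x \<in> {0..len G e}")
        case True
        then have "helmholtz (k\<^sup>2) (len G e) (f e) (v e)" using eigen_dataD(3)[OF D] by (simp add: k)
        from helmholtz_unique(1)[OF this, of x] True
        have "f e x = f e 0 * cos (k * x) + v e 0 * sn k x" by blast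
        then show ?thesis by (subst if_P[OF True]) (rule sym)
      next
        case False
        then have "f e x = 0" using eigen_dataD(1,2)[OF D] by blast
        then show ?thesis by (subst if_not_P[OF False]) (rule sym)
      qed
      finally show "f e x = (\<Sum>a\<in>edges G. graph_scale (f a 0) (bc a) + graph_scale (v a 0) (bs a)) e x" by simp
    qed
    also have "\<dots> \<in> gs.span T"
      by (intro gs.span_sum gs.span_add gs.span_scale gs.span_base) (auto simp: T_def)
    finally show ?thesis .
  qed
  moreover have "finite T" using fin by (simp add: T_def)
  ultimately show ?thesis by blast
qed

lemma card_le_multiplicity:
  assumes G: "compact_metric_graph G" and \<mu>: "0 \<le> \<mu>"
    and B: "gs.independent B" "B \<subseteq> eigenspace G \<mu>"
  shows "card B \<le> multiplicity_of G \<mu>"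
proof -
  obtain T where T: "finite T" "eigenspace G \<mu> \<subseteq> gs.span T" using eigenspace_finite_span[OF G \<mu>] by blast
  obtain C where C: "C \<subseteq> eigenspace G \<mu>" "gs.independent C" "eigenspace G \<mu> \<subseteq> gs.span C"
      "card C = gs.dim (eigenspace G \<mu>)"
    using gs.basis_exists by blast
  have "finite C" using gs.independent_span_bound[OF T(1) C(2)] C(1) T(2) by blast
  from gs.independent_span_bound[OF this B(1)] B(2) C(3,4) show ?thesis
    unfolding multiplicity_of_def by auto
qed

text \<open>The infimum is over a set that is bounded below, since negative numbers have multiplicity \<open>0\<close>.\<close>

lemma eigenvalue_le:
  assumes G: "compact_metric_graph G" and k: "1 \<le> k"
    and M: "finite M" "M \<subseteq> {..c}" "k \<le> (\<Sum>\<mu>\<in>M. multiplicity_of G \<mu>)"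
  shows "eigenvalue G k \<le> c"
  unfolding eigenvalue_def
proof (rule cInf_lower)
  show "c \<in> {c. \<exists>M. finite M \<and> M \<subseteq> {..c} \<and> k \<le> (\<Sum>\<mu>\<in>M. multiplicity_of G \<mu>)}" using M by blast
  show "bdd_below {c. \<exists>M. finite M \<and> M \<subseteq> {..c} \<and> k \<le> (\<Sum>\<mu>\<in>M. multiplicity_of G \<mu>)}"
  proof (rule bdd_belowI[of _ 0], safe, rule ccontr)
    fix c M assume *: "\<not> 0 \<le> c" "finite M" "M \<subseteq> {..c}" "k \<le> (\<Sum>\<mu>\<in>M. multiplicity_of G \<mu>)"
    have "(\<Sum>\<mu>\<in>M. multiplicity_of G \<mu>) = 0"
      using * by (intro sum.neutral ballI multiplicity_negative[OF G]) auto
    with * k show False by simp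
  qed
qed

definition const_one :: "('v, 'e) mgraph \<Rightarrow> 'e \<Rightarrow> real \<Rightarrow> real" where
  "const_one G = (\<lambda>e x. if e \<in> edges G \<and> x \<in> {0..len G e} then 1 else 0)"

lemma const_one_eigenspace:
  assumes G: "compact_metric_graph G"
  shows "const_one G \<in> eigenspace G 0"
proof -
  have "eigen_data G 0 (const_one G) (\<lambda>_ _. 0) (\<lambda>_. 1)"
    unfolding eigen_data_def
  proof (intro conjI ballI allI impI)
    fix e assume e: "e \<in> edges G"
    then have l: "0 < len G e" using compact_metric_graphD(3)[OF G] by blast
    show "const_one G e (end_pos G e b) = 1" for b using e l by (simp add: const_one_def end_pos_def)
    show "const_one G e x = 0" if "x \<notin> {0..len G e}" for x using that by (auto simp: const_one_def)
    show "helmholtz 0 (len G e) (const_one G e) (\<lambda>_. 0)"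
      unfolding helmholtz_def
    proof (intro conjI ballI)
      fix x assume x: "x \<in> {0..len G e}"
      show "(const_one G e has_real_derivative 0) (at x within {0..len G e})"
        by (rule has_field_derivative_transform_within[of "\<lambda>_. 1" _ _ _ 1]) (use x e in \<open>auto simp: const_one_def\<close>)
    qed auto
  qed (auto simp: const_one_def)
  then show ?thesis unfolding eigenspace_iff[OF G] by blast
qed

text \<open>If \<open>c > 0\<close>, the eigenvalues \<open>0\<close> and \<open>c\<close> are different; if \<open>c = 0\<close>, the function \<open>f\<close> and the constant
are two independent elements of the same eigenspace.\<close>

lemma eigenvalue_2_le:
  assumes G: "compact_metric_graph G" and c: "0 \<le> c" and f: "f \<in> eigenspace G c" "f \<noteq> 0"
    and nc: "\<And>a. c = 0 \<Longrightarrow> f \<noteq> graph_scale a (const_one G)"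
  shows "eigenvalue G 2 \<le> c"
proof -
  obtain e x where ex: "f e x \<noteq> 0" using f(2) by (auto simp: fun_eq_iff)
  obtain v \<phi> where D: "eigen_data G c f v \<phi>" using f(1) unfolding eigenspace_iff[OF G] by blast
  have "e \<in> edges G" using eigen_dataD(1)[OF D, of e x] ex by blast
  then have "const_one G e 0 = 1" using compact_metric_graphD(3)[OF G] by (simp add: const_one_def less_imp_le)
  then have one: "const_one G \<noteq> 0" by (metis zero_fun_def zero_neq_one)
  have one_le: "1 \<le> multiplicity_of G 0"
    using card_le_multiplicity[OF G _ _, of 0 "{const_one G}"] one const_one_eigenspace[OF G] by simp
  show ?thesis
  proof (cases "c = 0")
    case True
    have "gs.independent {f, const_one G}"
    proof (rule gs.independent_insertI)
      show "f \<notin> gs.span {const_one G}"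
        using nc[OF True] by (auto simp: gs.span_singleton)
    qed (use one in simp)
    then have "card {f, const_one G} \<le> multiplicity_of G 0"
      using f True const_one_eigenspace[OF G] by (intro card_le_multiplicity[OF G]) auto
    moreover have "f \<noteq> const_one G" using nc[OF True, of 1] by auto
    ultimately show ?thesis using True by (intro eigenvalue_le[OF G, of _ "{0}"]) auto
  next
    case False
    have "1 \<le> multiplicity_of G c"
      using card_le_multiplicity[OF G c, of "{f}"] f by simp
    with one_le False c show ?thesis by (intro eigenvalue_le[OF G, of _ "{0, c}"]) auto
  qed
qed

section \<open>The double of a graph\<close>

text \<open>Every edge is cut into \<open>N\<close> equal pieces. The nodes are the vertices and, on the edge \<open>e\<close>, the points
\<open>(e, i)\<close> with \<open>0 < i < N\<close>; the piece \<open>(e, i)\<close> joins the points with indices \<open>i\<close> and \<open>i + 1\<close>.\<close>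

definition sub_node :: "('v, 'e) mgraph \<Rightarrow> nat \<Rightarrow> 'e \<Rightarrow> nat \<Rightarrow> 'v + 'e \<times> nat" where
  "sub_node G N e i = (if i = 0 then Inl (src G e) else if i = N then Inl (tgt G e) else Inr (e, i))"

definition sub_end :: "('v, 'e) mgraph \<Rightarrow> nat \<Rightarrow> 'e \<times> nat \<Rightarrow> bool \<Rightarrow> 'v + 'e \<times> nat" where
  "sub_end G N d b = sub_node G N (fst d) (if b then snd d else Suc (snd d))"

text \<open>The piece of an edge that contains the dart selected by \<open>b\<close>.\<close>

definition end_index :: "nat \<Rightarrow> bool \<Rightarrow> nat" where "end_index N b = (if b then 0 else N - 1)"

lemma end_index_less: "0 < N \<Longrightarrow> end_index N b < N" by (simp add: end_index_def)

lemma sub_end_end_index: "0 < N \<Longrightarrow> sub_end G N (e, end_index N b) b = Inl (endpt G e b)"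
  by (auto simp: sub_end_def sub_node_def end_index_def endpt_def)

lemma sub_end_Inl:
  assumes "sub_end G N (e, i) b = Inl w" "i < N"
  shows "i = end_index N b" "w = endpt G e b"
  using assms by (auto simp: sub_end_def sub_node_def end_index_def endpt_def split: if_splits)

lemma sub_end_Inr:
  assumes "sub_end G N (e, i) b = Inr (e', j)" "i < N"
  shows "e' = e" "j = (if b then i else Suc i)" "0 < j" "j < N"
  using assms by (auto simp: sub_end_def sub_node_def split: if_splits)

lemma sub_end_inner:
  assumes "0 < j" "j < N"
  shows "sub_end G N (e, j) True = Inr (e, j)" "sub_end G N (e, j - 1) False = Inr (e, j)"
  using assms by (auto simp: sub_end_def sub_node_def)

lemma leafless_subdivide:
  assumes N: "0 < N" and F: "leafless (endpt G) W F"
  shows "leafless (sub_end G N) (Inl ` W) (F \<times> {..<N})"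
  unfolding leafless_def
proof (intro conjI ballI allI impI)
  show "F \<times> {..<N} \<noteq> {}" using F N by (auto simp: leafless_def)
  fix d b assume d: "d \<in> F \<times> {..<N}" and nW: "sub_end G N d b \<notin> Inl ` W"
  obtain e i where ei: "d = (e, i)" "e \<in> F" "i < N" using d by auto
  show "\<exists>d'\<in>F \<times> {..<N}. \<exists>b'. (d', b') \<noteq> (d, b) \<and> sub_end G N d' b' = sub_end G N d b"
  proof (cases "sub_end G N d b")
    case (Inl w)
    note i = sub_end_Inl[OF Inl[unfolded ei] ei(3)]
    have "endpt G e b \<notin> W" using nW Inl i by auto
    then obtain e' b' where e': "e' \<in> F" "(e', b') \<noteq> (e, b)" "endpt G e' b' = endpt G e b"
      using leaflessD[OF F ei(2)] by blast
    then show ?thesis using Inl i N ei sub_end_end_index[OF N, of G e' b'] end_index_less[OF N, of b']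
      by (intro bexI[of _ "(e', end_index N b')"] exI[of _ b']) auto
  next
    case (Inr p)
    obtain e1 j where p: "p = (e1, j)" by force
    note j = sub_end_Inr[OF Inr[unfolded ei p] ei(3)]
    show ?thesis
    proof (cases b)
      case True
      then show ?thesis using j ei Inr p sub_end_inner[OF j(3,4), of G e]
        by (intro bexI[of _ "(e, j - 1)"] exI[of _ False]) auto
    next
      case False
      then show ?thesis using j ei Inr p sub_end_inner[OF j(3,4), of G e]
        by (intro bexI[of _ "(e, j)"] exI[of _ True]) auto
    qed
  qed
qed

text \<open>An inner node has exactly two darts, so a leafless set that contains one piece of an edge contains
its neighbours and hence all pieces.\<close>

lemma leafless_subdivision_full:
  assumes N: "0 < N" and F: "leafless (sub_end G N) (Inl ` W) F" "F \<subseteq> E \<times> {..<N}"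
  shows "F = fst ` F \<times> {..<N}" "leafless (endpt G) W (fst ` F)"
proof -
  have other: "\<exists>e' i' b'. (e', i') \<in> F \<and> i' < N \<and> ((e', i'), b') \<noteq> ((e, i), b) \<and> sub_end G N (e', i') b' = sub_end G N (e, i) b"
    if "(e, i) \<in> F" "sub_end G N (e, i) b \<notin> Inl ` W" for e i b
    using leaflessD[OF F(1) that] F(2) by (metis mem_Sigma_iff lessThan_iff subsetD surj_pair)
  have up: "(e, Suc i) \<in> F" if ei: "(e, i) \<in> F" "Suc i < N" for e i
  proof -
    have eq: "sub_end G N (e, i) False = Inr (e, Suc i)" using sub_end_inner(2)[of "Suc i" N G e] ei by simp
    then obtain e' i' b' where *: "(e', i') \<in> F" "i' < N" "((e', i'), b') \<noteq> ((e, i), False)"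
      "sub_end G N (e', i') b' = Inr (e, Suc i)"
      using other[OF ei(1), of False] by auto
    from sub_end_Inr[OF *(4,2)] * show ?thesis by (auto split: if_splits)
  qed
  have down: "(e, i) \<in> F" if ei: "(e, Suc i) \<in> F" for e i
  proof -
    have N: "Suc i < N" using ei F(2) by auto
    have eq: "sub_end G N (e, Suc i) True = Inr (e, Suc i)" using sub_end_inner(1)[of "Suc i" N G e] N by simp
    then obtain e' i' b' where *: "(e', i') \<in> F" "i' < N" "((e', i'), b') \<noteq> ((e, Suc i), True)"
      "sub_end G N (e', i') b' = Inr (e, Suc i)"
      using other[OF ei(1), of True] by auto
    from sub_end_Inr[OF *(4,2)] * show ?thesis by (auto split: if_splits)
  qed
  have zero: "(e, 0) \<in> F" if "(e, i) \<in> F" for e i using that by (induction i) (auto intro: down)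
  have all: "(e, j) \<in> F" if "(e, i) \<in> F" "j < N" for e i j
    using that(2) by (induction j) (auto intro: up zero[OF that(1)])
  show full: "F = fst ` F \<times> {..<N}" using all F(2) by force
  show "leafless (endpt G) W (fst ` F)"
    unfolding leafless_def
  proof (intro conjI ballI allI impI)
    show "fst ` F \<noteq> {}" using F by (auto simp: leafless_def)
    fix e b assume e: "e \<in> fst ` F" "endpt G e b \<notin> W"
    have "(e, end_index N b) \<in> F" using e all end_index_less[OF N] by force
    moreover have "sub_end G N (e, end_index N b) b \<notin> Inl ` W"
      using e sub_end_end_index[OF N, of G e b] by auto
    ultimately obtain e' i' b' where *: "(e', i') \<in> F" "i' < N" "((e', i'), b') \<noteq> ((e, end_index N b), b)"
      "sub_end G N (e', i') b' = Inl (endpt G e b)"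
      using other sub_end_end_index[OF N, of G e b] by metis
    from sub_end_Inl[OF *(4,2)] * show "\<exists>e'\<in>fst ` F. \<exists>b'. (e', b') \<noteq> (e, b) \<and> endpt G e' b' = endpt G e b"
      by (intro bexI[of _ e'] exI[of _ b']) force+
  qed
qed

lemma trig_shift:
  fixes A B k x t :: real
  defines "u \<equiv> \<lambda>x. A * cos (k * x) + B * sn k x" and "v \<equiv> \<lambda>x. B * cos (k * x) - A * k\<^sup>2 * sn k x"
  shows "u (x + t) = u x * cos (k * t) + v x * sn k t"
proof (cases "k = 0")
  case True
  then show ?thesis by (simp add: u_def v_def sn_def algebra_simps)
next
  case False
  then have c: "cos (k * (x + t)) = cos (k * x) * cos (k * t) - sin (k * x) * sin (k * t)"
    "sin (k * (x + t)) = sin (k * x) * cos (k * t) + cos (k * x) * sin (k * t)"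
    by (simp_all add: distrib_left cos_add sin_add)
  show ?thesis using False unfolding u_def v_def sn_def c by (simp add: field_simps power2_eq_square)
qed

lemma sn_minus: "sn k (- x) = - sn k x" by (simp add: sn_def)

text \<open>At an inner node, criticality is the recurrence \<open>F (i + 2) = 2 cos (k h) F (i + 1) - F i\<close> of the
samples of a solution of \<open>u'' = - k\<^sup>2 u\<close>. So one solution interpolates all nodes of an edge, and at
a vertex criticality is the Kirchhoff condition.\<close>

lemma critical_function_on_edges:
  fixes G :: "('v, 'e) mgraph" and f :: "'v + 'e \<times> nat \<Rightarrow> real"
  defines "h \<equiv> \<lambda>N d. len G (fst d) / real N"
  assumes G: "compact_metric_graph G" and N: "0 < N" and k: "0 \<le> k" "\<And>e. e \<in> edges G \<Longrightarrow> k * (len G e / real N) < pi"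
    and f: "\<And>n. n \<notin> Inl ` W \<Longrightarrow>
      (\<Sum>(d, b) | d \<in> edges G \<times> {..<N} \<and> sub_end G N d b = n.
        (f n * cos (k * h N d) - f (sub_end G N d (\<not> b))) / sn k (h N d)) = 0"
  shows "\<exists>u v. \<forall>e\<in>edges G. helmholtz (k\<^sup>2) (len G e) (u e) (v e) \<and>
      (\<forall>i\<le>N. u e (real i * (len G e / N)) = f (sub_node G N e i)) \<and>
      (\<forall>w. w \<notin> W \<longrightarrow> (\<Sum>(e, b)\<in>darts G w. sg b * v e (end_pos G e b)) = 0)"
proof -
  define hh where "hh = (\<lambda>e. len G e / real N)"
  define F where "F = (\<lambda>e i. f (sub_node G N e i))"
  define B where "B = (\<lambda>e. (F e 1 - F e 0 * cos (k * hh e)) / sn k (hh e))"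
  define u where "u = (\<lambda>e x. F e 0 * cos (k * x) + B e * sn k x)"
  define v where "v = (\<lambda>e x. B e * cos (k * x) - F e 0 * k\<^sup>2 * sn k x)"
  have fin: "finite (edges G)" using compact_metric_graphD[OF G] by blast
  have pos: "0 < sn k (hh e)" if "e \<in> edges G" for e
    using compact_metric_graphD(3)[OF G that] N k(1) k(2)[OF that] unfolding hh_def by (intro sn_pos) auto
  have shift: "u e (x + t) = u e x * cos (k * t) + v e x * sn k t" for e x t
    unfolding u_def v_def by (rule trig_shift)
  have rec: "F e (Suc (Suc i)) = 2 * cos (k * hh e) * F e (Suc i) - F e i" if e: "e \<in> edges G" "Suc (Suc i) \<le> N" for e i
  proof -
    have set: "{(d, b). d \<in> edges G \<times> {..<N} \<and> sub_end G N d b = Inr (e, Suc i)} =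
        {((e, Suc i), True), ((e, i), False)}"
      using e sub_end_inner[of "Suc i" N G e] by (auto dest: sub_end_Inr split: if_splits)
    have "(F e (Suc i) * cos (k * hh e) - F e (Suc (Suc i))) / sn k (hh e) +
        (F e (Suc i) * cos (k * hh e) - F e i) / sn k (hh e) = 0"
    proof -
      have n: "sub_node G N e (Suc i) = Inr (e, Suc i)" using e by (simp add: sub_node_def)
      have "Inr (e, Suc i) \<notin> Inl ` W" by auto
      from f[OF this, unfolded set, folded n] show ?thesis
        by (simp add: h_def hh_def F_def sub_end_def)
    qed
    then show ?thesis using pos[OF e(1)] by (simp add: add_divide_distrib[symmetric]) (simp add: algebra_simps)
  qed
  have uF: "u e (real i * hh e) = F e i" if e: "e \<in> edges G" "i \<le> N" for e i
    using e(2)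
  proof (induction i rule: less_induct)
    case (less i)
    show ?case
    proof (cases "i = 0")
      case True then show ?thesis by (simp add: u_def)
    next
      case i0: False
      show ?thesis
      proof (cases "i = 1")
        case True then show ?thesis using pos[OF e(1)] by (simp add: u_def B_def)
      next
        case False
        with i0 obtain j where j: "i = Suc (Suc j)" by (metis One_nat_def not0_implies_Suc)
        have "u e (real i * hh e) + u e (real j * hh e) = 2 * cos (k * hh e) * u e (real (Suc j) * hh e)"
          using shift[of e "real (Suc j) * hh e" "hh e"] shift[of e "real (Suc j) * hh e" "- hh e"]
          by (simp add: j sn_minus algebra_simps)
        then show ?thesis using less.IH[of j] less.IH[of "Suc j"] less.prems rec[OF e(1), of j] by (simp add: j)
      qed
    qed
  qed
  have ends: "sg b * v e (end_pos G e b) =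
      - (f (sub_end G N (e, end_index N b) b) * cos (k * hh e) - f (sub_end G N (e, end_index N b) (\<not> b))) / sn k (hh e)"
    if e: "e \<in> edges G" for e b
  proof (cases b)
    case True
    then show ?thesis
      by (simp add: sg_def end_pos_def v_def B_def F_def sub_end_def end_index_def diff_divide_distrib)
  next
    case False
    have l: "real N * hh e = len G e" using N by (simp add: hh_def)
    have "u e (len G e - hh e) = F e (N - 1)"
      using uF[OF e, of "N - 1"] N l by (simp add: of_nat_diff algebra_simps)
    moreover have "u e (len G e) = F e N" using uF[OF e, of N] l by simp
    ultimately have "F e (N - 1) = F e N * cos (k * hh e) - v e (len G e) * sn k (hh e)"
      using shift[of e "len G e" "- hh e"] by (simp add: sn_minus)
    then have "v e (len G e) = (F e N * cos (k * hh e) - F e (N - 1)) / sn k (hh e)"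
      using pos[OF e] by (simp add: field_simps)
    then show ?thesis using False N
      by (simp add: sg_def end_pos_def F_def sub_end_def end_index_def diff_divide_distrib)
  qed
  have kirch: "(\<Sum>(e, b)\<in>darts G w. sg b * v e (end_pos G e b)) = 0" if "w \<notin> W" for w
  proof -
    let ?m = "\<lambda>(e, b). ((e, end_index N b), b)"
    have set: "{(d, b). d \<in> edges G \<times> {..<N} \<and> sub_end G N d b = Inl w} = ?m ` darts G w"
    proof (intro equalityI subsetI)
      fix p assume "p \<in> {(d, b). d \<in> edges G \<times> {..<N} \<and> sub_end G N d b = Inl w}"
      then obtain e i b where p: "p = ((e, i), b)" "e \<in> edges G" "i < N" "sub_end G N (e, i) b = Inl w" by auto
      from sub_end_Inl[OF p(4,3)] p show "p \<in> ?m ` darts G w"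
        by (intro image_eqI[of _ _ "(e, b)"]) (auto simp: darts_def)
    next
      fix p assume "p \<in> ?m ` darts G w"
      then show "p \<in> {(d, b). d \<in> edges G \<times> {..<N} \<and> sub_end G N d b = Inl w}"
        using N by (auto simp: darts_def sub_end_end_index end_index_less)
    qed
    have inj: "inj_on ?m (darts G w)" by (auto simp: inj_on_def)
    have "(\<Sum>(e, b)\<in>darts G w. sg b * v e (end_pos G e b)) = - (\<Sum>(e, b)\<in>darts G w.
        (f (Inl w) * cos (k * hh e) - f (sub_end G N (e, end_index N b) (\<not> b))) / sn k (hh e))"
      unfolding sum_negf[symmetric]
      by (intro sum.cong refl) (auto simp: darts_def ends sub_end_end_index[OF N] minus_divide_left)
    also have "(\<Sum>(e, b)\<in>darts G w.
        (f (Inl w) * cos (k * hh e) - f (sub_end G N (e, end_index N b) (\<not> b))) / sn k (hh e)) = 0"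
      using f[of "Inl w"] that unfolding set sum.reindex[OF inj]
      by (simp add: h_def hh_def case_prod_unfold image_iff)
    finally show ?thesis by simp
  qed
  have "helmholtz (k\<^sup>2) (len G e) (u e) (v e)" for e unfolding u_def v_def by (rule helmholtz_trig)
  moreover have "u e (real i * (len G e / real N)) = f (sub_node G N e i)" if "e \<in> edges G" "i \<le> N" for e i
    using uF[OF that] by (simp only: hh_def F_def)
  ultimately show ?thesis using kirch by (intro exI[of _ u] exI[of _ v]) blast
qed

lemma compact_double_graph:
  assumes "compact_metric_graph G"
  shows "compact_metric_graph (double_graph G W)"
  unfolding compact_metric_graph_def
proof (intro conjI ballI)
  have "verts (double_graph G W) \<subseteq> verts G \<times> UNIV" by (auto simp: double_graph_def glue_def)
  then show "finite (verts (double_graph G W))"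
    by (rule finite_subset) (use assms in \<open>auto simp: compact_metric_graph_def\<close>)
  obtain v where "v \<in> verts G" using assms by (auto simp: compact_metric_graph_def)
  then have "glue W v True \<in> verts (double_graph G W)" by (auto simp: double_graph_def)
  then show "verts (double_graph G W) \<noteq> {}" by blast
qed (use assms in \<open>auto simp: compact_metric_graph_def double_graph_def\<close>)

lemma endpt_double_graph: "endpt (double_graph G W) (e, c) b = glue W (endpt G e b) c"
  by (simp add: endpt_def double_graph_def)

lemma edges_double_graph [simp]: "edges (double_graph G W) = edges G \<times> UNIV"
  and len_double_graph [simp]: "len (double_graph G W) (e, c) = len G e"
  by (simp_all add: double_graph_def)

lemma end_pos_double_graph: "end_pos (double_graph G W) (e, c) b = end_pos G e b"
  by (simp add: end_pos_def)

lemma glue_eq_iff: "glue W v c = glue W w c' \<longleftrightarrow> v = w \<and> (w \<in> W \<or> c = c')"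
  by (auto simp: glue_def)

text \<open>At a vertex of \<open>W\<close> each dart meets its copy, elsewhere both copies are as in \<open>G\<close>.\<close>

lemma leafless_times_UNIV:
  assumes F: "leafless (endpt G) W F"
  shows "leafless (endpt (double_graph G W)) {} (F \<times> UNIV)"
  unfolding leafless_def
proof (intro conjI ballI allI impI)
  show "F \<times> (UNIV :: bool set) \<noteq> {}" using F by (auto simp: leafless_def)
  fix d b assume "d \<in> F \<times> (UNIV :: bool set)"
  then obtain e c where d: "d = (e, c)" "e \<in> F" by auto
  show "\<exists>d'\<in>F \<times> UNIV. \<exists>b'. (d', b') \<noteq> (d, b) \<and> endpt (double_graph G W) d' b' = endpt (double_graph G W) d b"
  proof (cases "endpt G e b \<in> W")
    case True
    then show ?thesis using d
      by (intro bexI[of _ "(e, \<not> c)"] exI[of _ b]) (auto simp: endpt_double_graph glue_eq_iff)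
  next
    case False
    then obtain e' b' where "e' \<in> F" "(e', b') \<noteq> (e, b)" "endpt G e' b' = endpt G e b"
      using leaflessD[OF F d(2)] by blast
    then show ?thesis using d
      by (intro bexI[of _ "(e', c)"] exI[of _ b']) (auto simp: endpt_double_graph glue_eq_iff)
  qed
qed

lemma leafless_fst:
  assumes F: "leafless (endpt (double_graph G W)) {} F"
  shows "leafless (endpt G) W (fst ` F)"
  unfolding leafless_def
proof (intro conjI ballI allI impI)
  show "fst ` F \<noteq> {}" using F by (auto simp: leafless_def)
  fix e b assume "e \<in> fst ` F" and nW: "endpt G e b \<notin> W"
  then obtain c where c: "(e, c) \<in> F" by auto
  obtain d' b' where d': "d' \<in> F" "(d', b') \<noteq> ((e, c), b)"
    "endpt (double_graph G W) d' b' = endpt (double_graph G W) (e, c) b"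
    by (rule leaflessD[OF F c, of b]) auto
  obtain e' c' where "d' = (e', c')" by (cases d')
  with d' have *: "(e', c') \<in> F" "((e', c'), b') \<noteq> ((e, c), b)"
    "endpt (double_graph G W) (e', c') b' = endpt (double_graph G W) (e, c) b"
    by simp_all
  then have "endpt G e' b' = endpt G e b" "c' = c"
    using nW by (auto simp: endpt_double_graph glue_eq_iff)
  with * show "\<exists>e'\<in>fst ` F. \<exists>b'. (e', b') \<noteq> (e, b) \<and> endpt G e' b' = endpt G e b"
    by (intro bexI[of _ e'] exI[of _ b']) force+
qed

text \<open>At a vertex in \<open>W\<close> the contributions of the two copies to the Kirchhoff sum cancel, whatever the
derivatives are; at the other vertices each copy is balanced by itself.\<close>

lemma antisymmetric_eigenfunction:
  fixes G :: "('v, 'e) mgraph"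
  assumes G: "compact_metric_graph G"
    and uv: "\<And>e. e \<in> edges G \<Longrightarrow> helmholtz \<mu> (len G e) (u e) (v e)"
    and cont: "\<And>e b. e \<in> edges G \<Longrightarrow> u e (end_pos G e b) = \<phi> (endpt G e b)"
    and W: "\<And>w. w \<in> W \<Longrightarrow> \<phi> w = 0"
    and kirch: "\<And>w. w \<notin> W \<Longrightarrow> (\<Sum>(e, b)\<in>darts G w. sg b * v e (end_pos G e b)) = 0"
  shows "(\<lambda>(e, c) x. if e \<in> edges G \<and> x \<in> {0..len G e} then sg c * u e x else 0)
    \<in> eigenspace (double_graph G W) \<mu>"
proof -
  let ?D = "double_graph G W"
  let ?f = "\<lambda>(e, c) x. if e \<in> edges G \<and> x \<in> {0..len G e} then sg c * u e x else 0"
  let ?v = "\<lambda>(e, c) x. sg c * v e x"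
  have fin: "finite (darts G w)" for w
    by (rule finite_subset[of _ "edges G \<times> UNIV"]) (use compact_metric_graphD[OF G] in \<open>auto simp: darts_def\<close>)
  have "eigen_data ?D \<mu> ?f ?v (\<lambda>(w, c). sg c * \<phi> w)"
    unfolding eigen_data_def
  proof (intro conjI ballI allI impI)
    show "?f d = (\<lambda>_. 0)" if "d \<notin> edges ?D" for d using that by (cases d) auto
    fix d assume "d \<in> edges ?D"
    then obtain e c where d: "d = (e, c)" "e \<in> edges G" by auto
    show "?f d x = 0" if "x \<notin> {0..len ?D d}" for x using that d by auto
    show "helmholtz \<mu> (len ?D d) (?f d) (?v d)"
      unfolding helmholtz_def d case_prod_conv len_double_graph
    proof (intro conjI ballI)
      fix x assume x: "x \<in> {0..len G e}"
      have du: "(u e has_real_derivative v e x) (at x within {0..len G e})"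
        and dv: "(v e has_real_derivative - \<mu> * u e x) (at x within {0..len G e})"
        using uv[OF d(2)] x by (auto simp: helmholtz_def)
      show "((\<lambda>x. if e \<in> edges G \<and> x \<in> {0..len G e} then sg c * u e x else 0) has_real_derivative sg c * v e x)
          (at x within {0..len G e})"
        by (rule has_field_derivative_transform_within[OF DERIV_cmult[OF du] zero_less_one x]) (use d in auto)
      show "((\<lambda>x. sg c * v e x) has_real_derivative
          - \<mu> * (if e \<in> edges G \<and> x \<in> {0..len G e} then sg c * u e x else 0)) (at x within {0..len G e})"
        using DERIV_cmult[OF dv, of "sg c"] d x by (simp add: mult.left_commute)
    qed
    show "?f d (end_pos ?D d b) = (case endpt ?D d b of (w, c) \<Rightarrow> sg c * \<phi> w)" for b
    proof -
      have "end_pos G e b \<in> {0..len G e}"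
        using compact_metric_graphD(3)[OF G d(2)] by (auto simp: end_pos_def)
      then show ?thesis using d cont[OF d(2), of b] W[of "endpt G e b"]
        by (simp add: endpt_double_graph end_pos_double_graph glue_def)
    qed
  next
    fix p assume "p \<in> verts ?D"
    then obtain w c where p: "p = glue W w c" by (auto simp: double_graph_def)
    show "(\<Sum>(d, b)\<in>darts ?D p. sg b * ?v d (end_pos ?D d b)) = 0"
    proof (cases "w \<in> W")
      case False
      let ?m = "\<lambda>(e, b). ((e, c), b)"
      have "darts ?D p = ?m ` darts G w"
        using False p by (auto simp: darts_def endpt_double_graph glue_eq_iff image_iff)
      moreover have "inj_on ?m (darts G w)" by (auto simp: inj_on_def)
      ultimately have "(\<Sum>(d, b)\<in>darts ?D p. sg b * ?v d (end_pos ?D d b)) =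
          (\<Sum>(e, b)\<in>darts G w. sg c * (sg b * v e (end_pos G e b)))"
        by (simp add: sum.reindex case_prod_unfold end_pos_double_graph mult.left_commute)
      also have "\<dots> = sg c * (\<Sum>(e, b)\<in>darts G w. sg b * v e (end_pos G e b))"
        by (simp add: sum_distrib_left case_prod_unfold)
      finally show ?thesis using kirch[OF False] by simp
    next
      case True
      let ?m = "\<lambda>(d, c). ((fst d, c), snd d)"
      have set: "darts ?D p = ?m ` (darts G w \<times> UNIV)"
        using True p by (auto simp: darts_def endpt_double_graph glue_eq_iff image_iff)
      have inj: "inj_on ?m (darts G w \<times> UNIV)" by (auto simp: inj_on_def)
      have "(\<Sum>(d, b)\<in>darts ?D p. sg b * ?v d (end_pos ?D d b)) =
          (\<Sum>x\<in>darts G w \<times> UNIV. sg (snd x) * (sg (snd (fst x)) * v (fst (fst x)) (end_pos G (fst (fst x)) (snd (fst x)))))"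
        unfolding set sum.reindex[OF inj]
        by (simp add: case_prod_unfold end_pos_double_graph mult.left_commute)
      also have "\<dots> = 0"
        unfolding sum_darts by (simp add: sg_def sum.neutral)
      finally show ?thesis .
    qed
  qed
  then show ?thesis unfolding eigenspace_iff[OF compact_double_graph[OF G]] by blast
qed

theorem eigenvalue_double_graph_le:
  fixes G :: "('v, 'e) mgraph"
  assumes G: "compact_metric_graph G" and s: "0 < s"
    and big: "\<And>F. F \<subseteq> edges G \<Longrightarrow> leafless (endpt G) W F \<Longrightarrow> s / 2 \<le> sum (len G) F"
    and F0: "F0 \<subseteq> edges G" "leafless (endpt G) W F0"
  shows "eigenvalue (double_graph G W) 2 \<le> 4 * pi\<^sup>2 / s\<^sup>2"
proof -
  \<comment> \<open>In units of this frequency a leafless set relative to \<open>W\<close> has length at least \<open>\<pi>\<close>.\<close>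
  define K where "K = 2 * pi / s"
  have K: "0 < K" using s by (simp add: K_def)
  have fin: "finite (edges G)" using compact_metric_graphD[OF G] by blast
  have len: "0 < len G e" if "e \<in> edges G" for e using compact_metric_graphD(3)[OF G that] .
  have "\<exists>N>0. \<forall>e\<in>edges G. K * (len G e / real N) < pi"
  proof -
    obtain n :: nat where n: "K * sum (len G) (edges G) / pi < real n" using reals_Archimedean2 by blast
    have "K * (len G e / real (Suc n)) < pi" if "e \<in> edges G" for e
    proof -
      have "K * len G e \<le> K * sum (len G) (edges G)"
        using K fin that len by (intro mult_left_mono member_le_sum) (auto intro: less_imp_le)
      also have "\<dots> < pi * real n" using n by (simp add: pos_divide_less_eq mult.commute)
      also have "\<dots> \<le> pi * real (Suc n)" by simp
      finally show ?thesis by (simp add: pos_divide_less_eq)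
    qed
    then show ?thesis by (intro exI[of _ "Suc n"]) auto
  qed
  then obtain N where N: "0 < N" and small: "\<And>e. e \<in> edges G \<Longrightarrow> K * (len G e / real N) < pi" by blast
  define E where "E = edges G \<times> {..<N}"
  define h where "h = (\<lambda>d :: 'e \<times> nat. len G (fst d) / real N)"
  let ?\<tau> = "sub_end G N" and ?Z = "Inl ` W :: ('v + 'e \<times> nat) set"
  have finE: "finite E" using fin by (simp add: E_def)
  have hpos: "0 < h d" "K * h d < pi" if "d \<in> E" for d using that len small N by (auto simp: E_def h_def)
  have sum_h: "sum h (F \<times> {..<N}) = sum (len G) F" for F
    using N unfolding h_def by (simp add: sum.cartesian_product' sum_distrib_left)
  have "\<exists>f. (\<forall>n\<in>?Z. f n = 0) \<and> (\<exists>e\<in>E. \<exists>b. f (?\<tau> e b) \<noteq> 0) \<and> energy E ?\<tau> (\<lambda>d. K * h d) f \<le> 0"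
  proof (rule test_function[OF finE])
    show "0 < K * h d \<and> K * h d < pi" if "d \<in> E" for d using hpos[OF that] K by simp
    show "F0 \<times> {..<N} \<subseteq> E" using F0 by (auto simp: E_def)
    show "leafless ?\<tau> ?Z (F0 \<times> {..<N})" by (rule leafless_subdivide[OF N F0(2)])
    fix F assume F: "F \<subseteq> E" "leafless ?\<tau> ?Z F"
    note full = leafless_subdivision_full[OF N F(2) F(1)[unfolded E_def]]
    have "s / 2 \<le> sum (len G) (fst ` F)" using full(2) F(1) by (intro big) (auto simp: E_def)
    also have "\<dots> = sum h F" by (subst full(1)) (simp only: sum_h)
    finally have "K * (s / 2) \<le> K * sum h F" using K by simp
    moreover have "K * (s / 2) = pi" using s by (simp add: K_def)
    ultimately show "pi \<le> (\<Sum>d\<in>F. K * h d)" by (simp add: sum_distrib_left)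
  qed
  then obtain f0 where f0: "\<And>n. n \<in> ?Z \<Longrightarrow> f0 n = 0" "\<exists>e\<in>E. \<exists>b. f0 (?\<tau> e b) \<noteq> 0"
    "energy E ?\<tau> (\<lambda>d. K * h d) f0 \<le> 0" by blast
  have "form E ?\<tau> h K f0 f0 = K * energy E ?\<tau> (\<lambda>d. K * h d) f0"
    unfolding form_def energy_def sum_distrib_left using K
    by (intro sum.cong refl) (simp add: sn_def power2_eq_square)
  then have f0neg: "form E ?\<tau> h K f0 f0 \<le> 0" using f0(3) K by (simp add: mult_nonneg_nonpos)
  have "\<exists>k f. 0 \<le> k \<and> k \<le> K \<and> (\<forall>n\<in>?Z. f n = 0) \<and> (\<exists>e\<in>E. \<exists>b. f (?\<tau> e b) \<noteq> 0) \<and>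
    (\<forall>n. n \<notin> ?Z \<longrightarrow> (\<Sum>(e, b) | e \<in> E \<and> ?\<tau> e b = n.
        (f n * cos (k * h e) - f (?\<tau> e (\<not> b))) / sn k (h e)) = 0)"
    by (rule critical_function[OF finE hpos(1) less_imp_le[OF K] hpos(2) f0(1,2) f0neg])
  then obtain k f where k: "0 \<le> k" "k \<le> K" and fZ: "\<forall>n\<in>?Z. f n = 0" and nz: "\<exists>e\<in>E. \<exists>b. f (?\<tau> e b) \<noteq> 0"
    and crit: "\<forall>n. n \<notin> ?Z \<longrightarrow> (\<Sum>(e, b) | e \<in> E \<and> ?\<tau> e b = n.
        (f n * cos (k * h e) - f (?\<tau> e (\<not> b))) / sn k (h e)) = 0"
    by (elim exE conjE)
  have ksmall: "k * (len G e / real N) < pi" if "e \<in> edges G" for e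
  proof -
    have "k * (len G e / real N) \<le> K * (len G e / real N)" using k len[OF that] by (intro mult_right_mono) auto
    with small[OF that] show ?thesis by linarith
  qed
  have "\<exists>u v. \<forall>e\<in>edges G. helmholtz (k\<^sup>2) (len G e) (u e) (v e) \<and>
      (\<forall>i\<le>N. u e (real i * (len G e / N)) = f (sub_node G N e i)) \<and>
      (\<forall>w. w \<notin> W \<longrightarrow> (\<Sum>(e, b)\<in>darts G w. sg b * v e (end_pos G e b)) = 0)"
    by (rule critical_function_on_edges[OF G N k(1) ksmall crit[rule_format, unfolded h_def E_def]])
  then obtain u v where uv: "\<forall>e\<in>edges G. helmholtz (k\<^sup>2) (len G e) (u e) (v e) \<and>
      (\<forall>i\<le>N. u e (real i * (len G e / N)) = f (sub_node G N e i)) \<and>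
      (\<forall>w. w \<notin> W \<longrightarrow> (\<Sum>(e, b)\<in>darts G w. sg b * v e (end_pos G e b)) = 0)"
    by (elim exE)
  let ?f = "\<lambda>(e, c) x. if e \<in> edges G \<and> x \<in> {0..len G e} then sg c * u e x else 0"
  have uv1: "helmholtz (k\<^sup>2) (len G e) (u e) (v e)" if "e \<in> edges G" for e
    using bspec[OF uv that, THEN conjunct1] .
  have uv2: "u e (real i * (len G e / N)) = f (sub_node G N e i)" if "e \<in> edges G" "i \<le> N" for e i
    using bspec[OF uv that(1), THEN conjunct2, THEN conjunct1, THEN spec, THEN mp, OF that(2)] .
  obtain d b where d: "d \<in> E" "f (?\<tau> d b) \<noteq> 0" using nz by blast
  have "\<exists>e\<in>edges G. \<exists>i\<le>N. f (sub_node G N e i) \<noteq> 0"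
    using d by (intro bexI[of _ "fst d"] exI[of _ "if b then snd d else Suc (snd d)"]) (auto simp: E_def sub_end_def)
  then obtain e i where ei: "e \<in> edges G" "i \<le> N" "f (sub_node G N e i) \<noteq> 0" by blast
  define x where "x = real i * (len G e / real N)"
  have "x \<le> real N * (len G e / real N)"
    unfolding x_def using ei len[OF ei(1)] by (intro mult_right_mono) auto
  then have x: "x \<in> {0..len G e}" using len[OF ei(1)] N by (simp add: x_def)
  have "u e x = f (sub_node G N e i)" unfolding x_def using uv2[OF ei(1,2)] .
  then have ux: "u e x \<noteq> 0" using ei(3) by simp
  have uv3: "(\<Sum>(e, b)\<in>darts G w. sg b * v e (end_pos G e b)) = 0" if "w \<notin> W" for w
    using bspec[OF uv ei(1), THEN conjunct2, THEN conjunct2, THEN spec, THEN mp, OF that] .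
  have eig: "?f \<in> eigenspace (double_graph G W) (k\<^sup>2)"
  proof (rule antisymmetric_eigenfunction[OF G, where v = v and \<phi> = "\<lambda>w. f (Inl w)"])
    show "helmholtz (k\<^sup>2) (len G e) (u e) (v e)" if "e \<in> edges G" for e by (rule uv1[OF that])
    show "u e (end_pos G e b) = f (Inl (endpt G e b))" if e: "e \<in> edges G" for e b
    proof -
      show ?thesis using uv2[OF e, of 0] uv2[OF e, of N] N by (cases b) (simp_all add: end_pos_def endpt_def sub_node_def)
    qed
    show "f (Inl w) = 0" if "w \<in> W" for w using fZ that by blast
    show "(\<Sum>(e, b)\<in>darts G w. sg b * v e (end_pos G e b)) = 0" if "w \<notin> W" for w by (rule uv3[OF that])
  qed
  have "eigenvalue (double_graph G W) 2 \<le> k\<^sup>2"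
  proof (rule eigenvalue_2_le[OF compact_double_graph[OF G] zero_le_power2 eig])
    have val: "?f (e, c) x = sg c * u e x" for c using x ei(1) by simp
    show "?f \<noteq> 0"
    proof
      assume "?f = 0"
      from fun_cong[OF fun_cong[OF this], of "(e, True)" x] show False
        unfolding val using ux by (simp add: sg_def)
    qed
    fix a
    show "?f \<noteq> graph_scale a (const_one (double_graph G W))"
    proof
      assume eq: "?f = graph_scale a (const_one (double_graph G W))"
      have c1: "const_one (double_graph G W) (e, c) x = 1" for c using ei(1) x by (simp add: const_one_def)
      have "sg c * u e x = a" for c
        using fun_cong[OF fun_cong[OF eq], of "(e, c)" x] unfolding val graph_scale_apply c1 by simp
      from this[of True] this[of False] ux show False unfolding sg_def if_True if_False by linarith
    qed
  qed
  also have "k\<^sup>2 \<le> K\<^sup>2" using k by (intro power_mono) auto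
  also have "K\<^sup>2 = 4 * pi\<^sup>2 / s\<^sup>2" by (simp add: K_def power_divide power_mult_distrib)
  finally show ?thesis .
qed

section \<open>Dummy vertices\<close>

lemma edge_pt_eq_Vertex:
  "0 < len G e \<Longrightarrow> edge_pt G e x = Vertex w \<longleftrightarrow> x = 0 \<and> src G e = w \<or> x = len G e \<and> tgt G e = w"
  by (auto simp: edge_pt_def)

lemma edge_pt_eq_Inner:
  "edge_pt G e x = Inner e' y \<longleftrightarrow> e = e' \<and> x = y \<and> x \<noteq> 0 \<and> x \<noteq> len G e"
  by (auto simp: edge_pt_def)

lemma edge_pt_in_points:
  assumes "compact_metric_graph G" "e \<in> edges G" "x \<in> {0..len G e}"
  shows "edge_pt G e x \<in> points G"
  using assms by (auto simp: edge_pt_def points_def compact_metric_graph_def)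

lemma edge_pt_end: "0 < len G e \<Longrightarrow> edge_pt G e (end_pos G e b) = Vertex (endpt G e b)"
  by (auto simp: edge_pt_def end_pos_def endpt_def)

text \<open>The direction \<open>(e, x, b)\<close> leaves the point with coordinate \<open>x\<close> on \<open>e\<close> towards larger coordinates if
\<open>b\<close> holds and towards smaller ones otherwise. In this form vertices and inner points, which have two
directions, are treated alike.\<close>

definition dirs :: "('v, 'e) mgraph \<Rightarrow> ('v, 'e) gpoint \<Rightarrow> ('e \<times> real \<times> bool) set" where
  "dirs G p = {(e, x, b). e \<in> edges G \<and> x \<in> {0..len G e} \<and> (if b then x < len G e else 0 < x) \<and>
     edge_pt G e x = p}"

lemma dirs_Vertex:
  assumes G: "compact_metric_graph G"
  shows "dirs G (Vertex w) = (\<lambda>(e, b). (e, end_pos G e b, b)) ` darts G w"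
proof (intro equalityI subsetI)
  fix d assume "d \<in> dirs G (Vertex w)"
  then obtain e x b where d: "d = (e, x, b)" "e \<in> edges G" "if b then x < len G e else 0 < x"
    "edge_pt G e x = Vertex w" by (auto simp: dirs_def)
  have "0 < len G e" using compact_metric_graphD(3)[OF G d(2)] .
  then have "x = end_pos G e b \<and> endpt G e b = w"
    using d by (auto simp: edge_pt_eq_Vertex end_pos_def endpt_def split: if_splits)
  with d show "d \<in> (\<lambda>(e, b). (e, end_pos G e b, b)) ` darts G w"
    by (intro image_eqI[of _ _ "(e, b)"]) (auto simp: darts_def)
next
  fix d assume "d \<in> (\<lambda>(e, b). (e, end_pos G e b, b)) ` darts G w"
  then obtain e b where d: "d = (e, end_pos G e b, b)" "e \<in> edges G" "endpt G e b = w"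
    by (auto simp: darts_def)
  have "0 < len G e" using compact_metric_graphD(3)[OF G d(2)] .
  then show "d \<in> dirs G (Vertex w)" using d edge_pt_end[of G e b]
    by (auto simp: dirs_def) (auto simp: end_pos_def)
qed

lemma dirs_Inner:
  assumes "e \<in> edges G" "0 < x" "x < len G e"
  shows "dirs G (Inner e x) = {(e, x, True), (e, x, False)}"
proof (intro equalityI subsetI)
  fix d assume "d \<in> dirs G (Inner e x)"
  then show "d \<in> {(e, x, True), (e, x, False)}"
    by (cases d) (auto simp: dirs_def edge_pt_eq_Inner)
qed (use assms in \<open>auto simp: dirs_def edge_pt_eq_Inner\<close>)

lemma points_cases:
  assumes "p \<in> points G"
  obtains (Vertex) w where "p = Vertex w" "w \<in> verts G"
    | (Inner) e x where "p = Inner e x" "e \<in> edges G" "0 < x" "x < len G e"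
  using assms by (auto simp: points_def)

text \<open>The conditions of \<open>eigen_data\<close> at all points instead of the vertices: \<open>h\<close> is the function on the
points of the graph. At inner points the two directions cancel.\<close>

definition eigen_pt :: "('v, 'e) mgraph \<Rightarrow> real \<Rightarrow> ('e \<Rightarrow> real \<Rightarrow> real) \<Rightarrow> ('e \<Rightarrow> real \<Rightarrow> real) \<Rightarrow>
    (('v, 'e) gpoint \<Rightarrow> real) \<Rightarrow> bool" where
  "eigen_pt G \<mu> f v h \<longleftrightarrow>
    (\<forall>e x. e \<notin> edges G \<or> x \<notin> {0..len G e} \<longrightarrow> f e x = 0) \<and>
    (\<forall>e\<in>edges G. helmholtz \<mu> (len G e) (f e) (v e)) \<and>
    (\<forall>e\<in>edges G. \<forall>x\<in>{0..len G e}. f e x = h (edge_pt G e x)) \<and>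
    (\<forall>p\<in>points G. (\<Sum>(e, x, b)\<in>dirs G p. sg b * v e x) = 0)"

lemma sum_dirs_Vertex:
  assumes G: "compact_metric_graph G"
  shows "(\<Sum>(e, x, b)\<in>dirs G (Vertex w). sg b * v e x) = (\<Sum>(e, b)\<in>darts G w. sg b * v e (end_pos G e b))"
proof -
  have "inj_on (\<lambda>(e, b). (e, end_pos G e b, b)) (darts G w)" by (auto simp: inj_on_def)
  then show ?thesis unfolding dirs_Vertex[OF G] by (subst sum.reindex) (auto simp: case_prod_unfold)
qed

lemma eigenspace_iff_pt:
  assumes G: "compact_metric_graph G"
  shows "f \<in> eigenspace G \<mu> \<longleftrightarrow> (\<exists>v h. eigen_pt G \<mu> f v h)"
proof
  assume "f \<in> eigenspace G \<mu>"
  then obtain v \<phi> where D: "eigen_data G \<mu> f v \<phi>" unfolding eigenspace_iff[OF G] by blast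
  define h where "h = (\<lambda>p. case p of Vertex w \<Rightarrow> \<phi> w | Inner e x \<Rightarrow> f e x)"
  have "eigen_pt G \<mu> f v h"
    unfolding eigen_pt_def
  proof (intro conjI ballI allI impI)
    show "f e x = 0" if "e \<notin> edges G \<or> x \<notin> {0..len G e}" for e x
      using eigen_dataD(1,2)[OF D] that by blast
    show "helmholtz \<mu> (len G e) (f e) (v e)" if "e \<in> edges G" for e using eigen_dataD(3)[OF D that] .
    show "f e x = h (edge_pt G e x)" if e: "e \<in> edges G" "x \<in> {0..len G e}" for e x
      using eigen_dataD(4)[OF D e(1), of True] eigen_dataD(4)[OF D e(1), of False]
      by (simp add: h_def edge_pt_def end_pos_def endpt_def)
    show "(\<Sum>(e, x, b)\<in>dirs G p. sg b * v e x) = 0" if "p \<in> points G" for p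
      using that
    proof (cases rule: points_cases)
      case (Vertex w)
      then show ?thesis using eigen_dataD(5)[OF D, of w] by (simp only: sum_dirs_Vertex[OF G])
    next
      case (Inner e x)
      then show ?thesis by (simp add: dirs_Inner sg_def)
    qed
  qed
  then show "\<exists>v h. eigen_pt G \<mu> f v h" by blast
next
  assume "\<exists>v h. eigen_pt G \<mu> f v h"
  then obtain v h where D: "eigen_pt G \<mu> f v h" by blast
  have "eigen_data G \<mu> f v (\<lambda>w. h (Vertex w))"
    unfolding eigen_data_def
  proof (intro conjI ballI allI impI)
    show "f e = (\<lambda>_. 0)" if "e \<notin> edges G" for e using D that by (auto simp: eigen_pt_def)
    show "f e x = 0" if "e \<in> edges G" "x \<notin> {0..len G e}" for e x using D that by (auto simp: eigen_pt_def)
    show "helmholtz \<mu> (len G e) (f e) (v e)" if "e \<in> edges G" for e using D that by (auto simp: eigen_pt_def)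
    show "f e (end_pos G e b) = h (Vertex (endpt G e b))" if e: "e \<in> edges G" for e b
    proof -
      have l: "0 < len G e" using compact_metric_graphD(3)[OF G e] .
      then have "end_pos G e b \<in> {0..len G e}" by (auto simp: end_pos_def)
      then have "f e (end_pos G e b) = h (edge_pt G e (end_pos G e b))" using D e unfolding eigen_pt_def by blast
      then show ?thesis by (simp only: edge_pt_end[OF l])
    qed
    show "(\<Sum>(e, b)\<in>darts G w. sg b * v e (end_pos G e b)) = 0" if "w \<in> verts G" for w
    proof -
      have "Vertex w \<in> points G" using that by (simp add: points_def)
      then have "(\<Sum>(e, x, b)\<in>dirs G (Vertex w). sg b * v e x) = 0" using D unfolding eigen_pt_def by blast
      then show ?thesis by (simp only: sum_dirs_Vertex[OF G])
    qed
  qed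
  then show "f \<in> eigenspace G \<mu>" unfolding eigenspace_iff[OF G] by blast
qed

lemma sg_mult: "sg b * sg c = sg (b = c)" and sg_sq: "sg b * sg b = 1" and sg_cases: "sg b = 1 \<or> sg b = - 1"
  by (auto simp: sg_def)

text \<open>The data of a dummy refinement with the choices made: the edge \<open>e\<close> of \<open>K\<close> is the segment of the edge
\<open>E e\<close> of \<open>G\<close> that starts at \<open>a e\<close> and runs upwards if \<open>\<sigma> e\<close> holds and downwards otherwise.\<close>

locale refinement =
  fixes G :: "('v, 'e) mgraph" and K :: "('w, 'f) mgraph"
    and \<phi> :: "('w, 'f) gpoint \<Rightarrow> ('v, 'e) gpoint" and E :: "'f \<Rightarrow> 'e" and a :: "'f \<Rightarrow> real" and \<sigma> :: "'f \<Rightarrow> bool"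
  assumes G: "compact_metric_graph G" and K: "compact_metric_graph K"
    and bij: "bij_betw \<phi> (points K) (points G)"
    and E: "\<And>e. e \<in> edges K \<Longrightarrow> E e \<in> edges G"
    and seg: "\<And>e x. e \<in> edges K \<Longrightarrow> x \<in> {0..len K e} \<Longrightarrow> a e + sg (\<sigma> e) * x \<in> {0..len G (E e)} \<and>
        \<phi> (edge_pt K e x) = edge_pt G (E e) (a e + sg (\<sigma> e) * x)"

lemma dummy_refinementE:
  assumes "dummy_refinement G K" "compact_metric_graph G"
  obtains \<phi> E a \<sigma> where "refinement G K \<phi> E a \<sigma>"
proof -
  obtain \<phi> where \<phi>: "bij_betw \<phi> (points K) (points G)" and
    *: "\<forall>e'\<in>edges K. \<exists>e\<in>edges G. \<exists>a \<sigma>. \<sigma> \<in> {1, -1} \<and>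
         (\<forall>x\<in>{0..len K e'}. a + \<sigma> * x \<in> {0..len G e} \<and> \<phi> (edge_pt K e' x) = edge_pt G e (a + \<sigma> * x))"
    using assms(1) by (auto simp: dummy_refinement_def)
  have "\<forall>e'\<in>edges K. \<exists>t. fst t \<in> edges G \<and>
         (\<forall>x\<in>{0..len K e'}. fst (snd t) + sg (snd (snd t)) * x \<in> {0..len G (fst t)} \<and>
          \<phi> (edge_pt K e' x) = edge_pt G (fst t) (fst (snd t) + sg (snd (snd t)) * x))"
  proof
    fix e' assume "e' \<in> edges K"
    then obtain e a s where t: "e \<in> edges G" "s \<in> {1, -1 :: real}"
      "\<forall>x\<in>{0..len K e'}. a + s * x \<in> {0..len G e} \<and> \<phi> (edge_pt K e' x) = edge_pt G e (a + s * x)"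
      using * by blast
    have "sg (s = 1) = s" using t(2) by (auto simp: sg_def)
    with t show "\<exists>t. fst t \<in> edges G \<and>
         (\<forall>x\<in>{0..len K e'}. fst (snd t) + sg (snd (snd t)) * x \<in> {0..len G (fst t)} \<and>
          \<phi> (edge_pt K e' x) = edge_pt G (fst t) (fst (snd t) + sg (snd (snd t)) * x))"
      by (intro exI[of _ "(e, a, s = 1)"]) (simp only: fst_conv snd_conv)
  qed
  from bchoice[OF this] obtain t where t: "\<forall>e'\<in>edges K. fst (t e') \<in> edges G \<and>
         (\<forall>x\<in>{0..len K e'}. fst (snd (t e')) + sg (snd (snd (t e'))) * x \<in> {0..len G (fst (t e'))} \<and>
          \<phi> (edge_pt K e' x) = edge_pt G (fst (t e')) (fst (snd (t e')) + sg (snd (snd (t e'))) * x))"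
    by (elim exE)
  have "refinement G K \<phi> (\<lambda>e. fst (t e)) (\<lambda>e. fst (snd (t e))) (\<lambda>e. snd (snd (t e)))"
    by unfold_locales (use assms \<phi> t in \<open>auto simp: dummy_refinement_def\<close>)
  then show ?thesis by (rule that)
qed

context refinement begin

definition pos :: "'f \<Rightarrow> real \<Rightarrow> real" where "pos e x = a e + sg (\<sigma> e) * x"

lemma pos_in: "e \<in> edges K \<Longrightarrow> x \<in> {0..len K e} \<Longrightarrow> pos e x \<in> {0..len G (E e)}"
  and \<phi>_edge_pt: "e \<in> edges K \<Longrightarrow> x \<in> {0..len K e} \<Longrightarrow> \<phi> (edge_pt K e x) = edge_pt G (E e) (pos e x)"
  using seg by (simp_all add: pos_def)

lemma lenK: "e \<in> edges K \<Longrightarrow> 0 < len K e" and lenG: "e' \<in> edges G \<Longrightarrow> 0 < len G e'"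
  using compact_metric_graphD(3)[OF K] compact_metric_graphD(3)[OF G] by blast+

lemma pos_move: "pos e (x + sg b * t) = pos e x + sg (b = \<sigma> e) * t"
  by (auto simp: pos_def sg_def)

lemma \<phi>_inj: "p \<in> points K \<Longrightarrow> q \<in> points K \<Longrightarrow> \<phi> p = \<phi> q \<Longrightarrow> p = q"
  using bij by (auto simp: bij_betw_def inj_on_def)

lemma \<phi>_in: "p \<in> points K \<Longrightarrow> \<phi> p \<in> points G"
  using bij by (auto simp: bij_betw_def)

lemma \<phi>_surj: "q \<in> points G \<Longrightarrow> \<exists>p\<in>points K. \<phi> p = q"
  using bij unfolding bij_betw_def by (metis imageE)

definition dmap :: "'f \<times> real \<times> bool \<Rightarrow> 'e \<times> real \<times> bool" where
  "dmap d = (case d of (e, x, b) \<Rightarrow> (E e, pos e x, b = \<sigma> e))"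

lemma dmap_in:
  assumes "d \<in> dirs K p"
  shows "dmap d \<in> dirs G (\<phi> p)"
proof -
  obtain e x b where d: "d = (e, x, b)" "e \<in> edges K" "x \<in> {0..len K e}" "if b then x < len K e else 0 < x"
    "edge_pt K e x = p" using assms by (auto simp: dirs_def)
  define t where "t = (if b then len K e - x else x)"
  have t: "0 < t" "x + sg b * t \<in> {0..len K e}" using d by (auto simp: t_def sg_def split: if_splits)
  have "pos e x + sg (b = \<sigma> e) * t \<in> {0..len G (E e)}"
    using pos_in[OF d(2) t(2)] by (simp only: pos_move)
  then have "if b = \<sigma> e then pos e x < len G (E e) else 0 < pos e x"
    using t(1) by (cases "b = \<sigma> e") (auto simp: sg_def)
  then show ?thesis using E[OF d(2)] pos_in[OF d(2,3)] \<phi>_edge_pt[OF d(2,3)] d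
    by (auto simp: dirs_def dmap_def)
qed

text \<open>The points next to \<open>\<phi> p\<close> in the direction \<open>d\<close> are covered by finitely many segments and vertices,
so one segment contains points arbitrarily close to \<open>\<phi> p\<close>. As it is closed, it contains \<open>\<phi> p\<close>.\<close>

lemma dmap_surj:
  assumes d: "d \<in> dirs G (\<phi> p)" and p: "p \<in> points K"
  shows "\<exists>d'\<in>dirs K p. dmap d' = d"
proof -
  obtain e y c where d': "d = (e, y, c)" "e \<in> edges G" "y \<in> {0..len G e}" "if c then y < len G e else 0 < y"
    "edge_pt G e y = \<phi> p" using d by (auto simp: dirs_def)
  define \<delta> where "\<delta> = (if c then len G e - y else y)"
  have \<delta>: "0 < \<delta>" using d' by (auto simp: \<delta>_def)
  \<comment> \<open>Inner points of \<open>e\<close> that approach \<open>y\<close> in the direction \<open>c\<close>; the \<open>2\<close> keeps them off the far end.\<close>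
  define t where "t = (\<lambda>n::nat. \<delta> / (real n + 2))"
  have t: "0 < t n" "t n < \<delta>" for n using \<delta> by (auto simp: t_def pos_divide_less_eq)
  have tinj: "t n = t m \<Longrightarrow> n = m" for n m using \<delta> by (auto simp: t_def divide_simps)
  define q where "q = (\<lambda>n. Inner e (y + sg c * t n) :: ('v, 'e) gpoint)"
  have y: "0 < y + sg c * t n" "y + sg c * t n < len G e" for n
    using t[of n] d' by (auto simp: \<delta>_def sg_def split: if_splits)
  have qG: "q n \<in> points G" for n using y[of n] d' by (auto simp: q_def points_def)
  define r where "r = (\<lambda>n. inv_into (points K) \<phi> (q n))"
  have r: "r n \<in> points K" "\<phi> (r n) = q n" for n
    using qG[of n] bij unfolding r_def bij_betw_def by (metis inv_into_into, metis f_inv_into_f)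
  have rinj: "r n = r m \<Longrightarrow> n = m" for n m
  proof -
    assume "r n = r m"
    then have "q n = q m" using r by metis
    then show "n = m" using tinj sg_cases[of c] by (auto simp: q_def)
  qed
  \<comment> \<open>The vertex or edge of \<open>K\<close> that carries the \<open>n\<close>-th point.\<close>
  define tag where "tag = (\<lambda>n. case r n of Vertex w \<Rightarrow> Inl w | Inner e' x \<Rightarrow> Inr e')"
  have "range tag \<subseteq> Inl ` verts K \<union> Inr ` edges K"
  proof
    fix z assume "z \<in> range tag"
    then obtain n where z: "z = tag n" by blast
    show "z \<in> Inl ` verts K \<union> Inr ` edges K"
      using r(1)[of n] by (cases rule: points_cases) (auto simp: z tag_def)
  qed
  then have "finite (range tag)" by (rule finite_subset) (use compact_metric_graphD[OF K] in auto)
  then obtain n0 where inf: "infinite {n. tag n = tag n0}"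
    using pigeonhole_infinite[of UNIV tag] by auto
  have "\<exists>e'. tag n0 = Inr e'"
  proof (cases "tag n0")
    case (Inl w)
    have "n = n0" if "tag n = tag n0" for n
    proof (rule rinj)
      show "r n = r n0" using that Inl unfolding tag_def by (auto split: gpoint.splits)
    qed
    then have "{n. tag n = tag n0} \<subseteq> {n0}" by blast
    with inf show ?thesis using finite_subset by blast
  qed auto
  then obtain e' where e': "tag n0 = Inr e'" by blast
  define I where "I = {n. tag n = Inr e'}"
  have I: "infinite I" using inf by (simp add: I_def e')
  define b where "b = (c = \<sigma> e')"
  have bc: "c = (b = \<sigma> e')" by (auto simp: b_def)
  define x where "x = sg (\<sigma> e') * (y - a e')"
  have posx: "pos e' x = y" by (simp add: pos_def x_def mult.assoc[symmetric] sg_sq)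
  have rI: "e' \<in> edges K \<and> E e' = e \<and> x + sg b * t n \<in> {0..len K e'}" if n: "n \<in> I" for n
  proof -
    obtain z where z: "r n = Inner e' z" using n by (auto simp: I_def tag_def split: gpoint.splits)
    have z': "e' \<in> edges K" "0 < z" "z < len K e'" using r(1)[of n] unfolding z by (auto simp: points_def)
    have "edge_pt K e' z = r n" using z z' by (simp add: edge_pt_def)
    then have "edge_pt G (E e') (pos e' z) = q n" using \<phi>_edge_pt[of e' z] z' r(2)[of n] by simp
    then have "E e' = e" "pos e' z = y + sg c * t n" by (auto simp: q_def edge_pt_eq_Inner)
    moreover have "pos e' (x + sg b * t n) = y + sg c * t n" unfolding pos_move posx bc[symmetric] ..
    ultimately have "z = x + sg b * t n" using sg_cases[of "\<sigma> e'"] by (auto simp: pos_def)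
    then show ?thesis using z' \<open>E e' = e\<close> by auto
  qed
  have small: "\<exists>n\<in>I. t n < \<epsilon>" if \<epsilon>: "0 < \<epsilon>" for \<epsilon>
  proof -
    obtain m :: nat where m: "\<delta> / \<epsilon> < real m" using reals_Archimedean2 by blast
    obtain n where n: "n \<in> I" "m < n" using I unfolding infinite_nat_iff_unbounded by blast
    have "\<delta> < \<epsilon> * real m" using m \<epsilon> by (simp add: pos_divide_less_eq mult.commute)
    also have "\<dots> \<le> \<epsilon> * (real n + 2)" using n \<epsilon> by (intro mult_left_mono) auto
    finally have "t n < \<epsilon>" by (simp add: t_def pos_divide_less_eq)
    with n show ?thesis by blast
  qed
  obtain n1 where n1: "n1 \<in> I" using small[of 1] by auto
  have e'K: "e' \<in> edges K" and Ee: "E e' = e" using rI[OF n1] by auto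
  have x0: "0 \<le> x"
  proof (rule ccontr)
    assume "\<not> 0 \<le> x"
    then obtain n where n: "n \<in> I" "t n < - x" using small[of "- x"] by auto
    with rI[OF n(1)] t[of n] show False by (auto simp: sg_def split: if_splits)
  qed
  have xl: "x \<le> len K e'"
  proof (rule ccontr)
    assume "\<not> x \<le> len K e'"
    then obtain n where n: "n \<in> I" "t n < x - len K e'" using small[of "x - len K e'"] by auto
    with rI[OF n(1)] t[of n] show False by (auto simp: sg_def split: if_splits)
  qed
  have valid: "if b then x < len K e' else 0 < x"
    using rI[OF n1] t[of n1] by (auto simp: sg_def split: if_splits)
  have xK: "x \<in> {0..len K e'}" using x0 xl by simp
  have "edge_pt K e' x = p"
    using \<phi>_edge_pt[OF e'K xK] d'(5) p edge_pt_in_points[OF K e'K xK] by (intro \<phi>_inj) (simp_all add: posx Ee)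
  then have "(e', x, b) \<in> dirs K p" using e'K xK valid by (auto simp: dirs_def)
  moreover have "dmap (e', x, b) = d" by (simp add: dmap_def posx Ee bc[symmetric] d'(1))
  ultimately show ?thesis by blast
qed

text \<open>Two directions with the same image have a nearby inner point in common.\<close>

lemma dmap_inj:
  assumes p: "p \<in> points K"
  shows "inj_on dmap (dirs K p)"
proof (rule inj_onI)
  fix d1 d2 assume d: "d1 \<in> dirs K p" "d2 \<in> dirs K p" "dmap d1 = dmap d2"
  obtain e1 x1 b1 where d1: "d1 = (e1, x1, b1)" "e1 \<in> edges K" "x1 \<in> {0..len K e1}"
    "if b1 then x1 < len K e1 else 0 < x1" using d(1) by (auto simp: dirs_def)
  obtain e2 x2 b2 where d2: "d2 = (e2, x2, b2)" "e2 \<in> edges K" "x2 \<in> {0..len K e2}"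
    "if b2 then x2 < len K e2 else 0 < x2" using d(2) by (auto simp: dirs_def)
  have eq: "E e1 = E e2" "pos e1 x1 = pos e2 x2" "(b1 = \<sigma> e1) = (b2 = \<sigma> e2)"
    using d(3) by (auto simp: dmap_def d1(1) d2(1))
  define t where "t = min (if b1 then len K e1 - x1 else x1) (if b2 then len K e2 - x2 else x2) / 2"
  have t: "0 < t" "t < (if b1 then len K e1 - x1 else x1)" "t < (if b2 then len K e2 - x2 else x2)"
    using d1 d2 by (auto simp: t_def min_def)
  have in1: "0 < x1 + sg b1 * t" "x1 + sg b1 * t < len K e1" and in2: "0 < x2 + sg b2 * t" "x2 + sg b2 * t < len K e2"
    using t d1 d2 by (auto simp: sg_def split: if_splits)
  have "\<phi> (edge_pt K e1 (x1 + sg b1 * t)) = \<phi> (edge_pt K e2 (x2 + sg b2 * t))"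
    using \<phi>_edge_pt[OF d1(2), of "x1 + sg b1 * t"] \<phi>_edge_pt[OF d2(2), of "x2 + sg b2 * t"] in1 in2
    by (simp add: pos_move eq)
  then have "edge_pt K e1 (x1 + sg b1 * t) = edge_pt K e2 (x2 + sg b2 * t)"
    using in1 in2 by (intro \<phi>_inj edge_pt_in_points[OF K] d1(2) d2(2)) auto
  then have "e1 = e2 \<and> x1 + sg b1 * t = x2 + sg b2 * t" using in1 in2 by (simp add: edge_pt_def)
  moreover from this have "b1 = b2" using eq(3) by auto
  ultimately show "d1 = d2" using d1(1) d2(1) by simp
qed

lemma dmap_bij: "p \<in> points K \<Longrightarrow> bij_betw dmap (dirs K p) (dirs G (\<phi> p))"
  unfolding bij_betw_def using dmap_inj dmap_in dmap_surj by blast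

definition restrict :: "('e \<Rightarrow> real \<Rightarrow> real) \<Rightarrow> 'f \<Rightarrow> real \<Rightarrow> real" where
  "restrict f = (\<lambda>e x. if e \<in> edges K \<and> x \<in> {0..len K e} then f (E e) (pos e x) else 0)"

lemma pos_deriv: "(pos e has_real_derivative sg (\<sigma> e)) (at x within S)"
  unfolding pos_def[abs_def] by (auto intro!: derivative_eq_intros)

lemma restrict_eigenspace:
  assumes "f \<in> eigenspace G \<mu>"
  shows "restrict f \<in> eigenspace K \<mu>"
proof -
  obtain v h where D: "eigen_pt G \<mu> f v h" using assms unfolding eigenspace_iff_pt[OF G] by blast
  have "eigen_pt K \<mu> (restrict f) (\<lambda>e x. sg (\<sigma> e) * v (E e) (pos e x)) (\<lambda>p. h (\<phi> p))"
    unfolding eigen_pt_def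
  proof (intro conjI ballI allI impI)
    show "restrict f e x = 0" if "e \<notin> edges K \<or> x \<notin> {0..len K e}" for e x
      using that by (auto simp: restrict_def)
    show "restrict f e x = h (\<phi> (edge_pt K e x))" if "e \<in> edges K" "x \<in> {0..len K e}" for e x
    proof -
      have "f (E e) (pos e x) = h (edge_pt G (E e) (pos e x))"
        using D E[OF that(1)] pos_in[OF that] unfolding eigen_pt_def by blast
      then show ?thesis using that \<phi>_edge_pt[OF that] by (simp add: restrict_def)
    qed
    show "helmholtz \<mu> (len K e) (restrict f e) (\<lambda>x. sg (\<sigma> e) * v (E e) (pos e x))" if e: "e \<in> edges K" for e
      unfolding helmholtz_def
    proof (intro conjI ballI)
      fix x assume x: "x \<in> {0..len K e}"
      have H: "helmholtz \<mu> (len G (E e)) (f (E e)) (v (E e))" using D E[OF e] unfolding eigen_pt_def by blast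
      have sub: "pos e ` {0..len K e} \<subseteq> {0..len G (E e)}" using pos_in[OF e] by blast
      have du: "(f (E e) has_real_derivative v (E e) (pos e x)) (at (pos e x) within pos e ` {0..len K e})"
        and dv: "(v (E e) has_real_derivative - \<mu> * f (E e) (pos e x)) (at (pos e x) within pos e ` {0..len K e})"
        using H pos_in[OF e x] has_field_derivative_subset[OF _ sub] unfolding helmholtz_def by blast+
      have "((\<lambda>x. f (E e) (pos e x)) has_real_derivative sg (\<sigma> e) * v (E e) (pos e x)) (at x within {0..len K e})"
        using DERIV_image_chain[OF du pos_deriv] by (simp add: o_def mult.commute)
      then show "(restrict f e has_real_derivative sg (\<sigma> e) * v (E e) (pos e x)) (at x within {0..len K e})"
        by (rule has_field_derivative_transform_within[OF _ zero_less_one x]) (simp add: restrict_def e)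
      have "((\<lambda>x. v (E e) (pos e x)) has_real_derivative - \<mu> * f (E e) (pos e x) * sg (\<sigma> e)) (at x within {0..len K e})"
        using DERIV_image_chain[OF dv pos_deriv] by (simp add: o_def)
      from DERIV_cmult[OF this, of "sg (\<sigma> e)"]
      show "((\<lambda>x. sg (\<sigma> e) * v (E e) (pos e x)) has_real_derivative - \<mu> * restrict f e x) (at x within {0..len K e})"
      proof (rule DERIV_cong)
        have "sg (\<sigma> e) * (- \<mu> * f (E e) (pos e x) * sg (\<sigma> e)) =
            (sg (\<sigma> e) * sg (\<sigma> e)) * (- \<mu> * f (E e) (pos e x))"
          by (simp only: ac_simps)
        then show "sg (\<sigma> e) * (- \<mu> * f (E e) (pos e x) * sg (\<sigma> e)) = - \<mu> * restrict f e x"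
          using x e by (simp add: sg_sq restrict_def)
      qed
    qed
    show "(\<Sum>(e, x, b)\<in>dirs K p. sg b * (sg (\<sigma> e) * v (E e) (pos e x))) = 0" if p: "p \<in> points K" for p
    proof -
      have "(\<Sum>(e, x, b)\<in>dirs K p. sg b * (sg (\<sigma> e) * v (E e) (pos e x))) =
          (\<Sum>d\<in>dirs K p. (\<lambda>(e, x, b). sg b * v e x) (dmap d))"
        by (intro sum.cong refl) (auto simp: dmap_def sg_mult[symmetric])
      also have "\<dots> = (\<Sum>(e, x, b)\<in>dirs G (\<phi> p). sg b * v e x)"
        by (rule sum.reindex_bij_betw[OF dmap_bij[OF p]])
      also have "\<dots> = 0" using D \<phi>_in[OF p] unfolding eigen_pt_def by blast
      finally show ?thesis .
    qed
  qed
  then show ?thesis unfolding eigenspace_iff_pt[OF K] by blast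
qed

text \<open>In particular the segments on an edge of \<open>G\<close> cover the closed edge.\<close>

lemma points_covered:
  assumes e: "e \<in> edges G" and y: "y \<in> {0..len G e}" and c: "if c then y < len G e else 0 < y"
  shows "\<exists>e' x b. e' \<in> edges K \<and> x \<in> {0..len K e'} \<and> (if b then x < len K e' else 0 < x) \<and>
    E e' = e \<and> pos e' x = y \<and> c = (b = \<sigma> e')"
proof -
  have "edge_pt G e y \<in> points G" by (rule edge_pt_in_points[OF G e y])
  then obtain p where p: "p \<in> points K" "\<phi> p = edge_pt G e y" using \<phi>_surj by blast
  have "(e, y, c) \<in> dirs G (\<phi> p)" using e y c p by (auto simp: dirs_def)
  from dmap_surj[OF this p(1)] obtain d where d: "d \<in> dirs K p" "dmap d = (e, y, c)" by blast
  obtain e' x b where "d = (e', x, b)" by (cases d)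
  with d show ?thesis
    by (intro exI[of _ e'] exI[of _ x] exI[of _ b]) (auto simp: dirs_def dmap_def split: if_splits)
qed

text \<open>Used to glue the pieces of a function at a dummy vertex.\<close>

lemma derivative_from_sides:
  fixes f :: "real \<Rightarrow> real"
  assumes y: "y \<in> {0..l}" and l: "0 < l"
    and right: "y < l \<Longrightarrow> \<exists>\<delta>>0. (f has_real_derivative d) (at y within {y..y + \<delta>})"
    and left: "0 < y \<Longrightarrow> \<exists>\<delta>>0. (f has_real_derivative d) (at y within {y - \<delta>..y})"
  shows "(f has_real_derivative d) (at y within {0..l})"
proof -
  have R: "(f has_real_derivative d) (at_right y)" if "y < l"
    using right[OF that] at_within_Icc_at_right[of y] by auto
  have L: "(f has_real_derivative d) (at_left y)" if "0 < y"
    using left[OF that] at_within_Icc_at_left[of _ y] by auto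
  consider "y = 0" | "y = l" | "0 < y" "y < l" using y by force
  then show ?thesis
  proof cases
    case 1
    then show ?thesis using R l at_within_Icc_at_right[of 0 l] by simp
  next
    case 2
    then show ?thesis using L l at_within_Icc_at_left[of 0 l] by simp
  next
    case 3
    then have "(f has_real_derivative d) (at y)"
      using R L unfolding has_field_derivative_iff filterlim_at_split by simp
    then show ?thesis by (rule has_field_derivative_at_within)
  qed
qed

lemma derivative_along_segment:
  assumes e: "e \<in> edges K" and x: "x \<in> {0..len K e}" "if b then x < len K e else 0 < x"
    and g: "(g has_real_derivative d) (at x within {0..len K e})"
    and f: "\<And>z. z \<in> {0..len K e} \<Longrightarrow> f (pos e z) = g z"
  shows "\<exists>\<delta>>0. (f has_real_derivative sg (\<sigma> e) * d)
    (at (pos e x) within (if b = \<sigma> e then {pos e x..pos e x + \<delta>} else {pos e x - \<delta>..pos e x}))"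
proof -
  define y where "y = pos e x"
  define inv where "inv = (\<lambda>y. sg (\<sigma> e) * (y - a e))"
  have inv_pos: "inv (pos e z) = z" and pos_inv: "pos e (inv z) = z" for z
    by (simp_all add: inv_def pos_def mult.assoc[symmetric] sg_sq)
  define \<delta> where "\<delta> = (if b then len K e - x else x)"
  have \<delta>: "0 < \<delta>" using x by (auto simp: \<delta>_def)
  define S where "S = (if b = \<sigma> e then {y..y + \<delta>} else {y - \<delta>..y})"
  have S: "inv z \<in> {0..len K e}" if "z \<in> S" for z
    using that x by (auto simp: S_def inv_def \<delta>_def y_def pos_def sg_def split: if_splits)
  have yS: "y \<in> S" using \<delta> by (auto simp: S_def)
  have "(g has_real_derivative d) (at (inv y) within inv ` S)"
    unfolding y_def inv_pos by (rule has_field_derivative_subset[OF g]) (use S in blast)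
  moreover have "(inv has_real_derivative sg (\<sigma> e)) (at y within S)"
    unfolding inv_def by (auto intro!: derivative_eq_intros)
  ultimately have "((\<lambda>z. g (inv z)) has_real_derivative sg (\<sigma> e) * d) (at y within S)"
    using DERIV_image_chain[of g d inv y S "sg (\<sigma> e)"] by (simp add: o_def mult.commute)
  then have "(f has_real_derivative sg (\<sigma> e) * d) (at y within S)"
  proof (rule has_field_derivative_transform_within[OF _ zero_less_one yS])
    fix z assume "z \<in> S"
    from f[OF S[OF this]] show "g (inv z) = f z" by (simp add: pos_inv)
  qed
  with \<delta> show ?thesis unfolding S_def y_def by blast
qed

text \<open>Let \<open>od\<close> be the derivative in a given direction, transported from \<open>K\<close>. At a dummy vertex there are
two directions, and the Kirchhoff condition of \<open>K\<close> says that the two one-sided derivatives agree, so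
the glued function is differentiable. The same computation applies to its derivative, with the
continuous values \<open>- \<mu> f\<close>.\<close>

lemma restrict_surj:
  assumes "g \<in> eigenspace K \<mu>"
  shows "\<exists>f\<in>eigenspace G \<mu>. restrict f = g"
proof -
  obtain w h where D: "eigen_pt K \<mu> g w h" using assms unfolding eigenspace_iff_pt[OF K] by blast
  define \<psi> where "\<psi> = inv_into (points K) \<phi>"
  have \<psi>: "\<psi> (\<phi> p) = p" if "p \<in> points K" for p
    using bij that unfolding \<psi>_def bij_betw_def by simp
  define f where "f = (\<lambda>e x. if e \<in> edges G \<and> x \<in> {0..len G e} then h (\<psi> (edge_pt G e x)) else 0)"
  have fg: "f (E e) (pos e x) = g e x" if "e \<in> edges K" "x \<in> {0..len K e}" for e x
  proof -
    have "f (E e) (pos e x) = h (\<psi> (\<phi> (edge_pt K e x)))"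
      using E[OF that(1)] pos_in[OF that] \<phi>_edge_pt[OF that] by (simp add: f_def)
    also have "\<dots> = h (edge_pt K e x)" using edge_pt_in_points[OF K that] \<psi> by simp
    also have "\<dots> = g e x" using D that unfolding eigen_pt_def by metis
    finally show ?thesis .
  qed
  define od where "od = (\<lambda>d. case the_inv_into (dirs K (\<psi> (case d of (e, y, c) \<Rightarrow> edge_pt G e y))) dmap d of
      (e', x, b) \<Rightarrow> sg b * w e' x)"
  have od: "od (dmap (e', x, b)) = sg b * w e' x" if "(e', x, b) \<in> dirs K p" for e' x b p
  proof -
    have e': "e' \<in> edges K" "x \<in> {0..len K e'}" "p = edge_pt K e' x" using that by (auto simp: dirs_def)
    have p: "p \<in> points K" using edge_pt_in_points[OF K e'(1,2)] e'(3) by simp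
    have "(case dmap (e', x, b) of (e, y, c) \<Rightarrow> edge_pt G e y) = \<phi> p"
      using \<phi>_edge_pt[OF e'(1,2)] e'(3) by (simp add: dmap_def)
    then have "the_inv_into (dirs K (\<psi> (case dmap (e', x, b) of (e, y, c) \<Rightarrow> edge_pt G e y))) dmap (dmap (e', x, b)) = (e', x, b)"
      using the_inv_into_f_f[OF dmap_inj[OF p] that] \<psi>[OF p] by simp
    then show ?thesis by (simp add: od_def)
  qed
  have sum_od: "(\<Sum>d\<in>dirs G (\<phi> p). od d) = 0" if p: "p \<in> points K" for p
  proof -
    have "(\<Sum>d\<in>dirs G (\<phi> p). od d) = (\<Sum>d\<in>dirs K p. od (dmap d))"
      by (rule sum.reindex_bij_betw[OF dmap_bij[OF p], symmetric])
    also have "\<dots> = (\<Sum>(e, x, b)\<in>dirs K p. sg b * w e x)"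
      by (intro sum.cong refl) (auto simp: od)
    also have "\<dots> = 0" using D p unfolding eigen_pt_def by blast
    finally show ?thesis .
  qed
  define v where "v = (\<lambda>e y. if y < len G e then od (e, y, True) else - od (e, y, False))"
  have v: "v e y = sg c * od (e, y, c)" if e: "e \<in> edges G" "y \<in> {0..len G e}" and c: "if c then y < len G e else 0 < y" for e y c
  proof (cases "0 < y \<and> y < len G e")
    case True
    then have "edge_pt G e y = Inner e y" by (simp add: edge_pt_def)
    moreover obtain p where p: "p \<in> points K" "\<phi> p = edge_pt G e y"
      using \<phi>_surj[OF edge_pt_in_points[OF G e]] by blast
    ultimately have "od (e, y, True) + od (e, y, False) = 0"
      using sum_od[OF p(1)] dirs_Inner[OF e(1), of y] True by simp
    then show ?thesis using True by (cases c) (simp_all add: v_def sg_def)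
  next
    case False
    then show ?thesis using c e lenG[OF e(1)] by (cases c) (auto simp: v_def sg_def)
  qed
  have vw: "v (E e) (pos e x) = sg (\<sigma> e) * w e x" if e: "e \<in> edges K" "x \<in> {0..len K e}" for e x
  proof -
    define b where "b = (x < len K e)"
    have d: "(e, x, b) \<in> dirs K (edge_pt K e x)" using e lenK[OF e(1)] by (auto simp: dirs_def b_def)
    from dmap_in[OF d] have "if b = \<sigma> e then pos e x < len G (E e) else 0 < pos e x"
      by (auto simp: dirs_def dmap_def)
    then have "v (E e) (pos e x) = sg (b = \<sigma> e) * od (dmap (e, x, b))"
      using v[OF E[OF e(1)] pos_in[OF e], of "b = \<sigma> e"] by (simp add: dmap_def)
    also have "\<dots> = sg (\<sigma> e) * (sg b * sg b) * w e x" unfolding od[OF d] sg_mult[symmetric] by simp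
    finally show ?thesis by (simp add: sg_sq)
  qed
  have helm: "helmholtz \<mu> (len G e) (f e) (v e)" if e: "e \<in> edges G" for e
    unfolding helmholtz_def
  proof (intro ballI)
    fix y assume y: "y \<in> {0..len G e}"
    have side: "\<exists>\<delta>>0. (f e has_real_derivative v e y) (at y within (if c then {y..y + \<delta>} else {y - \<delta>..y}))"
      "\<exists>\<delta>>0. (v e has_real_derivative - \<mu> * f e y) (at y within (if c then {y..y + \<delta>} else {y - \<delta>..y}))"
      if c: "if c then y < len G e else 0 < y" for c
    proof -
      obtain e' x b where x: "e' \<in> edges K" "x \<in> {0..len K e'}" "if b then x < len K e' else 0 < x"
        and ey: "E e' = e" "pos e' x = y" "c = (b = \<sigma> e')" using points_covered[OF e y c] by blast
      have H: "(g e' has_real_derivative w e' x) (at x within {0..len K e'})"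
        "(w e' has_real_derivative - \<mu> * g e' x) (at x within {0..len K e'})"
        using D x unfolding eigen_pt_def helmholtz_def by blast+
      have H2: "((\<lambda>x. sg (\<sigma> e') * w e' x) has_real_derivative sg (\<sigma> e') * (- \<mu> * g e' x)) (at x within {0..len K e'})"
        by (rule DERIV_cmult[OF H(2)])
      have s: "sg (\<sigma> e') * w e' x = v e y" using vw[OF x(1,2)] by (simp add: ey)
      have s2: "sg (\<sigma> e') * (sg (\<sigma> e') * (- \<mu> * g e' x)) = - \<mu> * f e y"
        using fg[OF x(1,2)] by (simp add: ey mult.assoc[symmetric] sg_sq)
      show "\<exists>\<delta>>0. (f e has_real_derivative v e y) (at y within (if c then {y..y + \<delta>} else {y - \<delta>..y}))"
        using derivative_along_segment[OF x H(1), of "f e"] fg[OF x(1)] unfolding ey s by blast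
      show "\<exists>\<delta>>0. (v e has_real_derivative - \<mu> * f e y) (at y within (if c then {y..y + \<delta>} else {y - \<delta>..y}))"
        using derivative_along_segment[OF x H2, of "v e"] vw[OF x(1)] unfolding ey s2 by blast
    qed
    show "(f e has_real_derivative v e y) (at y within {0..len G e}) \<and>
        (v e has_real_derivative - \<mu> * f e y) (at y within {0..len G e})"
      using side[of True] side[of False] by (intro conjI derivative_from_sides y lenG e) simp_all
  qed
  have "eigen_pt G \<mu> f v (\<lambda>q. h (\<psi> q))"
    unfolding eigen_pt_def
  proof (intro conjI ballI allI impI)
    show "f e x = 0" if "e \<notin> edges G \<or> x \<notin> {0..len G e}" for e x using that by (auto simp: f_def)
    show "f e x = h (\<psi> (edge_pt G e x))" if "e \<in> edges G" "x \<in> {0..len G e}" for e x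
      using that by (simp add: f_def)
    show "(\<Sum>(e, y, c)\<in>dirs G q. sg c * v e y) = 0" if q: "q \<in> points G" for q
    proof -
      obtain p where p: "p \<in> points K" "\<phi> p = q" using \<phi>_surj[OF q] by blast
      have "(\<Sum>(e, y, c)\<in>dirs G q. sg c * v e y) = (\<Sum>d\<in>dirs G q. od d)"
      proof (intro sum.cong refl, clarify)
        fix e y c assume "(e, y, c) \<in> dirs G q"
        then have "v e y = sg c * od (e, y, c)" by (intro v) (auto simp: dirs_def)
        then show "sg c * v e y = od (e, y, c)" by (simp add: mult.assoc[symmetric] sg_sq)
      qed
      then show ?thesis using sum_od[OF p(1)] p(2) by simp
    qed
  qed (rule helm)
  then have "f \<in> eigenspace G \<mu>" unfolding eigenspace_iff_pt[OF G] by blast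
  moreover have "restrict f = g"
  proof (intro ext)
    fix e x show "restrict f e x = g e x"
      using fg[of e x] D by (auto simp: restrict_def eigen_pt_def)
  qed
  ultimately show ?thesis by blast
qed

lemma restrict_zero:
  assumes f: "\<And>e x. e \<notin> edges G \<or> x \<notin> {0..len G e} \<Longrightarrow> f e x = 0" and "restrict f = 0"
  shows "f = 0"
proof (intro ext)
  fix e y
  show "f e y = 0 e y"
  proof (cases "e \<in> edges G \<and> y \<in> {0..len G e}")
    case True
    then have "if y < len G e then y < len G e else 0 < y" using lenG[of e] by auto
    then obtain e' x b where x: "e' \<in> edges K" "x \<in> {0..len K e'}" "E e' = e" "pos e' x = y"
      using points_covered[of e y "y < len G e"] True by blast
    have "restrict f e' x = f e y" using x by (simp add: restrict_def)
    with assms(2) show ?thesis by simp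
  qed (use f in auto)
qed

text \<open>Restriction is a linear bijection between the eigenspaces. Injectivity is needed on the span of a
basis, whose elements still vanish off the edges.\<close>

theorem multiplicity_eq: "multiplicity_of K \<mu> = multiplicity_of G \<mu>"
proof -
  interpret m: module_hom graph_scale graph_scale restrict
    by unfold_locales (auto simp: restrict_def fun_eq_iff algebra_simps)
  obtain B where B: "B \<subseteq> eigenspace G \<mu>" "gs.independent B" "eigenspace G \<mu> \<subseteq> gs.span B"
      "card B = gs.dim (eigenspace G \<mu>)"
    using gs.basis_exists by blast
  let ?Z = "{f. \<forall>e x. e \<notin> edges G \<or> x \<notin> {0..len G e} \<longrightarrow> f e x = 0} :: ('e \<Rightarrow> real \<Rightarrow> real) set"
  have "gs.subspace ?Z" by (rule gs.subspaceI) auto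
  moreover have "B \<subseteq> ?Z" using B(1) by (auto simp: eigenspace_iff_pt[OF G] eigen_pt_def)
  ultimately have spanZ: "gs.span B \<subseteq> ?Z" by (rule gs.span_minimal[rotated])
  have inj: "inj_on restrict (gs.span B)"
  proof (subst m.inj_on_iff_eq_0[OF gs.subspace_span], intro ballI impI)
    fix f assume "f \<in> gs.span B" "restrict f = 0"
    then show "f = 0" using spanZ by (intro restrict_zero) auto
  qed
  have ind: "gs.independent (restrict ` B)" by (rule m.independent_injective_image[OF B(2) inj])
  have "gs.dim (eigenspace K \<mu>) = card (restrict ` B)"
  proof (rule gs.dim_unique[OF _ _ ind refl])
    show "restrict ` B \<subseteq> eigenspace K \<mu>" using B(1) restrict_eigenspace by blast
    show "eigenspace K \<mu> \<subseteq> gs.span (restrict ` B)"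
      unfolding m.span_image using restrict_surj B(3) by blast
  qed
  also have "card (restrict ` B) = card B"
    by (rule card_image) (rule inj_on_subset[OF inj gs.span_superset])
  finally show ?thesis using B(4) by (simp add: multiplicity_of_def)
qed

corollary eigenvalue_eq: "eigenvalue K k = eigenvalue G k"
  by (simp add: eigenvalue_def multiplicity_eq)

end

section \<open>Cycles and dummy vertices\<close>

text \<open>At an inner point the second direction is on the same edge.\<close>

lemma leafless_dirs:
  assumes G: "compact_metric_graph G" and F: "leafless (endpt G) {} F" "F \<subseteq> edges G"
    and q: "q \<in> points G" and d: "d \<in> dirs G q" "fst d \<in> F"
  shows "\<exists>d'\<in>dirs G q. d' \<noteq> d \<and> fst d' \<in> F"
  using q
proof (cases rule: points_cases)
  case (Vertex w)
  then obtain e b where eb: "d = (e, end_pos G e b, b)" "(e, b) \<in> darts G w"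
    using d(1) unfolding Vertex dirs_Vertex[OF G] by auto
  then obtain e' b' where e': "e' \<in> F" "(e', b') \<noteq> (e, b)" "endpt G e' b' = endpt G e b"
    using leaflessD[OF F(1), of e b] d(2) by auto
  then have "(e', b') \<in> darts G w" using eb F(2) by (auto simp: darts_def)
  then have "(e', end_pos G e' b', b') \<in> dirs G q" unfolding Vertex dirs_Vertex[OF G] by force
  then show ?thesis using e' eb by (intro bexI[of _ "(e', end_pos G e' b', b')"]) auto
next
  case (Inner e x)
  note di = dirs_Inner[OF Inner(2-4)]
  show ?thesis
    using d unfolding Inner(1) di by (cases "snd (snd d)") auto
qed

lemma topspace_graph_topology:
  assumes "compact_metric_graph G"
  shows "topspace (graph_topology G) = points G"
proof
  show "topspace (graph_topology G) \<subseteq> points G"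
    unfolding topspace_def by (auto simp: openin_graph_topology graph_open_def)
  have "graph_open G (points G)"
    unfolding graph_open_def
  proof (intro conjI ballI)
    fix e assume "e \<in> edges G"
    then have "{x \<in> {0..len G e}. edge_pt G e x \<in> points G} = {0..len G e}"
      using edge_pt_in_points[OF assms] by blast
    then show "openin (top_of_set {0..len G e}) {x \<in> {0..len G e}. edge_pt G e x \<in> points G}" by simp
  qed simp
  then show "points G \<subseteq> topspace (graph_topology G)"
    by (simp add: openin_graph_topology openin_subset)
qed

context refinement begin

definition pull :: "'e set \<Rightarrow> 'f set" where "pull F = {e \<in> edges K. E e \<in> F}"

lemma leafless_pull:
  assumes F: "leafless (endpt G) {} F" "F \<subseteq> edges G"
  shows "leafless (endpt K) {} (pull F)"
  unfolding leafless_def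
proof (intro conjI ballI allI impI)
  obtain e where e: "e \<in> F" using F by (auto simp: leafless_def)
  then have "0 < len G e" using lenG F by blast
  then obtain e' where "e' \<in> edges K" "E e' = e"
    using points_covered[of e 0 True] e F by auto
  then show "pull F \<noteq> {}" using e by (auto simp: pull_def)
next
  fix e b assume e: "e \<in> pull F"
  then have eK: "e \<in> edges K" "E e \<in> F" by (auto simp: pull_def)
  define w where "w = endpt K e b"
  have p: "Vertex w \<in> points K" using compact_metric_graphD(4)[OF K eK(1)] by (simp add: points_def w_def)
  have d: "(e, end_pos K e b, b) \<in> dirs K (Vertex w)"
    unfolding dirs_Vertex[OF K] using eK by (auto simp: darts_def w_def)
  obtain d2 where d2: "d2 \<in> dirs G (\<phi> (Vertex w))" "d2 \<noteq> dmap (e, end_pos K e b, b)" "fst d2 \<in> F"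
    using leafless_dirs[OF G F \<phi>_in[OF p] dmap_in[OF d]] eK by (auto simp: dmap_def)
  obtain d3 where d3: "d3 \<in> dirs K (Vertex w)" "dmap d3 = d2" using dmap_surj[OF d2(1) p] by blast
  then obtain e' b' where e': "d3 = (e', end_pos K e' b', b')" "(e', b') \<in> darts K w"
    unfolding dirs_Vertex[OF K] by auto
  have "e' \<in> pull F" using d2(3) d3(2) e' by (auto simp: pull_def dmap_def darts_def)
  moreover have "(e', b') \<noteq> (e, b)"
  proof
    assume "(e', b') = (e, b)"
    then have "d3 = (e, end_pos K e b, b)" using e'(1) by simp
    with d2(2) d3(2) show False by simp
  qed
  moreover have "endpt K e' b' = endpt K e b" using e'(2) by (simp add: darts_def w_def)
  ultimately show "\<exists>e'\<in>pull F. \<exists>b'. (e', b') \<noteq> (e, b) \<and> endpt K e' b' = endpt K e b" by blast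
qed

lemma pos_image: "pos e ` {0<..<len K e} = (if \<sigma> e then {a e<..<a e + len K e} else {a e - len K e<..<a e})"
proof (intro equalityI subsetI)
  fix y assume y: "y \<in> (if \<sigma> e then {a e<..<a e + len K e} else {a e - len K e<..<a e})"
  show "y \<in> pos e ` {0<..<len K e}"
    by (rule image_eqI[of _ _ "sg (\<sigma> e) * (y - a e)"])
       (use y in \<open>auto simp: pos_def sg_def split: if_splits\<close>)
qed (auto simp: pos_def sg_def split: if_splits)

lemma pos_image_measure:
  assumes "e \<in> edges K"
  shows "pos e ` {0<..<len K e} \<in> lmeasurable" "measure lebesgue (pos e ` {0<..<len K e}) = len K e"
  using lenK[OF assms] unfolding pos_image by auto

text \<open>Different edges of \<open>K\<close> are mapped to disjoint open segments.\<close>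

lemma length_pull:
  assumes F: "F \<subseteq> edges G"
  shows "sum (len K) (pull F) \<le> sum (len G) F"
proof -
  have finK: "finite (edges K)" and finF: "finite F"
    using compact_metric_graphD(1)[OF K] compact_metric_graphD(1)[OF G] F finite_subset by blast+
  have edge: "sum (len K) {e' \<in> pull F. E e' = e} \<le> len G e" if e: "e \<in> F" for e
  proof -
    let ?I = "{e' \<in> pull F. E e' = e}"
    have I: "e' \<in> edges K" "E e' = e" if "e' \<in> ?I" for e' using that by (auto simp: pull_def)
    have "sum (len K) ?I = (\<Sum>e'\<in>?I. measure lebesgue (pos e' ` {0<..<len K e'}))"
      by (intro sum.cong refl pos_image_measure(2)[symmetric]) (rule I(1))
    also have "\<dots> = measure lebesgue (\<Union>e'\<in>?I. pos e' ` {0<..<len K e'})"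
    proof (rule measure_finite_Union[symmetric])
      show "finite ?I" using finK by (auto simp: pull_def)
      show "disjoint_family_on (\<lambda>e'. pos e' ` {0<..<len K e'}) ?I"
        unfolding disjoint_family_on_def
      proof (intro ballI impI equals0I)
        fix e1 e2 y assume *: "e1 \<in> ?I" "e2 \<in> ?I" "e1 \<noteq> e2"
          "y \<in> pos e1 ` {0<..<len K e1} \<inter> pos e2 ` {0<..<len K e2}"
        then obtain x1 x2 where x: "0 < x1" "x1 < len K e1" "0 < x2" "x2 < len K e2" "pos e1 x1 = pos e2 x2" by auto
        have "\<phi> (edge_pt K e1 x1) = \<phi> (edge_pt K e2 x2)"
          using x \<phi>_edge_pt[OF I(1)[OF *(1)], of x1] \<phi>_edge_pt[OF I(1)[OF *(2)], of x2] I(2)[OF *(1)] I(2)[OF *(2)]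
          by simp
        then have "edge_pt K e1 x1 = edge_pt K e2 x2"
          using x by (intro \<phi>_inj edge_pt_in_points[OF K] I(1)[OF *(1)] I(1)[OF *(2)]) auto
        then show False using x *(3) by (simp add: edge_pt_def)
      qed
      show "(\<lambda>e'. pos e' ` {0<..<len K e'}) ` ?I \<subseteq> sets lebesgue"
        using pos_image_measure(1)[OF I(1)] by (auto dest: fmeasurableD)
      show "emeasure lebesgue (pos e' ` {0<..<len K e'}) \<noteq> \<infinity>" if "e' \<in> ?I" for e'
        by (simp only: infinity_ennreal_def) (rule fmeasurableD2[OF pos_image_measure(1)[OF I(1)[OF that]]])
    qed
    also have "\<dots> \<le> measure lebesgue {0..len G e}"
    proof (rule measure_mono_fmeasurable)
      show "(\<Union>e'\<in>?I. pos e' ` {0<..<len K e'}) \<subseteq> {0..len G e}"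
      proof
        fix y assume "y \<in> (\<Union>e'\<in>?I. pos e' ` {0<..<len K e'})"
        then obtain e' x where x: "e' \<in> ?I" "0 < x" "x < len K e'" "y = pos e' x" by auto
        then show "y \<in> {0..len G e}" using pos_in[OF I(1)[OF x(1)], of x] I(2)[OF x(1)] by simp
      qed
      have "finite ?I" using finK by (auto simp: pull_def)
      then show "(\<Union>e'\<in>?I. pos e' ` {0<..<len K e'}) \<in> sets lebesgue"
        using pos_image_measure(1)[OF I(1)] by (intro sets.finite_UN) (auto dest: fmeasurableD)
    qed auto
    also have "\<dots> = len G e" using lenG[of e] e F by (auto simp: less_imp_le)
    finally show ?thesis .
  qed
  have "sum (len K) (pull F) = (\<Sum>e\<in>F. sum (len K) {e' \<in> pull F. E e' = e})"
    by (rule sum.group[symmetric]) (use finK finF in \<open>auto simp: pull_def\<close>)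
  also have "\<dots> \<le> sum (len G) F" by (rule sum_mono[OF edge])
  finally show ?thesis .
qed

lemma continuous_\<phi>: "continuous_map (graph_topology K) (graph_topology G) \<phi>"
  unfolding continuous_map_def topspace_graph_topology[OF G] topspace_graph_topology[OF K]
proof (intro conjI allI impI funcsetI \<phi>_in)
  fix U assume "openin (graph_topology G) U"
  then have U: "graph_open G U" by (simp add: openin_graph_topology)
  have "openin (top_of_set {0..len K e}) {x \<in> {0..len K e}. edge_pt K e x \<in> {p \<in> points K. \<phi> p \<in> U}}"
    if e: "e \<in> edges K" for e
  proof -
    let ?V = "{y \<in> {0..len G (E e)}. edge_pt G (E e) y \<in> U}"
    have "{x \<in> {0..len K e}. edge_pt K e x \<in> {p \<in> points K. \<phi> p \<in> U}} = {0..len K e} \<inter> pos e -` ?V"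
      using edge_pt_in_points[OF K e] \<phi>_edge_pt[OF e] pos_in[OF e] by auto
    moreover have "openin (top_of_set {0..len K e}) ({0..len K e} \<inter> pos e -` ?V)"
    proof (rule continuous_openin_preimage)
      show "continuous_on {0..len K e} (pos e)" unfolding pos_def by (intro continuous_intros)
      show "pos e \<in> {0..len K e} \<rightarrow> {0..len G (E e)}" using pos_in[OF e] by blast
      show "openin (top_of_set {0..len G (E e)}) ?V" using U E[OF e] by (auto simp: graph_open_def)
    qed
    ultimately show ?thesis by simp
  qed
  then show "openin (graph_topology K) {p \<in> points K. \<phi> p \<in> U}"
    unfolding openin_graph_topology graph_open_def by blast
qed

lemma cycle_push:
  assumes "is_cycle K C"
  shows "is_cycle G (\<phi> ` C)"
proof -
  obtain \<gamma> where \<gamma>: "continuous_map (top_of_set {0..1::real}) (graph_topology K) \<gamma>" "\<gamma> 0 = \<gamma> 1"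
    "inj_on \<gamma> {0..<1}" "C = \<gamma> ` {0..1}" using assms by (auto simp: is_cycle_def)
  have mem: "\<gamma> t \<in> points K" if "t \<in> {0..1}" for t
    using \<gamma>(1) that unfolding continuous_map_def topspace_graph_topology[OF K] by auto
  show ?thesis
    unfolding is_cycle_def
  proof (intro exI[of _ "\<phi> \<circ> \<gamma>"] conjI)
    show "continuous_map (top_of_set {0..1}) (graph_topology G) (\<phi> \<circ> \<gamma>)"
      by (rule continuous_map_compose[OF \<gamma>(1) continuous_\<phi>])
    show "inj_on (\<phi> \<circ> \<gamma>) {0..<1}"
      by (rule comp_inj_on[OF \<gamma>(3)]) (intro inj_onI \<phi>_inj; use mem in auto)
  qed (use \<gamma> in auto)
qed

text \<open>Vertices of \<open>K\<close> may become inner points of edges, but there are only finitely many of them.\<close>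

lemma length_push:
  assumes C: "C \<subseteq> points K" and F: "F \<subseteq> edges K" and CF: "\<And>e x. Inner e x \<in> C \<Longrightarrow> e \<in> F"
  shows "total_length G (\<phi> ` C) \<le> sum (len K) F"
proof -
  have finF: "finite F" using compact_metric_graphD(1)[OF K] F finite_subset by blast
  have finG: "finite (edges G)" using compact_metric_graphD(1)[OF G] .
  have edge: "measure lebesgue {x. 0 < x \<and> x < len G e \<and> Inner e x \<in> \<phi> ` C} \<le> sum (len K) {e' \<in> F. E e' = e}"
    (is "measure _ ?A \<le> _") if "e \<in> edges G" for e
  proof (cases "?A \<in> sets lebesgue")
    case False
    then have "measure lebesgue ?A = 0" by (simp add: measure_notin_sets)
    moreover have "0 \<le> sum (len K) {e' \<in> F. E e' = e}"
      by (rule sum_nonneg) (use lenK F in \<open>auto intro: less_imp_le\<close>)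
    ultimately show ?thesis by simp
  next
    case True
    let ?I = "{e' \<in> F. E e' = e}"
    define X where "X = {x. Inner e x \<in> \<phi> ` Vertex ` verts K}"
    have "finite (Inner e ` X :: ('v, 'e) gpoint set)"
      by (rule finite_subset[of _ "\<phi> ` Vertex ` verts K"]) (use compact_metric_graphD(2)[OF K] in \<open>auto simp: X_def\<close>)
    then have finX: "finite X" by (rule finite_imageD) (auto simp: inj_on_def)
    have sub: "?A \<subseteq> (\<Union>e'\<in>?I. pos e' ` {0<..<len K e'}) \<union> X"
    proof
      fix x assume "x \<in> ?A"
      then obtain p where p: "p \<in> C" "\<phi> p = Inner e x" by auto
      then have "p \<in> points K" using C by blast
      then show "x \<in> (\<Union>e'\<in>?I. pos e' ` {0<..<len K e'}) \<union> X"
      proof (cases rule: points_cases)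
        case (Vertex w)
        then have "Inner e x \<in> \<phi> ` Vertex ` verts K" using p(2)[symmetric] by simp
        then show ?thesis by (simp add: X_def)
      next
        case (Inner e' y)
        have "edge_pt K e' y = p" using Inner by (simp add: edge_pt_def)
        then have "edge_pt G (E e') (pos e' y) = Inner e x" using p \<phi>_edge_pt[OF Inner(2), of y] Inner by simp
        then have "E e' = e" "pos e' y = x" by (auto simp: edge_pt_eq_Inner)
        moreover have "e' \<in> F" using CF p Inner by blast
        ultimately show ?thesis using Inner by auto
      qed
    qed
    have I: "e' \<in> edges K" if "e' \<in> ?I" for e' using that F by auto
    have U: "(\<Union>e'\<in>?I. pos e' ` {0<..<len K e'}) \<in> lmeasurable"
      using finF pos_image_measure(1)[OF I] by (intro fmeasurable.finite_UN) auto
    have X: "X \<in> lmeasurable" "measure lebesgue X = 0"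
      using finX by (auto simp: negligible_imp_measurable negligible_imp_measure0 negligible_finite)
    have "measure lebesgue ?A \<le> measure lebesgue ((\<Union>e'\<in>?I. pos e' ` {0<..<len K e'}) \<union> X)"
      using True U X by (intro measure_mono_fmeasurable[OF sub]) auto
    also have "\<dots> \<le> measure lebesgue (\<Union>e'\<in>?I. pos e' ` {0<..<len K e'}) + measure lebesgue X"
      using U X by (intro measure_Un_le) (auto dest: fmeasurableD)
    also have "measure lebesgue (\<Union>e'\<in>?I. pos e' ` {0<..<len K e'}) \<le> (\<Sum>e'\<in>?I. measure lebesgue (pos e' ` {0<..<len K e'}))"
      using finF pos_image_measure(1)[OF I] by (intro measure_UNION_le) (auto dest: fmeasurableD)
    also have "\<dots> = sum (len K) ?I" by (intro sum.cong refl pos_image_measure(2)) (rule I)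
    finally show ?thesis using X by simp
  qed
  have "total_length G (\<phi> ` C) \<le> (\<Sum>e\<in>edges G. sum (len K) {e' \<in> F. E e' = e})"
    unfolding total_length_def by (rule sum_mono[OF edge])
  also have "\<dots> = sum (len K) F"
    by (rule sum.group) (use finF finG F E in auto)
  finally show ?thesis .
qed

end

section \<open>Leafless edge sets contain cycles\<close>

lemma continuous_map_pieces:
  fixes g :: "real \<Rightarrow> 'a" and A B :: real
  assumes m: "\<And>m::int. real_of_int m < B \<Longrightarrow> A < real_of_int m + 1 \<Longrightarrow> continuous_map (top_of_set ({real_of_int m..real_of_int m + 1} \<inter> {A..B})) Y g"
    and AB: "A < B"
  shows "continuous_map (top_of_set {A..B}) Y g"
proof (rule pasting_lemma_closed[where I = "{m::int. real_of_int m < B \<and> A < real_of_int m + 1}" and T = "\<lambda>m. {real_of_int m..real_of_int m + 1} \<inter> {A..B}" and f = "\<lambda>_. g"])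
  have "{m::int. real_of_int m < B \<and> A < real_of_int m + 1} \<subseteq> {\<lfloor>A\<rfloor>..\<lceil>B\<rceil>}"
  proof
    fix m :: int assume "m \<in> {m::int. real_of_int m < B \<and> A < real_of_int m + 1}"
    then have "real_of_int m < B" "A < real_of_int m + 1" by auto
    then show "m \<in> {\<lfloor>A\<rfloor>..\<lceil>B\<rceil>}" unfolding atLeastAtMost_iff by linarith
  qed
  then show "finite {m::int. real_of_int m < B \<and> A < real_of_int m + 1}" by (rule finite_subset) simp
  fix i :: int
  show "closedin (top_of_set {A..B}) ({real_of_int i..real_of_int i + 1} \<inter> {A..B})"
    by (metis closed_closedin closed_real_atLeastAtMost closedin_closed_Int inf_commute)
  assume "i \<in> {m::int. real_of_int m < B \<and> A < real_of_int m + 1}"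
  then show "continuous_map (subtopology (top_of_set {A..B}) ({real_of_int i..real_of_int i + 1} \<inter> {A..B})) Y g"
    using m[of i] by (simp add: subtopology_subtopology Int_absorb1)
next
  fix x assume "x \<in> topspace (top_of_set {A..B})"
  then have x: "A \<le> x" "x \<le> B" by auto
  show "\<exists>j. j \<in> {m::int. real_of_int m < B \<and> A < real_of_int m + 1} \<and> x \<in> {real_of_int j..real_of_int j + 1} \<inter> {A..B} \<and> g x = g x"
  proof (cases "real_of_int \<lfloor>x\<rfloor> < B")
    case True
    then show ?thesis using x by (intro exI[of _ "\<lfloor>x\<rfloor>"]) (auto, linarith+)
  next
    case False
    then have "real_of_int \<lfloor>x\<rfloor> = x" "x = B" using x by linarith+
    then show ?thesis using x AB by (intro exI[of _ "\<lfloor>x\<rfloor> - 1"]) auto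
  qed
qed auto

lemma continuous_edge_pt:
  assumes G: "compact_metric_graph G" and e: "e \<in> edges G"
  shows "continuous_map (top_of_set {0..len G e}) (graph_topology G) (edge_pt G e)"
  unfolding continuous_map_def topspace_graph_topology[OF G]
  using edge_pt_in_points[OF G e] e by (auto simp: openin_graph_topology graph_open_def)

lemma continuous_on_graph:
  fixes h :: "('v, 'e) gpoint \<Rightarrow> real"
  assumes G: "compact_metric_graph G"
    and h: "\<And>e. e \<in> edges G \<Longrightarrow> continuous_on {0..len G e} (\<lambda>x. h (edge_pt G e x))"
  shows "continuous_map (graph_topology G) euclideanreal h"
  unfolding continuous_map_def
proof (intro conjI allI impI)
  fix U assume U: "openin euclideanreal U"
  have "openin (top_of_set {0..len G e}) {x \<in> {0..len G e}. edge_pt G e x \<in> {p \<in> points G. h p \<in> U}}"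
    if e: "e \<in> edges G" for e
  proof -
    have "{x \<in> {0..len G e}. edge_pt G e x \<in> {p \<in> points G. h p \<in> U}} = {0..len G e} \<inter> (\<lambda>x. h (edge_pt G e x)) -` U"
      using edge_pt_in_points[OF G e] by auto
    then show ?thesis using continuous_openin_preimage_gen[OF h[OF e], of U] U by simp
  qed
  then show "openin (graph_topology G) {x \<in> topspace (graph_topology G). h x \<in> U}"
    unfolding openin_graph_topology graph_open_def topspace_graph_topology[OF G] by blast
qed auto

definition edge_coord :: "('v, 'e) mgraph \<Rightarrow> 'e \<times> bool \<Rightarrow> real \<Rightarrow> real" where
  "edge_coord G d r = (if snd d then r else 1 - r) * len G (fst d)"

text \<open>Since no dart is alone at its vertex, a walk can leave each vertex by a dart different from the one
it came by. Up to the first repetition of a vertex its edges are distinct: an edge used twice would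
be reversed immediately. So the walk between the two visits, traversed at unit speed per edge, is an
injective loop.\<close>

lemma cycle_in_leafless:
  fixes G :: "('v, 'e) mgraph"
  assumes G: "compact_metric_graph G" and F: "leafless (endpt G) {} F" "F \<subseteq> edges G"
  shows "\<exists>C. is_cycle G C \<and> C \<subseteq> points G \<and> (\<forall>e x. Inner e x \<in> C \<longrightarrow> e \<in> F)"
proof -
  have "\<forall>d. \<exists>d'. fst d \<in> F \<longrightarrow> fst d' \<in> F \<and> d' \<noteq> (fst d, \<not> snd d) \<and>
      endpt G (fst d') (snd d') = endpt G (fst d) (\<not> snd d)"
  proof
    fix d :: "'e \<times> bool"
    show "\<exists>d'. fst d \<in> F \<longrightarrow> fst d' \<in> F \<and> d' \<noteq> (fst d, \<not> snd d) \<and>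
      endpt G (fst d') (snd d') = endpt G (fst d) (\<not> snd d)"
    proof (cases "fst d \<in> F")
      case True
      obtain e' b' where "e' \<in> F" "(e', b') \<noteq> (fst d, \<not> snd d)" "endpt G e' b' = endpt G (fst d) (\<not> snd d)"
        by (rule leaflessD[OF F(1) True, of "\<not> snd d"]) auto
      then show ?thesis by (intro exI[of _ "(e', b')"]) (simp only: fst_conv snd_conv simp_thms)
    qed simp
  qed
  from choice[OF this] obtain nxt :: "'e \<times> bool \<Rightarrow> 'e \<times> bool" where
    nxt0: "\<forall>d. fst d \<in> F \<longrightarrow> fst (nxt d) \<in> F \<and> nxt d \<noteq> (fst d, \<not> snd d) \<and>
      endpt G (fst (nxt d)) (snd (nxt d)) = endpt G (fst d) (\<not> snd d)"
    by (elim exE)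
  obtain e0 where e0: "e0 \<in> F" using F by (auto simp: leafless_def)
  define D where "D = (\<lambda>n. (nxt ^^ n) (e0, True))"
  define v where "v = (\<lambda>n. endpt G (fst (D n)) (snd (D n)))"
  have DF: "fst (D n) \<in> F" for n
  proof (induction n)
    case 0 then show ?case using e0 by (simp add: D_def)
  next
    case (Suc n)
    from nxt0[THEN spec, THEN mp, OF Suc] show ?case by (simp add: D_def)
  qed
  have Dn: "D (Suc n) \<noteq> (fst (D n), \<not> snd (D n))" "v (Suc n) = endpt G (fst (D n)) (\<not> snd (D n))" for n
    using nxt0[THEN spec, of "D n"] DF[of n] by (simp_all add: v_def) (simp_all add: D_def)
  have DE: "fst (D n) \<in> edges G" for n using DF F by blast
  have len: "0 < len G (fst (D n))" for n using compact_metric_graphD(3)[OF G DE] .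
  have "\<not> inj v"
  proof
    assume "inj v"
    moreover have "range v \<subseteq> verts G" using compact_metric_graphD(4)[OF G DE] by (auto simp: v_def)
    ultimately show False
      using compact_metric_graphD(2)[OF G] by (meson finite_imageD finite_subset infinite_UNIV_nat)
  qed
  then have "\<exists>j. \<exists>i<j. v i = v j" unfolding inj_def by (metis linorder_neqE_nat)
  \<comment> \<open>The first repetition.\<close>
  define j where "j = (LEAST j. \<exists>i<j. v i = v j)"
  obtain i where i: "i < j" "v i = v j" using LeastI_ex[OF \<open>\<exists>j. \<exists>i<j. v i = v j\<close>] unfolding j_def by blast
  have vinj: "m = n" if "m < j" "n < j" "v m = v n" for m n
  proof (rule ccontr)
    assume "m \<noteq> n"
    then have "\<exists>i<max m n. v i = v (max m n)"
      using that by (cases "m < n") (auto simp: max_def intro!: exI[of _ "min m n"] split: if_splits)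
    then have "j \<le> max m n" unfolding j_def by (rule Least_le)
    with that show False by simp
  qed
  have einj_less: "fst (D m) \<noteq> fst (D n)" if mn: "m < n" "n < j" for m n
  proof
    assume eq: "fst (D m) = fst (D n)"
    have "snd (D n) = (\<not> snd (D m))"
    proof (rule ccontr)
      assume "snd (D n) \<noteq> (\<not> snd (D m))"
      then have "v m = v n" using eq by (simp add: v_def)
      with vinj[of m n] mn show False by simp
    qed
    then have Dn': "D n = (fst (D m), \<not> snd (D m))" using eq by (simp add: prod_eq_iff)
    then have "v n = v (Suc m)" using Dn(2)[of m] by (simp add: v_def)
    then have "n = Suc m" using vinj[of n "Suc m"] mn by simp
    with Dn' Dn(1)[of m] show False by simp
  qed
  have einj: "m = n" if "m < j" "n < j" "fst (D m) = fst (D n)" for m n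
    using einj_less[of m n] einj_less[of n m] that by (metis linorder_neqE_nat)
  \<comment> \<open>The walk in continuous time, one edge per unit.\<close>
  define P where "P = (\<lambda>\<tau>. let m = nat \<lfloor>\<tau>\<rfloor> in edge_pt G (fst (D m)) (edge_coord G (D m) (\<tau> - real m)))"
  have start: "edge_pt G (fst (D m)) (edge_coord G (D m) 0) = Vertex (v m)" for m
    using len[of m] by (auto simp: edge_pt_def edge_coord_def v_def endpt_def)
  have stop: "edge_pt G (fst (D m)) (edge_coord G (D m) 1) = Vertex (v (Suc m))" for m
    using len[of m] Dn(2)[of m] by (auto simp: edge_pt_def edge_coord_def endpt_def)
  have Pm: "P \<tau> = edge_pt G (fst (D m)) (edge_coord G (D m) (\<tau> - real m))"
    if "real m \<le> \<tau>" "\<tau> \<le> real m + 1" for m \<tau>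
  proof (cases "\<tau> = real m + 1")
    case True
    then have "nat \<lfloor>\<tau>\<rfloor> = Suc m" by linarith
    then show ?thesis using True start[of "Suc m"] stop[of m] by (simp add: P_def Let_def)
  next
    case False
    then have "nat \<lfloor>\<tau>\<rfloor> = m" using that by linarith
    then show ?thesis by (simp add: P_def Let_def)
  qed
  have coord_in: "edge_coord G (D m) r \<in> {0..len G (fst (D m))}" if "r \<in> {0..1}" for m r
    using that len[of m] by (auto simp: edge_coord_def mult_le_cancel_right1 mult_left_le_one_le)
  have contP: "continuous_map (top_of_set {real i..real j}) (graph_topology G) P"
  proof (rule continuous_map_pieces)
    fix m :: int assume m: "real_of_int m < real j" "real i < real_of_int m + 1"
    define k where "k = nat m"
    have k: "real_of_int m = real k" using m unfolding k_def by linarith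
    let ?S = "{real_of_int m..real_of_int m + 1} \<inter> {real i..real j}"
    have "continuous_map (top_of_set ?S) (top_of_set {0..len G (fst (D k))}) (\<lambda>\<tau>. edge_coord G (D k) (\<tau> - real k))"
    proof -
      have "continuous_on ?S (\<lambda>\<tau>. edge_coord G (D k) (\<tau> - real k))"
        unfolding edge_coord_def by (cases "snd (D k)") (auto intro!: continuous_intros)
      moreover have "edge_coord G (D k) (\<tau> - real k) \<in> {0..len G (fst (D k))}" if "\<tau> \<in> ?S" for \<tau>
        using that k by (intro coord_in) auto
      ultimately show ?thesis by (auto simp: continuous_map_in_subtopology)
    qed
    from continuous_map_compose[OF this continuous_edge_pt[OF G DE]]
    show "continuous_map (top_of_set ({real_of_int m..real_of_int m + 1} \<inter> {real i..real j})) (graph_topology G) P"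
      by (rule continuous_map_eq) (use Pm[of k] k in auto)
  qed (use i in simp)
  have Pinj: "\<tau> = \<tau>'" if t: "\<tau> \<in> {real i..<real j}" "\<tau>' \<in> {real i..<real j}" "P \<tau> = P \<tau>'" for \<tau> \<tau>'
  proof -
    define m m' where "m = nat \<lfloor>\<tau>\<rfloor>" and "m' = nat \<lfloor>\<tau>'\<rfloor>"
    define r r' where "r = \<tau> - real m" and "r' = \<tau>' - real m'"
    have r: "0 \<le> r" "r < 1" "0 \<le> r'" "r' < 1" "m < j" "m' < j"
      using t(1,2) unfolding r_def r'_def m_def m'_def by auto linarith+
    have val: "edge_pt G (fst (D n)) (edge_coord G (D n) s) =
        (if s = 0 then Vertex (v n) else Inner (fst (D n)) (edge_coord G (D n) s))"
      if "0 \<le> s" "s < 1" for n s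
    proof (cases "s = 0")
      case True then show ?thesis using start by simp
    next
      case False
      then have "edge_coord G (D n) s \<noteq> 0" "edge_coord G (D n) s \<noteq> len G (fst (D n))"
        using that len[of n] by (auto simp: edge_coord_def)
      with False show ?thesis by (simp add: edge_pt_def)
    qed
    have eq: "(if r = 0 then Vertex (v m) else Inner (fst (D m)) (edge_coord G (D m) r)) =
        (if r' = 0 then Vertex (v m') else Inner (fst (D m')) (edge_coord G (D m') r'))"
      using t(3) unfolding P_def Let_def m_def[symmetric] m'_def[symmetric] r_def[symmetric] r'_def[symmetric]
        val[OF r(1,2)] val[OF r(3,4)] .
    have "m = m' \<and> r = r'"
    proof (cases "r = 0")
      case True
      then have "r' = 0" "v m = v m'" using eq by (auto split: if_splits)
      with True vinj[OF r(5,6)] show ?thesis by simp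
    next
      case False
      then have *: "r' \<noteq> 0" "fst (D m) = fst (D m')" "edge_coord G (D m) r = edge_coord G (D m') r'"
        using eq by (auto split: if_splits)
      have "m = m'" by (rule einj[OF r(5,6) *(2)])
      then show ?thesis using *(3) len[of m] by (auto simp: edge_coord_def split: if_splits)
    qed
    then show ?thesis by (simp add: r_def r'_def)
  qed
  define \<gamma> where "\<gamma> = (\<lambda>t. P (real i + t * (real j - real i)))"
  have rng: "real i + t * (real j - real i) \<in> {real i..real j}" if "t \<in> {0..1}" for t
  proof -
    have "t * (real j - real i) \<le> real j - real i" using that i by (intro mult_left_le_one_le) auto
    from add_left_mono[OF this, of "real i"] that i show ?thesis by simp
  qed
  have cont\<gamma>: "continuous_map (top_of_set {0..1}) (graph_topology G) \<gamma>"
  proof -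
    have "continuous_map (top_of_set {0..1}) (top_of_set {real i..real j}) (\<lambda>t. real i + t * (real j - real i))"
      using rng by (auto simp: continuous_map_in_subtopology intro!: continuous_intros)
    from continuous_map_compose[OF this contP] show ?thesis by (simp add: \<gamma>_def o_def)
  qed
  have PF: "e \<in> F" if "P \<tau> = Inner e x" for \<tau> e x
    using that DF by (auto simp: P_def Let_def edge_pt_eq_Inner)
  have "is_cycle G (\<gamma> ` {0..1})"
    unfolding is_cycle_def
  proof (intro exI[of _ \<gamma>] conjI cont\<gamma> refl)
    show "\<gamma> 0 = \<gamma> 1" using Pm[of i "real i"] Pm[of j "real j"] start[of i] start[of j] i by (simp add: \<gamma>_def)
    show "inj_on \<gamma> {0..<1}"
    proof (rule inj_onI)
      fix t t' :: real assume t: "t \<in> {0..<1}" "t' \<in> {0..<1}" "\<gamma> t = \<gamma> t'"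
      have "real i + s * (real j - real i) \<in> {real i..<real j}" if "s \<in> {0..<1}" for s
      proof -
        have "s * (real j - real i) < 1 * (real j - real i)" using that i by (intro mult_strict_right_mono) auto
        from add_strict_left_mono[OF this, of "real i"] that i show ?thesis by simp
      qed
      from Pinj[OF this[OF t(1)] this[OF t(2)]] t(3) i show "t = t'" by (simp add: \<gamma>_def)
    qed
  qed
  moreover have "\<gamma> ` {0..1} \<subseteq> points G"
    using cont\<gamma> unfolding continuous_map_def topspace_graph_topology[OF G] by auto
  moreover have "e \<in> F" if "Inner e x \<in> \<gamma> ` {0..1}" for e x
    using that PF unfolding \<gamma>_def by (metis imageE)
  ultimately show ?thesis by blast
qed

section \<open>Cycles contain leafless edge sets\<close>

definition along :: "('v, 'e) mgraph \<Rightarrow> 'e \<times> real \<times> bool \<Rightarrow> real \<Rightarrow> ('v, 'e) gpoint" where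
  "along G d r = (case d of (e, x, b) \<Rightarrow> edge_pt G e (x + sg b * r))"

text \<open>The length of the edge ahead.\<close>

definition room :: "('v, 'e) mgraph \<Rightarrow> 'e \<times> real \<times> bool \<Rightarrow> real" where
  "room G d = (case d of (e, x, b) \<Rightarrow> if b then len G e - x else x)"

lemma along_Inner:
  assumes "(e, x, b) \<in> dirs G p" "0 < r" "r < room G (e, x, b)"
  shows "along G (e, x, b) r = Inner e (x + sg b * r)" "0 < x + sg b * r" "x + sg b * r < len G e"
  using assms by (auto simp: along_def edge_pt_def dirs_def room_def sg_def split: if_splits)

text \<open>A continuous function on the graph with support in the edge \<open>e\<close> around the coordinate \<open>z\<close>. It serves
as a coordinate on half of its support.\<close>

definition tent :: "'e \<Rightarrow> real \<Rightarrow> real \<Rightarrow> ('v, 'e) gpoint \<Rightarrow> real" where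
  "tent e z \<delta> q = (case q of Vertex _ \<Rightarrow> 0 | Inner e' y \<Rightarrow> if e' = e then max 0 (\<delta> - \<bar>y - z\<bar>) else 0)"

lemma continuous_tent:
  assumes G: "compact_metric_graph G" and z: "\<delta> \<le> z" "z + \<delta> \<le> len G e"
  shows "continuous_map (graph_topology G) euclideanreal (tent e z \<delta>)"
proof (rule continuous_on_graph[OF G])
  fix e' assume e': "e' \<in> edges G"
  show "continuous_on {0..len G e'} (\<lambda>x. tent e z \<delta> (edge_pt G e' x))"
  proof (cases "e' = e")
    case True
    have "continuous_on {0..len G e'} (\<lambda>x. max 0 (\<delta> - \<bar>x - z\<bar>))"
      by (intro continuous_intros)
    then show ?thesis
      by (rule continuous_on_eq) (use z True in \<open>auto simp: tent_def edge_pt_def max_def\<close>)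
  next
    case False
    have "tent e z \<delta> (edge_pt G e' x) = 0" for x using False by (simp add: tent_def edge_pt_def)
    then show ?thesis by simp
  qed
qed

text \<open>A continuous function on the graph that has the value \<open>1\<close> only at the vertex \<open>w\<close>. The squares make it
smaller than \<open>1\<close> also inside a loop at \<open>w\<close>, where the linear interpolation would be constant.\<close>

definition hat :: "('v, 'e) mgraph \<Rightarrow> 'v \<Rightarrow> ('v, 'e) gpoint \<Rightarrow> real" where
  "hat G w q = (case q of Vertex w' \<Rightarrow> if w' = w then 1 else 0
     | Inner e y \<Rightarrow> (if src G e = w then (1 - y / len G e)\<^sup>2 else 0) + (if tgt G e = w then (y / len G e)\<^sup>2 else 0))"

lemma hat_edge_pt:
  assumes "0 < len G e"
  shows "hat G w (edge_pt G e x) =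
    (if src G e = w then (1 - x / len G e)\<^sup>2 else 0) + (if tgt G e = w then (x / len G e)\<^sup>2 else 0)"
  using assms by (auto simp: hat_def edge_pt_def)

lemma continuous_hat:
  assumes G: "compact_metric_graph G"
  shows "continuous_map (graph_topology G) euclideanreal (hat G w)"
proof (rule continuous_on_graph[OF G])
  fix e assume e: "e \<in> edges G"
  have l: "0 < len G e" using compact_metric_graphD(3)[OF G e] .
  show "continuous_on {0..len G e} (\<lambda>x. hat G w (edge_pt G e x))"
    unfolding hat_edge_pt[OF l] using l
    by (cases "src G e = w"; cases "tgt G e = w") (auto intro!: continuous_intros)
qed

lemma hat_less_1:
  assumes G: "compact_metric_graph G" and q: "q \<in> points G" "q \<noteq> Vertex w"
  shows "hat G w q < 1"
  using q(1)
proof (cases rule: points_cases)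
  case (Vertex w')
  then show ?thesis using q(2) by (simp add: hat_def)
next
  case (Inner e x)
  define s where "s = x / len G e"
  have s: "0 < s" "s < 1" using Inner by (auto simp: s_def)
  have "(1 - s)\<^sup>2 + s\<^sup>2 = 1 - 2 * (s * (1 - s))" by (simp add: power2_eq_square algebra_simps)
  moreover have "0 < s * (1 - s)" using s by simp
  ultimately have "(1 - s)\<^sup>2 + s\<^sup>2 < 1" by simp
  moreover from this have "(1 - s)\<^sup>2 < 1" "s\<^sup>2 < 1"
    using zero_le_power2[of s] zero_le_power2[of "1 - s"] by linarith+
  moreover have "hat G w q = (if src G e = w then (1 - s)\<^sup>2 else 0) + (if tgt G e = w then s\<^sup>2 else 0)"
    by (simp add: hat_def Inner s_def)
  ultimately show ?thesis by (auto split: if_splits)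
qed

lemma finite_dirs:
  assumes G: "compact_metric_graph G" and p: "p \<in> points G"
  shows "finite (dirs G p)"
  using p
proof (cases rule: points_cases)
  case (Vertex w)
  have "finite (darts G w)"
    by (rule finite_subset[of _ "edges G \<times> UNIV"]) (use compact_metric_graphD[OF G] in \<open>auto simp: darts_def\<close>)
  then show ?thesis unfolding Vertex dirs_Vertex[OF G] by simp
qed (simp add: dirs_Inner)

text \<open>The arcs of length \<open>\<epsilon>\<close> in all directions form a neighbourhood. The factor \<open>4\<close> keeps the tents
with half-width \<open>\<epsilon>\<close> over the first halves of the edges, so that two arcs are never under the same
tent, even if they belong to the two ends of one edge.\<close>

lemma star_neighbourhood:
  assumes G: "compact_metric_graph G" and p: "p \<in> points G"
  shows "\<exists>\<epsilon>>0. (\<forall>d\<in>dirs G p. 4 * \<epsilon> \<le> room G d) \<and>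
    graph_open G ({p} \<union> {along G d r | d r. d \<in> dirs G p \<and> 0 < r \<and> r < \<epsilon>})"
proof -
  define \<epsilon> where "\<epsilon> = Min (insert 1 (room G ` dirs G p)) / 4"
  have fin: "finite (insert 1 (room G ` dirs G p))" using finite_dirs[OF G p] by simp
  have "0 < room G d" if "d \<in> dirs G p" for d
    using that by (auto simp: room_def dirs_def split: if_splits)
  then have "0 < Min (insert 1 (room G ` dirs G p))" using fin by (subst Min_gr_iff) auto
  then have \<epsilon>: "0 < \<epsilon>" by (simp add: \<epsilon>_def)
  have room: "4 * \<epsilon> \<le> room G d" if "d \<in> dirs G p" for d
    using fin that by (simp add: \<epsilon>_def)
  let ?S = "{p} \<union> {along G d r | d r. d \<in> dirs G p \<and> 0 < r \<and> r < \<epsilon>}"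
  have "?S \<subseteq> points G"
  proof
    fix q assume "q \<in> ?S"
    then consider "q = p" | d r where "q = along G d r" "d \<in> dirs G p" "0 < r" "r < \<epsilon>" by blast
    then show "q \<in> points G"
    proof cases
      case (2 d r)
      obtain e x b where d: "d = (e, x, b)" by (cases d)
      have "r < room G (e, x, b)" using room[OF 2(2)] 2(4) \<epsilon> d by simp
      from along_Inner[OF 2(2)[unfolded d] 2(3) this] 2 d show ?thesis
        by (auto simp: points_def dirs_def)
    qed (use p in simp)
  qed
  moreover have "openin (top_of_set {0..len G e}) {y \<in> {0..len G e}. edge_pt G e y \<in> ?S}"
    if e: "e \<in> edges G" for e
  proof -
    define X where "X = {x \<in> {0..len G e}. edge_pt G e x = p}"
    have "{y \<in> {0..len G e}. edge_pt G e y \<in> ?S} = {0..len G e} \<inter> (\<Union>x\<in>X. ball x \<epsilon>)"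
    proof (intro equalityI subsetI)
      fix y assume "y \<in> {y \<in> {0..len G e}. edge_pt G e y \<in> ?S}"
      then have y: "y \<in> {0..len G e}" and "edge_pt G e y \<in> ?S" by auto
      then consider "edge_pt G e y = p" | d r where "edge_pt G e y = along G d r" "d \<in> dirs G p" "0 < r" "r < \<epsilon>"
        by blast
      then show "y \<in> {0..len G e} \<inter> (\<Union>x\<in>X. ball x \<epsilon>)"
      proof cases
        case 1
        then show ?thesis using y \<epsilon> by (auto simp: X_def)
      next
        case (2 d r)
        obtain e' x b where d: "d = (e', x, b)" by (cases d)
        have "r < room G (e', x, b)" using room[OF 2(2)] 2(4) \<epsilon> d by simp
        from along_Inner(1)[OF 2(2)[unfolded d] 2(3) this] 2(1) d
        have "e = e'" "y = x + sg b * r" by (auto simp: edge_pt_eq_Inner)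
        moreover have "x \<in> X" using 2(2) d \<open>e = e'\<close> by (auto simp: X_def dirs_def)
        moreover have "dist x (x + sg b * r) < \<epsilon>" using 2 by (auto simp: dist_real_def sg_def)
        ultimately show ?thesis using y by auto
      qed
    next
      fix y assume "y \<in> {0..len G e} \<inter> (\<Union>x\<in>X. ball x \<epsilon>)"
      then obtain x where y: "y \<in> {0..len G e}" and x: "x \<in> X" "\<bar>x - y\<bar> < \<epsilon>" by (auto simp: dist_real_def)
      have "edge_pt G e y \<in> ?S"
      proof (cases "y = x")
        case True
        then show ?thesis using x by (simp add: X_def)
      next
        case False
        have "(e, x, x < y) \<in> dirs G p" using x y e False by (auto simp: X_def dirs_def)
        moreover have "edge_pt G e y = along G (e, x, x < y) \<bar>x - y\<bar>"
          using False by (auto simp: along_def sg_def)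
        ultimately show ?thesis using x False by auto
      qed
      with y show "y \<in> {y \<in> {0..len G e}. edge_pt G e y \<in> ?S}" by blast
    qed
    moreover have "openin (top_of_set {0..len G e}) ({0..len G e} \<inter> (\<Union>x\<in>X. ball x \<epsilon>))"
      by (intro openin_open_Int open_UN ballI open_ball)
    ultimately show ?thesis by simp
  qed
  ultimately have "graph_open G ?S" unfolding graph_open_def by blast
  with \<epsilon> room show ?thesis by blast
qed

text \<open>Within distance \<open>\<epsilon>\<close> of \<open>p\<close>, the tent in one direction measures the distance to \<open>p\<close> in that
direction and vanishes in all others.\<close>

lemma tent_along:
  assumes d: "(e, x, b) \<in> dirs G p" "4 * \<epsilon> \<le> room G (e, x, b)" and d': "d' \<in> dirs G p" "4 * \<epsilon> \<le> room G d'"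
    and r: "0 < r" "r < \<epsilon>"
  shows "tent e (x + sg b * \<epsilon>) \<epsilon> (along G d' r) = (if d' = (e, x, b) then r else 0)"
proof -
  obtain e' x' b' where d'_eq: "d' = (e', x', b')" by (cases d')
  have "r < room G (e', x', b')" using d' r d'_eq by simp
  note arc = along_Inner[OF d'(1)[unfolded d'_eq] r(1) this]
  show ?thesis
  proof (cases "e' = e")
    case False
    then show ?thesis unfolding d'_eq arc(1) by (simp add: tent_def)
  next
    case e: True
    show ?thesis
    proof (cases "x' = x")
      case True
      then show ?thesis using r unfolding d'_eq arc(1) by (auto simp: tent_def e sg_def)
    next
      case False
      have "x = 0 \<and> x' = len G e \<or> x = len G e \<and> x' = 0"
        using d(1) d'(1) False unfolding d'_eq e by (auto simp: dirs_def edge_pt_def split: if_splits)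
      moreover have "if b then x < len G e else 0 < x" "if b' then x' < len G e else 0 < x'"
        using d(1) d'(1) unfolding d'_eq e by (auto simp: dirs_def)
      ultimately have "x = 0 \<and> b \<and> x' = len G e \<and> \<not> b' \<or> x = len G e \<and> \<not> b \<and> x' = 0 \<and> b'"
        by (auto split: if_splits)
      then show ?thesis using r d(2) unfolding d'_eq arc(1) by (auto simp: tent_def e sg_def room_def)
    qed
  qed
qed

text \<open>A path that leaves \<open>g 0\<close> for good soon lies in the star. If it is then in the direction \<open>d\<close>, the tent
in this direction grows from \<open>0\<close> along the path, and by the intermediate value theorem the path
passes through all nearby points in that direction.\<close>

lemma leaving_branch:
  fixes g :: "real \<Rightarrow> ('v, 'e) gpoint"
  assumes G: "compact_metric_graph G" and g: "continuous_map (top_of_set {0..1}) (graph_topology G) g"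
    and ne: "\<And>t. 0 < t \<Longrightarrow> t \<le> 1 \<Longrightarrow> g t \<noteq> g 0"
  shows "\<exists>d\<in>dirs G (g 0). \<exists>r1>0. \<forall>r. 0 < r \<and> r < r1 \<longrightarrow> (\<exists>t\<in>{0<..1}. g t = along G d r)"
proof -
  have mem: "g t \<in> points G" if "t \<in> {0..1}" for t
    using g that unfolding continuous_map_def topspace_graph_topology[OF G] by auto
  have p: "g 0 \<in> points G" by (rule mem) simp
  obtain \<epsilon> where \<epsilon>: "0 < \<epsilon>" and room: "\<And>d. d \<in> dirs G (g 0) \<Longrightarrow> 4 * \<epsilon> \<le> room G d"
    and op: "graph_open G ({g 0} \<union> {along G d r | d r. d \<in> dirs G (g 0) \<and> 0 < r \<and> r < \<epsilon>})" (is "graph_open G ?S")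
    using star_neighbourhood[OF G p] by blast
  have "openin (top_of_set {0..1}) {t \<in> topspace (top_of_set {0..1}). g t \<in> ?S}"
    using g op unfolding continuous_map_def openin_graph_topology by blast
  then obtain U where U: "open U" "{t \<in> {0..1}. g t \<in> ?S} = {0..1} \<inter> U"
    unfolding openin_open by auto
  have "(0::real) \<in> {t \<in> {0..1}. g t \<in> ?S}" by simp
  then have "0 \<in> U" unfolding U(2) by blast
  then obtain \<delta> where \<delta>: "0 < \<delta>" "ball 0 \<delta> \<subseteq> U" using U(1) openE by blast
  define \<tau> where "\<tau> = min 1 (\<delta> / 2)"
  have \<tau>: "0 < \<tau>" "\<tau> \<le> 1" "\<tau> < \<delta>" using \<delta> by (auto simp: \<tau>_def min_def)
  have near: "\<exists>d r. g t = along G d r \<and> d \<in> dirs G (g 0) \<and> 0 < r \<and> r < \<epsilon>" if t: "0 < t" "t \<le> \<tau>" for t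
  proof -
    have "t \<in> {0..1} \<inter> U" using t \<tau> \<delta>(2) by (auto simp: subset_iff)
    then have "g t \<in> ?S" using U(2) by blast
    with ne[of t] t \<tau> show ?thesis by auto
  qed
  obtain d r1 where d: "g \<tau> = along G d r1" "d \<in> dirs G (g 0)" "0 < r1" "r1 < \<epsilon>" using near[of \<tau>] \<tau> by blast
  obtain e x b where d_eq: "d = (e, x, b)" by (cases d)
  have dirs: "(e, x, b) \<in> dirs G (g 0)" "4 * \<epsilon> \<le> room G (e, x, b)" using d(2) room d_eq by auto
  define h where "h = (\<lambda>t. tent e (x + sg b * \<epsilon>) \<epsilon> (g t))"
  have "continuous_map (top_of_set {0..1}) euclideanreal (tent e (x + sg b * \<epsilon>) \<epsilon> \<circ> g)"
  proof (rule continuous_map_compose[OF g continuous_tent[OF G]])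
    show "\<epsilon> \<le> x + sg b * \<epsilon>" "x + sg b * \<epsilon> + \<epsilon> \<le> len G e"
      using dirs \<epsilon> by (auto simp: room_def dirs_def sg_def split: if_splits)
  qed
  then have "continuous_on {0..1} h" by (simp add: h_def o_def)
  then have cont: "continuous_on {0..\<tau>} h" by (rule continuous_on_subset) (use \<tau> in auto)
  have g0: "g 0 = edge_pt G e x" using dirs(1) by (simp add: dirs_def)
  have h0: "h 0 = 0"
    unfolding h_def g0 using \<epsilon> by (auto simp: tent_def edge_pt_def sg_def)
  have h\<tau>: "h \<tau> = r1"
    unfolding h_def d(1) using tent_along[OF dirs d(2) room[OF d(2)] d(3,4)] d_eq by simp
  have "\<exists>t\<in>{0<..1}. g t = along G d r" if r: "0 < r" "r < r1" for r
  proof -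
    obtain t where t: "0 \<le> t" "t \<le> \<tau>" "h t = r"
      using IVT'[of h 0 r \<tau>] h0 h\<tau> r \<tau> cont by auto
    then have "0 < t" using h0 r by (cases "t = 0") auto
    then obtain d' r' where d': "g t = along G d' r'" "d' \<in> dirs G (g 0)" "0 < r'" "r' < \<epsilon>" using near[of t] t by blast
    have "h t = (if d' = (e, x, b) then r' else 0)"
      unfolding h_def d'(1) by (rule tent_along[OF dirs d'(2) room[OF d'(2)] d'(3,4)])
    then have "d' = d" "r' = r" using t(3) r d_eq by (auto split: if_splits)
    with d'(1) \<open>0 < t\<close> t \<tau> show ?thesis by (intro bexI[of _ t]) auto
  qed
  with d(2,3) show ?thesis by blast
qed

text \<open>The overlap allows each point of the loop, including its base point, to be passed in both
directions.\<close>

lemma periodic_extension: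
  assumes G: "compact_metric_graph G" and C: "is_cycle G C"
  shows "\<exists>g. continuous_map (top_of_set {-1..2::real}) (graph_topology G) g \<and>
    (\<forall>t\<in>{-1..2}. \<forall>s\<in>{-1..2}. g t = g s \<longrightarrow> \<bar>t - s\<bar> < 1 \<longrightarrow> t = s) \<and> C = g ` {0..1} \<and> g ` {-1..2} \<subseteq> C"
proof -
  obtain \<gamma> where \<gamma>: "continuous_map (top_of_set {0..1::real}) (graph_topology G) \<gamma>" "\<gamma> 0 = \<gamma> 1"
    "inj_on \<gamma> {0..<1}" "C = \<gamma> ` {0..1}" using C by (auto simp: is_cycle_def)
  define g where "g = (\<lambda>t. \<gamma> (frac t))"
  have piece: "g t = \<gamma> (t - real_of_int m)" if "real_of_int m \<le> t" "t \<le> real_of_int m + 1" for t m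
  proof (cases "t = real_of_int m + 1")
    case True
    then have t: "t - real_of_int m = 1" "frac t = 0" by (simp_all add: frac_def)
    show ?thesis unfolding g_def t by (rule \<gamma>(2))
  next
    case False
    then have "\<lfloor>t\<rfloor> = m" using that by linarith
    then show ?thesis by (simp add: g_def frac_def)
  qed
  have "continuous_map (top_of_set {-1..2::real}) (graph_topology G) g"
  proof (rule continuous_map_pieces)
    fix m :: int
    let ?S = "{real_of_int m..real_of_int m + 1} \<inter> {- 1..2}"
    have "continuous_map (top_of_set ?S) (top_of_set {0..1}) (\<lambda>t. t - real_of_int m)"
      by (auto simp: continuous_map_in_subtopology intro!: continuous_intros)
    from continuous_map_compose[OF this \<gamma>(1)]
    show "continuous_map (top_of_set ?S) (graph_topology G) g"
      by (rule continuous_map_eq) (use piece[of m] in auto)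
  qed simp
  moreover have "t = s" if "g t = g s" "\<bar>t - s\<bar> < 1" for t s
  proof -
    have "frac t = frac s"
      using inj_onD[OF \<gamma>(3), of "frac t" "frac s"] that(1) by (simp add: g_def frac_lt_1)
    then have "t - s = real_of_int (\<lfloor>t\<rfloor> - \<lfloor>s\<rfloor>)" by (simp add: frac_def)
    with that(2) have "\<lfloor>t\<rfloor> - \<lfloor>s\<rfloor> = 0" by linarith
    with \<open>t - s = real_of_int (\<lfloor>t\<rfloor> - \<lfloor>s\<rfloor>)\<close> show ?thesis by simp
  qed
  moreover have "C = g ` {0..1}" unfolding \<gamma>(4) by (rule image_cong) (use piece[of 0] in auto)
  moreover have "g ` {-1..2} \<subseteq> C" unfolding \<gamma>(4) g_def
    using frac_ge_0 frac_lt_1 by (fastforce intro: less_imp_le)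
  ultimately show ?thesis by blast
qed

text \<open>Forward and backward in time the loop leaves \<open>p\<close> in different directions: in a common direction
both parts would pass through the same points, against injectivity.\<close>

lemma two_branches:
  assumes G: "compact_metric_graph G" and C: "is_cycle G C" and p: "p \<in> C"
  shows "\<exists>d1\<in>dirs G p. \<exists>d2\<in>dirs G p. \<exists>r1>0. d1 \<noteq> d2 \<and>
    (\<forall>r. 0 < r \<and> r < r1 \<longrightarrow> along G d1 r \<in> C \<and> along G d2 r \<in> C)"
proof -
  obtain g where cont: "continuous_map (top_of_set {-1..2::real}) (graph_topology G) g"
    and inj: "\<And>t s. t \<in> {-1..2} \<Longrightarrow> s \<in> {-1..2} \<Longrightarrow> g t = g s \<Longrightarrow> \<bar>t - s\<bar> < 1 \<Longrightarrow> t = s"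
    and gC: "C = g ` {0..1}" "g ` {-1..2} \<subseteq> C"
    using periodic_extension[OF G C] by blast
  obtain t0 where t0: "t0 \<in> {0..1}" "p = g t0" using p gC by blast
  \<comment> \<open>With the factor \<open>1 / 3\<close> forward and backward times differ by less than the period.\<close>
  define f where "f = (\<lambda>c t. g (t0 + sg c * (t / 3)))"
  have dom: "t0 + sg c * (t / 3) \<in> {-1..2}" if "t \<in> {0..1}" for c t
    using that t0 by (auto simp: sg_def)
  have "\<exists>d\<in>dirs G (f c 0). \<exists>r1>0. \<forall>r. 0 < r \<and> r < r1 \<longrightarrow> (\<exists>t\<in>{0<..1}. f c t = along G d r)" for c
  proof (rule leaving_branch[OF G])
    have "continuous_map (top_of_set {0..1}) (top_of_set {-1..2}) (\<lambda>t. t0 + sg c * (t / 3))"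
      using dom by (auto simp: continuous_map_in_subtopology intro!: continuous_intros)
    from continuous_map_compose[OF this cont]
    show "continuous_map (top_of_set {0..1}) (graph_topology G) (f c)" by (simp add: f_def o_def)
    show "f c t \<noteq> f c 0" if t: "0 < t" "t \<le> 1" for t
    proof
      assume "f c t = f c 0"
      then have "t0 + sg c * (t / 3) = t0 + sg c * (0 / 3)"
        unfolding f_def using t by (intro inj dom) (auto simp: sg_def)
      with t show False by (simp add: sg_def split: if_splits)
    qed
  qed
  moreover have f0: "f c 0 = p" for c by (simp add: f_def t0)
  ultimately have br: "\<exists>d\<in>dirs G p. \<exists>r1>0. \<forall>r. 0 < r \<and> r < r1 \<longrightarrow> (\<exists>t\<in>{0<..1}. f c t = along G d r)" for c
    by simp
  obtain d1 r1 where 1: "d1 \<in> dirs G p" "0 < r1" "\<And>r. 0 < r \<Longrightarrow> r < r1 \<Longrightarrow> \<exists>t\<in>{0<..1}. f True t = along G d1 r"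
    using br[of True] by blast
  obtain d2 r2 where 2: "d2 \<in> dirs G p" "0 < r2" "\<And>r. 0 < r \<Longrightarrow> r < r2 \<Longrightarrow> \<exists>t\<in>{0<..1}. f False t = along G d2 r"
    using br[of False] by blast
  define r0 where "r0 = min r1 r2"
  have r0: "0 < r0" "r0 \<le> r1" "r0 \<le> r2" using 1(2) 2(2) by (auto simp: r0_def)
  have "d1 \<noteq> d2"
  proof
    assume eq: "d1 = d2"
    obtain t where t: "t \<in> {0<..1}" "f True t = along G d1 (r0 / 2)" using 1(3)[of "r0 / 2"] r0 by auto
    obtain s where s: "s \<in> {0<..1}" "f False s = along G d1 (r0 / 2)" using 2(3)[of "r0 / 2"] r0 eq by auto
    have "t0 + sg True * (t / 3) = t0 + sg False * (s / 3)"
      using t s unfolding f_def by (intro inj dom) (auto simp: sg_def)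
    with t(1) s(1) show False by (simp add: sg_def)
  qed
  moreover have "along G d1 r \<in> C \<and> along G d2 r \<in> C" if r: "0 < r" "r < r0" for r
  proof -
    have fC: "f c t \<in> C" if "t \<in> {0<..1}" for c t
    proof -
      have "t0 + sg c * (t / 3) \<in> {-1..2}" using that by (intro dom) auto
      then show ?thesis using gC(2) unfolding f_def by blast
    qed
    obtain t s where "t \<in> {0<..1}" "f True t = along G d1 r" "s \<in> {0<..1}" "f False s = along G d2 r"
      using 1(3)[of r] 2(3)[of r] r r0 by (metis order_less_le_trans)
    then show ?thesis using fC by metis
  qed
  ultimately show ?thesis using 1(1) 2(1) r0(1) by blast
qed

lemma cycle_attains_max:
  assumes "is_cycle G C" and h: "continuous_map (graph_topology G) euclideanreal h"
  shows "\<exists>q\<in>C. \<forall>q'\<in>C. h q' \<le> h q"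
proof -
  obtain \<gamma> where \<gamma>: "continuous_map (top_of_set {0..1::real}) (graph_topology G) \<gamma>" "C = \<gamma> ` {0..1}"
    using assms(1) by (auto simp: is_cycle_def)
  have "continuous_on {0..1} (\<lambda>t. h (\<gamma> t))"
    using continuous_map_compose[OF \<gamma>(1) h] by (simp add: o_def)
  from continuous_attains_sup[OF _ _ this] show ?thesis unfolding \<gamma>(2) by auto
qed

lemma cycle_subset_points:
  assumes G: "compact_metric_graph G" and "is_cycle G C"
  shows "C \<subseteq> points G"
  using assms(2) unfolding is_cycle_def continuous_map_def topspace_graph_topology[OF G] by auto

text \<open>The coordinates of the points of \<open>e\<close> in the cycle form an open set, because both directions at such a
point are occupied, and a relatively closed one: around a point off the cycle a tent attains its
maximum over the cycle below its peak.\<close>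

lemma cycle_contains_edge:
  assumes G: "compact_metric_graph G" and C: "is_cycle G C"
    and e: "Inner e x0 \<in> C" and x: "0 < x" "x < len G e"
  shows "Inner e x \<in> C"
proof -
  have "Inner e x0 \<in> points G" using cycle_subset_points[OF G C] e by blast
  then have eG: "e \<in> edges G" and x0: "0 < x0" "x0 < len G e" by (auto simp: points_def)
  define A where "A = {x \<in> {0<..<len G e}. Inner e x \<in> C}"
  define B where "B = {x \<in> {0<..<len G e}. Inner e x \<notin> C}"
  have "open A"
  proof (rule openI)
    fix z assume z: "z \<in> A"
    then have z': "0 < z" "z < len G e" "Inner e z \<in> C" by (auto simp: A_def)
    obtain d1 d2 r1 where d: "d1 \<in> dirs G (Inner e z)" "d2 \<in> dirs G (Inner e z)" "0 < r1" "d1 \<noteq> d2"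
      and r1: "\<And>r. 0 < r \<Longrightarrow> r < r1 \<Longrightarrow> along G d1 r \<in> C \<and> along G d2 r \<in> C"
      using two_branches[OF G C z'(3)] by blast
    have both: "along G (e, z, c) r \<in> C" if "0 < r" "r < r1" for r c
      using d(1,2,4) r1[OF that] unfolding dirs_Inner[OF eG z'(1,2)] by (cases c) auto
    define m where "m = min r1 (min z (len G e - z))"
    have "y \<in> A" if y: "y \<in> ball z m" for y
    proof (cases "y = z")
      case False
      have m: "\<bar>z - y\<bar> < m" using y by (simp add: dist_real_def)
      then have "along G (e, z, z < y) \<bar>z - y\<bar> \<in> C" using False by (intro both) (auto simp: m_def)
      moreover have "along G (e, z, z < y) \<bar>z - y\<bar> = edge_pt G e y" using False by (auto simp: along_def sg_def)
      moreover have yy: "0 < y" "y < len G e" using m by (auto simp: m_def)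
      ultimately show ?thesis by (simp add: A_def edge_pt_def)
    qed (use z in simp)
    moreover have "0 < m" using d(3) z' by (simp add: m_def)
    ultimately show "\<exists>e>0. ball z e \<subseteq> A" by blast
  qed
  moreover have "open B"
  proof (rule openI)
    fix z assume "z \<in> B"
    then have z: "0 < z" "z < len G e" "Inner e z \<notin> C" by (auto simp: B_def)
    define \<delta> where "\<delta> = min z (len G e - z)"
    have \<delta>: "0 < \<delta>" "\<delta> \<le> z" "z + \<delta> \<le> len G e" using z by (auto simp: \<delta>_def)
    obtain q where q: "q \<in> C" "\<And>q'. q' \<in> C \<Longrightarrow> tent e z \<delta> q' \<le> tent e z \<delta> q"
      using cycle_attains_max[OF C continuous_tent[OF G \<delta>(2,3)]] by blast
    have lt: "tent e z \<delta> q < \<delta>"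
    proof (cases q)
      case (Inner e' y)
      show ?thesis
      proof (cases "e' = e")
        case True
        then have "y \<noteq> z" using q(1) z(3) Inner by auto
        then show ?thesis using Inner \<delta> by (simp add: tent_def)
      qed (use Inner \<delta> in \<open>simp add: tent_def\<close>)
    qed (use \<delta> in \<open>simp add: tent_def\<close>)
    define m where "m = min (\<delta> - tent e z \<delta> q) \<delta>"
    have "y \<in> B" if y: "y \<in> ball z m" for y
    proof -
      have "\<bar>z - y\<bar> < m" using y by (simp add: dist_real_def)
      then have yy: "0 < y" "y < len G e" and "\<bar>y - z\<bar> < \<delta> - tent e z \<delta> q" using \<delta> by (auto simp: m_def)
      then have "tent e z \<delta> q < tent e z \<delta> (Inner e y)" by (simp add: tent_def)
      then have "Inner e y \<notin> C" using q(2) by (meson not_less)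
      with yy show ?thesis by (simp add: B_def)
    qed
    moreover have "0 < m" using lt \<delta> by (simp add: m_def)
    ultimately show "\<exists>e>0. ball z e \<subseteq> B" by blast
  qed
  moreover have "{0<..<len G e} \<subseteq> A \<union> B" "A \<inter> B \<inter> {0<..<len G e} = {}" by (auto simp: A_def B_def)
  moreover have "connected {0<..<len G e}" by simp
  ultimately have "A \<inter> {0<..<len G e} = {} \<or> B \<inter> {0<..<len G e} = {}" using connectedD by blast
  moreover have "x0 \<in> A" using x0 e by (simp add: A_def)
  ultimately have "x \<notin> B" using x x0 by auto
  with x show ?thesis by (simp add: B_def)
qed

text \<open>Take the edges that lie entirely in the cycle. The vertex at the end of such an edge is in the cycle
too, as otherwise its hat function would stay away from \<open>1\<close> on the cycle. There the cycle has two
directions, and one of them is not the given end.\<close>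

theorem leafless_in_cycle:
  assumes G: "compact_metric_graph G" and C: "is_cycle G C"
  shows "\<exists>F\<subseteq>edges G. leafless (endpt G) {} F \<and> sum (len G) F \<le> total_length G C"
proof -
  define F where "F = {e \<in> edges G. \<forall>x. 0 < x \<and> x < len G e \<longrightarrow> Inner e x \<in> C}"
  have branch: "fst d1 \<in> F" if d: "d1 \<in> dirs G p" and r: "0 < r1" "\<And>r. 0 < r \<Longrightarrow> r < r1 \<Longrightarrow> along G d1 r \<in> C" for d1 p r1
  proof -
    obtain e x b where d_eq: "d1 = (e, x, b)" by (cases d1)
    have rm: "0 < room G (e, x, b)" using d d_eq by (auto simp: dirs_def room_def split: if_splits)
    define r where "r = min r1 (room G (e, x, b)) / 2"
    have rr: "0 < r" "r < r1" "r < room G (e, x, b)" using r(1) rm by (auto simp: r_def min_def)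
    have "Inner e (x + sg b * r) \<in> C"
      using r(2)[OF rr(1,2)] along_Inner(1)[OF d[unfolded d_eq] rr(1,3)] d_eq by simp
    from cycle_contains_edge[OF G C this] show ?thesis using d d_eq by (auto simp: F_def dirs_def)
  qed
  have two: "\<exists>d1\<in>dirs G p. \<exists>d2\<in>dirs G p. d1 \<noteq> d2 \<and> fst d1 \<in> F \<and> fst d2 \<in> F" if p: "p \<in> C" for p
  proof -
    obtain d1 d2 r1 where d: "d1 \<in> dirs G p" "d2 \<in> dirs G p" "0 < r1" "d1 \<noteq> d2"
      and r1: "\<And>r. 0 < r \<Longrightarrow> r < r1 \<Longrightarrow> along G d1 r \<in> C \<and> along G d2 r \<in> C"
      using two_branches[OF G C p] by blast
    then have "fst d1 \<in> F" "fst d2 \<in> F" using branch[of d1 p r1] branch[of d2 p r1] by blast+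
    with d show ?thesis by blast
  qed
  have "leafless (endpt G) {} F"
    unfolding leafless_def
  proof (intro conjI ballI allI impI)
    obtain p where "p \<in> C" using C unfolding is_cycle_def by fastforce
    from two[OF this] show "F \<noteq> {}" by blast
  next
    fix e b assume e: "e \<in> F"
    define w where "w = endpt G e b"
    have eG: "e \<in> edges G" and l: "0 < len G e"
      using e compact_metric_graphD(3)[OF G] by (auto simp: F_def)
    have "Vertex w \<in> C"
    proof (rule ccontr)
      assume w: "Vertex w \<notin> C"
      obtain q where q: "q \<in> C" "\<And>q'. q' \<in> C \<Longrightarrow> hat G w q' \<le> hat G w q"
        using cycle_attains_max[OF C continuous_hat[OF G]] by blast
      have q1: "hat G w q < 1"
        using hat_less_1[OF G, of q w] q(1) w cycle_subset_points[OF G C] by blast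
      have le: "(1 - s)\<^sup>2 \<le> hat G w q" if s: "0 < s" "s < 1" for s
      proof -
        define x where "x = (if b then s else 1 - s) * len G e"
        have x: "0 < x" "x < len G e" "x / len G e = (if b then s else 1 - s)"
          using s l by (auto simp: x_def)
        have "Inner e x \<in> C" using e x by (simp add: F_def)
        moreover have "(1 - s)\<^sup>2 \<le> hat G w (Inner e x)"
          using x(3) by (auto simp: hat_def w_def endpt_def)
        ultimately show ?thesis using q(2) by (meson order_trans)
      qed
      have "((\<lambda>s. (1 - s)\<^sup>2) \<longlongrightarrow> (1 - 0)\<^sup>2) (at_right (0::real))"
        by (intro tendsto_intros)
      moreover have "\<forall>\<^sub>F s in at_right (0::real). (1 - s)\<^sup>2 \<le> hat G w q"
        using eventually_at_right_real[OF zero_less_one] by eventually_elim (use le in auto)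
      ultimately have "(1 - 0)\<^sup>2 \<le> hat G w q" by (rule tendsto_upperbound) simp
      with q1 show False by simp
    qed
    from two[OF this] obtain d1 d2 where d: "d1 \<in> dirs G (Vertex w)" "d2 \<in> dirs G (Vertex w)" "d1 \<noteq> d2"
      "fst d1 \<in> F" "fst d2 \<in> F" by blast
    obtain d' where d': "d' \<in> dirs G (Vertex w)" "fst d' \<in> F" "d' \<noteq> (e, end_pos G e b, b)" using d by metis
    then obtain e' b' where e': "d' = (e', end_pos G e' b', b')" "(e', b') \<in> darts G w"
      unfolding dirs_Vertex[OF G] by auto
    have "(e', b') \<noteq> (e, b)"
    proof
      assume "(e', b') = (e, b)"
      then have "d' = (e, end_pos G e b, b)" using e'(1) by simp
      with d'(3) show False ..
    qed
    moreover have "e' \<in> F" using d'(2) e'(1) by simp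
    moreover have "endpt G e' b' = endpt G e b" using e'(2) by (simp add: darts_def w_def)
    ultimately show "\<exists>e'\<in>F. \<exists>b'. (e', b') \<noteq> (e, b) \<and> endpt G e' b' = endpt G e b" by blast
  qed
  moreover have "F \<subseteq> edges G" by (auto simp: F_def)
  moreover have "sum (len G) F \<le> total_length G C"
  proof -
    have "sum (len G) F = (\<Sum>e\<in>F. measure lebesgue {x. 0 < x \<and> x < len G e \<and> Inner e x \<in> C})"
    proof (intro sum.cong refl)
      fix e assume e: "e \<in> F"
      then have "{x. 0 < x \<and> x < len G e \<and> Inner e x \<in> C} = {0<..<len G e}" by (auto simp: F_def)
      moreover have "0 < len G e" using e compact_metric_graphD(3)[OF G] by (auto simp: F_def)
      ultimately show "len G e = measure lebesgue {x. 0 < x \<and> x < len G e \<and> Inner e x \<in> C}" by simp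
    qed
    also have "\<dots> \<le> total_length G C"
      unfolding total_length_def
      by (rule sum_mono2) (use compact_metric_graphD(1)[OF G] in \<open>auto simp: F_def\<close>)
    finally show ?thesis .
  qed
  ultimately show ?thesis by blast
qed

section \<open>The spectral gap and the girth\<close>

text \<open>A leafless set is pulled back to the common refinement, contains a cycle there, and this cycle is
mapped forward. Neither step increases the length.\<close>

lemma leafless_to_cycle:
  assumes G: "compact_metric_graph G" "dummy_refinement G K" and H: "compact_metric_graph H" "dummy_refinement H K"
    and F: "F \<subseteq> edges H" "leafless (endpt H) {} F"
  shows "\<exists>C. is_cycle G C \<and> total_length G C \<le> sum (len H) F"
proof -
  obtain \<phi>\<^sub>G E\<^sub>G a\<^sub>G \<sigma>\<^sub>G where "refinement G K \<phi>\<^sub>G E\<^sub>G a\<^sub>G \<sigma>\<^sub>G" using dummy_refinementE[OF G(2,1)] .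
  then interpret g: refinement G K \<phi>\<^sub>G E\<^sub>G a\<^sub>G \<sigma>\<^sub>G .
  obtain \<phi>\<^sub>H E\<^sub>H a\<^sub>H \<sigma>\<^sub>H where "refinement H K \<phi>\<^sub>H E\<^sub>H a\<^sub>H \<sigma>\<^sub>H" using dummy_refinementE[OF H(2,1)] .
  then interpret h: refinement H K \<phi>\<^sub>H E\<^sub>H a\<^sub>H \<sigma>\<^sub>H .
  have pull: "h.pull F \<subseteq> edges K" by (auto simp: h.pull_def)
  obtain C where C: "is_cycle K C" "C \<subseteq> points K" "\<And>e x. Inner e x \<in> C \<Longrightarrow> e \<in> h.pull F"
    using cycle_in_leafless[OF g.K h.leafless_pull[OF F(2,1)] pull] by blast
  have "total_length G (\<phi>\<^sub>G ` C) \<le> sum (len K) (h.pull F)" by (rule g.length_push[OF C(2) pull C(3)])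
  also have "\<dots> \<le> sum (len H) F" by (rule h.length_pull[OF F(1)])
  finally show ?thesis using g.cycle_push[OF C(1)] by blast
qed

lemma eigenvalue_same_metric_graph:
  assumes "compact_metric_graph G" "dummy_refinement G K" "compact_metric_graph H" "dummy_refinement H K"
  shows "eigenvalue G k = eigenvalue H k"
proof -
  obtain \<phi>\<^sub>G E\<^sub>G a\<^sub>G \<sigma>\<^sub>G where "refinement G K \<phi>\<^sub>G E\<^sub>G a\<^sub>G \<sigma>\<^sub>G" using dummy_refinementE[OF assms(2,1)] .
  then have "eigenvalue K k = eigenvalue G k" by (rule refinement.eigenvalue_eq)
  moreover obtain \<phi>\<^sub>H E\<^sub>H a\<^sub>H \<sigma>\<^sub>H where "refinement H K \<phi>\<^sub>H E\<^sub>H a\<^sub>H \<sigma>\<^sub>H" using dummy_refinementE[OF assms(4,3)] .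
  then have "eigenvalue K k = eigenvalue H k" by (rule refinement.eigenvalue_eq)
  ultimately show ?thesis by simp
qed

lemma total_length_nonneg: "0 \<le> total_length G C"
  unfolding total_length_def by (intro sum_nonneg) simp

lemma girth_le:
  assumes "is_cycle G C"
  shows "girth G \<le> total_length G C"
proof -
  have "bdd_below (total_length G ` {C. is_cycle G C})"
    by (rule bdd_belowI[of _ 0]) (auto simp: total_length_nonneg)
  then show ?thesis using assms unfolding girth_def by (auto intro: cINF_lower)
qed

lemma le_girth:
  assumes "is_cycle G C0" "\<And>C. is_cycle G C \<Longrightarrow> c \<le> total_length G C"
  shows "c \<le> girth G"
  unfolding girth_def using assms by (auto intro!: cINF_greatest)

lemma girth_nonneg: "0 \<le> girth G"
proof (cases "\<exists>C. is_cycle G C")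
  case True
  then show ?thesis using le_girth total_length_nonneg by blast
qed (simp add: girth_def)

text \<open>A leafless set in \<open>H\<close> relative to \<open>W\<close> doubles to a leafless set of twice the length, which is at
least the girth. Conversely the cycle that exists because the girth is not \<open>0\<close> yields such a set.\<close>

lemma eigenvalue_2_le_girth:
  assumes G: "compact_metric_graph G" and H: "compact_metric_graph H"
    and same: "same_metric_graph G (double_graph H W)" and s: "girth G \<noteq> 0"
  shows "eigenvalue G 2 \<le> 4 * pi\<^sup>2 / (girth G)\<^sup>2"
proof -
  let ?D = "double_graph H W"
  have D: "compact_metric_graph ?D" by (rule compact_double_graph[OF H])
  obtain K :: "(nat, nat) mgraph" where K: "dummy_refinement G K" "dummy_refinement ?D K"
    using same by (auto simp: same_metric_graph_def)
  have s0: "0 < girth G" using s girth_nonneg[of G] by simp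
  obtain C where C: "is_cycle G C" using s by (auto simp: girth_def split: if_splits)
  obtain F1 where "F1 \<subseteq> edges G" "leafless (endpt G) {} F1" using leafless_in_cycle[OF G C] by blast
  then obtain C2 where "is_cycle ?D C2" using leafless_to_cycle[OF D K(2) G K(1)] by blast
  then obtain F2 where F2: "F2 \<subseteq> edges ?D" "leafless (endpt ?D) {} F2" using leafless_in_cycle[OF D] by blast
  have "eigenvalue ?D 2 \<le> 4 * pi\<^sup>2 / (girth G)\<^sup>2"
  proof (rule eigenvalue_double_graph_le[OF H s0])
    show "fst ` F2 \<subseteq> edges H" using F2(1) by auto
    show "leafless (endpt H) W (fst ` F2)" by (rule leafless_fst[OF F2(2)])
    fix F assume F: "F \<subseteq> edges H" "leafless (endpt H) W F"
    have "F \<times> UNIV \<subseteq> edges ?D" using F(1) by auto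
    from leafless_to_cycle[OF G K(1) D K(2) this leafless_times_UNIV[OF F(2)]]
    obtain C' where C': "is_cycle G C'" "total_length G C' \<le> sum (len ?D) (F \<times> UNIV)" by blast
    have "sum (len ?D) (F \<times> UNIV) = 2 * sum (len H) F"
      by (simp add: sum_darts sum_distrib_left)
    then show "girth G / 2 \<le> sum (len H) F" using girth_le[OF C'(1)] C'(2) by simp
  qed
  then show ?thesis using eigenvalue_same_metric_graph[OF G K(1) D K(2)] by simp
qed

lemma compact_pumpkin: "0 < l \<Longrightarrow> compact_metric_graph (equilateral_pumpkin m l)"
  by (auto simp: compact_metric_graph_def equilateral_pumpkin_def)

lemma pumpkin_simps [simp]:
  "edges (equilateral_pumpkin m l) = {..<m}" "len (equilateral_pumpkin m l) e = l"
  "verts (equilateral_pumpkin m l) = UNIV"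
  "endpt (equilateral_pumpkin m l) e b = (\<not> b)"
  by (auto simp: equilateral_pumpkin_def endpt_def)

lemma darts_pumpkin: "darts (equilateral_pumpkin m l) w = (\<lambda>e. (e, \<not> w)) ` {..<m}"
  by (auto simp: darts_def)

lemma girth_pumpkin:
  assumes G: "compact_metric_graph G" and m: "2 \<le> m" and l: "0 < l"
    and same: "same_metric_graph G (equilateral_pumpkin m l)"
  shows "girth G = 2 * l"
proof (rule antisym)
  let ?P = "equilateral_pumpkin m l"
  have P: "compact_metric_graph ?P" by (rule compact_pumpkin[OF l])
  obtain K :: "(nat, nat) mgraph" where K: "dummy_refinement G K" "dummy_refinement ?P K"
    using same by (auto simp: same_metric_graph_def)
  have "leafless (endpt ?P) {} {0, 1}"
    unfolding leafless_def by (auto intro: exI[of _ True] exI[of _ False])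
  then obtain C where C: "is_cycle G C" "total_length G C \<le> sum (len ?P) {0, 1}"
    using leafless_to_cycle[OF G K(1) P K(2), of "{0, 1}"] m by auto
  then show "girth G \<le> 2 * l" using girth_le[OF C(1)] by simp
  show "2 * l \<le> girth G"
  proof (rule le_girth[OF C(1)])
    fix C assume "is_cycle G C"
    then obtain F where F: "F \<subseteq> edges G" "leafless (endpt G) {} F" "sum (len G) F \<le> total_length G C"
      using leafless_in_cycle[OF G] by blast
    obtain C' where C': "is_cycle ?P C'" "total_length ?P C' \<le> sum (len G) F"
      using leafless_to_cycle[OF P K(2) G K(1) F(1,2)] by blast
    obtain F' where F': "F' \<subseteq> edges ?P" "leafless (endpt ?P) {} F'" "sum (len ?P) F' \<le> total_length ?P C'"
      using leafless_in_cycle[OF P C'(1)] by blast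
    obtain e where e: "e \<in> F'" using F'(2) by (auto simp: leafless_def)
    obtain e' b' where e': "e' \<in> F'" "(e', b') \<noteq> (e, True)" "endpt ?P e' b' = endpt ?P e True"
      by (rule leaflessD[OF F'(2) e, of True]) auto
    then have "e' \<noteq> e" by auto
    have "finite F'" using F'(1) finite_subset by auto
    then have "card {e, e'} \<le> card F'" using e e' by (intro card_mono) auto
    then have "2 \<le> card F'" using \<open>e' \<noteq> e\<close> by simp
    then have "real 2 * l \<le> real (card F') * l" using l by (intro mult_right_mono) auto
    then show "2 * l \<le> total_length G C" using F' C' F(3) by simp
  qed
qed

lemma pumpkin_multiplicity_0:
  assumes m: "2 \<le> m" and l: "0 < l"
  shows "multiplicity_of (equilateral_pumpkin m l) 0 \<le> 1"
proof -
  let ?P = "equilateral_pumpkin m l"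
  have P: "compact_metric_graph ?P" by (rule compact_pumpkin[OF l])
  have "f \<in> gs.span {const_one ?P}" if f: "f \<in> eigenspace ?P 0" for f
  proof -
    obtain v \<phi> where D: "eigen_data ?P 0 f v \<phi>" using f unfolding eigenspace_iff[OF P] by blast
    have "f e x = \<phi> False" if e: "e < m" "x \<in> {0..l}" for e x
    proof -
      have "(f e has_real_derivative 0) (at x within {0..l})" if x: "x \<in> {0..l}" for x
      proof -
        have "v e x = 0" using nonpos_eigen_derivative_zero[OF P D, of e x] e x by simp
        then show ?thesis using eigen_dataD(3)[OF D, of e] e x unfolding helmholtz_def by (metis lessThan_iff pumpkin_simps(1,2))
      qed
      from const_if_derivative_zero[OF this e(2)] have "f e x = f e 0" .
      also have "\<dots> = \<phi> False" using eigen_dataD(4)[OF D, of e True] e by (simp add: end_pos_def)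
      finally show ?thesis .
    qed
    moreover have "f e x = 0" if "\<not> (e < m \<and> x \<in> {0..l})" for e x
      using eigen_dataD(1,2)[OF D, of e x] that by auto
    ultimately have "f = graph_scale (\<phi> False) (const_one ?P)"
      by (auto simp: fun_eq_iff const_one_def)
    then show ?thesis by (simp add: gs.span_base gs.span_scale)
  qed
  then have "gs.dim (eigenspace ?P 0) \<le> card {const_one ?P}" by (intro gs.dim_le_card) auto
  then show ?thesis by (simp add: multiplicity_of_def)
qed

text \<open>Below \<open>\<pi> / l\<close> the end values determine the solution on an edge, so all edges carry the same function,
and the Kirchhoff conditions say that its derivative vanishes at both ends.\<close>

lemma pumpkin_no_eigenvalue:
  assumes m: "2 \<le> m" and l: "0 < l" and \<mu>: "0 < \<mu>" "\<mu> < (pi / l)\<^sup>2"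
  shows "multiplicity_of (equilateral_pumpkin m l) \<mu> = 0"
proof -
  let ?P = "equilateral_pumpkin m l"
  have P: "compact_metric_graph ?P" by (rule compact_pumpkin[OF l])
  define k where "k = sqrt \<mu>"
  have k: "0 < k" "k\<^sup>2 = \<mu>" using \<mu> by (simp_all add: k_def)
  have "k < pi / l" using \<mu> l unfolding k_def by (intro real_less_lsqrt) auto
  then have kl: "k * l < pi" using l by (simp add: pos_less_divide_eq)
  have sn: "0 < sn k l" using k l kl by (intro sn_pos) auto
  have "f = 0" if f: "f \<in> eigenspace ?P \<mu>" for f
  proof -
    obtain v \<phi> where D: "eigen_data ?P \<mu> f v \<phi>" using f unfolding eigenspace_iff[OF P] by blast
    have H: "helmholtz (k\<^sup>2) l (f e) (v e)" if "e < m" for e using eigen_dataD(3)[OF D, of e] that by (simp add: k)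
    have f0: "f e 0 = \<phi> False" and fl: "f e l = \<phi> True" if "e < m" for e
      using eigen_dataD(4)[OF D, of e True] eigen_dataD(4)[OF D, of e False] that by (simp_all add: end_pos_def)
    define c where "c = (\<phi> True - \<phi> False * cos (k * l)) / sn k l"
    have v0: "v e 0 = c" if e: "e < m" for e
    proof -
      have "f e l = f e 0 * cos (k * l) + v e 0 * sn k l"
        by (rule helmholtz_unique(1)[OF H[OF e]]) (use l in simp)
      then show ?thesis using sn unfolding f0[OF e] fl[OF e] c_def by (simp add: field_simps)
    qed
    have vl: "v e l = c * cos (k * l) - \<phi> False * k\<^sup>2 * sn k l" if e: "e < m" for e
      using helmholtz_unique(2)[OF H[OF e], of l] l by (simp only: v0[OF e] f0[OF e]) simp
    have inj: "inj_on (\<lambda>e. (e, b)) {..<m}" for b by (auto simp: inj_on_def)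
    have "(\<Sum>e<m. v e 0) = 0"
      using eigen_dataD(5)[OF D, of False] by (simp add: darts_pumpkin sum.reindex[OF inj] sg_def end_pos_def)
    then have "real m * c = 0" using v0 by simp
    then have c: "c = 0" using m by simp
    have "(\<Sum>e<m. - v e l) = 0"
      using eigen_dataD(5)[OF D, of True] by (simp add: darts_pumpkin sum.reindex[OF inj] sg_def end_pos_def)
    then have "real m * (\<phi> False * k\<^sup>2 * sn k l) = 0" using vl by (simp add: c)
    then have \<phi>: "\<phi> False = 0" using m k sn \<mu>(1) by simp
    show ?thesis
    proof (intro ext)
      fix e x
      show "f e x = 0 e x"
      proof (cases "e < m \<and> x \<in> {0..l}")
        case True
        then show ?thesis using helmholtz_unique(1)[OF H, of e x] v0[of e] f0[of e] c \<phi> by simp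
      next
        case False
        then show ?thesis using eigen_dataD(1,2)[OF D, of e x] by auto
      qed
    qed
  qed
  then have "eigenspace ?P \<mu> = {0}" using zero_in_eigenspace[OF P] by blast
  then show ?thesis unfolding multiplicity_of_def
    using gs.dim_unique[of "{}" "{0}" 0] by (simp add: gs.span_empty gs.independent_empty)
qed

text \<open>Its derivative vanishes at both ends of every edge.\<close>

lemma pumpkin_cosine_eigenfunction:
  assumes l: "0 < l"
  shows "(\<lambda>e x. if e < m \<and> x \<in> {0..l} then cos (pi / l * x) else 0) \<in> eigenspace (equilateral_pumpkin m l) ((pi / l)\<^sup>2)"
    (is "?f \<in> eigenspace ?P _")
proof -
  have P: "compact_metric_graph ?P" by (rule compact_pumpkin[OF l])
  define k where "k = pi / l"
  have kl: "k * l = pi" "k \<noteq> 0" using l by (simp_all add: k_def)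
  have "eigen_data ?P (k\<^sup>2) ?f (\<lambda>_ x. - (k\<^sup>2 * sn k x)) (\<lambda>w. if w then - 1 else 1)"
    unfolding eigen_data_def k_def[symmetric]
  proof (intro conjI ballI allI impI)
    fix e assume e: "e \<in> edges ?P"
    have H: "helmholtz (k\<^sup>2) l (\<lambda>x. cos (k * x)) (\<lambda>x. - (k\<^sup>2 * sn k x))"
      using helmholtz_trig[of k l 1 0] by simp
    show "helmholtz (k\<^sup>2) (len ?P e) (\<lambda>x. if e < m \<and> x \<in> {0..l} then cos (k * x) else 0) (\<lambda>x. - (k\<^sup>2 * sn k x))"
      unfolding helmholtz_def pumpkin_simps
    proof (intro ballI conjI)
      fix x assume x: "x \<in> {0..l}"
      have d: "((\<lambda>x. cos (k * x)) has_real_derivative - (k\<^sup>2 * sn k x)) (at x within {0..l})"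
        "((\<lambda>x. - (k\<^sup>2 * sn k x)) has_real_derivative - k\<^sup>2 * cos (k * x)) (at x within {0..l})"
        using H x by (auto simp: helmholtz_def)
      show "((\<lambda>x. if e < m \<and> x \<in> {0..l} then cos (k * x) else 0) has_real_derivative - (k\<^sup>2 * sn k x)) (at x within {0..l})"
        by (rule has_field_derivative_transform_within[OF d(1) zero_less_one x]) (use e in auto)
      show "((\<lambda>x. - (k\<^sup>2 * sn k x)) has_real_derivative - k\<^sup>2 * (if e < m \<and> x \<in> {0..l} then cos (k * x) else 0)) (at x within {0..l})"
        using d(2) e x by simp
    qed
    show "(if e < m \<and> end_pos ?P e b \<in> {0..l} then cos (k * end_pos ?P e b) else 0) = (if endpt ?P e b then - 1 else 1)" for b
      using e l kl by (simp add: end_pos_def)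
  next
    fix w
    have "sn k l = 0" using kl by (simp add: sn_def)
    then show "(\<Sum>(e, b)\<in>darts ?P w. sg b * - (k\<^sup>2 * sn k (end_pos ?P e b))) = 0"
      by (intro sum.neutral) (auto simp: end_pos_def)
  qed auto
  then show ?thesis unfolding eigenspace_iff[OF P] k_def by blast
qed

text \<open>The cosine is needed to see that the set defining the eigenvalue is nonempty.\<close>

lemma eigenvalue_2_pumpkin_ge:
  assumes m: "2 \<le> m" and l: "0 < l"
  shows "(pi / l)\<^sup>2 \<le> eigenvalue (equilateral_pumpkin m l) 2"
  unfolding eigenvalue_def
proof (rule cInf_greatest)
  let ?P = "equilateral_pumpkin m l"
  let ?f = "\<lambda>e x. if e < m \<and> x \<in> {0..l} then cos (pi / l * x) else 0"
  have P: "compact_metric_graph ?P" by (rule compact_pumpkin[OF l])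
  have f: "?f \<noteq> 0"
  proof
    assume "?f = 0"
    from fun_cong[OF fun_cong[OF this], of 0 0] m l show False by simp
  qed
  have one: "const_one ?P \<noteq> 0"
  proof
    assume "const_one ?P = 0"
    from fun_cong[OF fun_cong[OF this], of 0 0] m l show False by (simp add: const_one_def)
  qed
  have "1 \<le> multiplicity_of ?P ((pi / l)\<^sup>2)"
    using card_le_multiplicity[OF P _ _, of "(pi / l)\<^sup>2" "{?f}"] f pumpkin_cosine_eigenfunction[OF l, of m] by simp
  moreover have "1 \<le> multiplicity_of ?P 0"
    using card_le_multiplicity[OF P _ _, of 0 "{const_one ?P}"] one const_one_eigenspace[OF P] by simp
  moreover have "(pi / l)\<^sup>2 \<noteq> 0" using l by simp
  ultimately have "2 \<le> (\<Sum>\<mu>\<in>{0, (pi / l)\<^sup>2}. multiplicity_of ?P \<mu>)" by simp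
  then have "(pi / l)\<^sup>2 \<in> {c. \<exists>M. finite M \<and> M \<subseteq> {..c} \<and> 2 \<le> (\<Sum>\<mu>\<in>M. multiplicity_of ?P \<mu>)}"
    by (intro CollectI exI[of _ "{0, (pi / l)\<^sup>2}"]) auto
  then show "{c. \<exists>M. finite M \<and> M \<subseteq> {..c} \<and> 2 \<le> (\<Sum>\<mu>\<in>M. multiplicity_of ?P \<mu>)} \<noteq> {}" by blast
  fix c assume "c \<in> {c. \<exists>M. finite M \<and> M \<subseteq> {..c} \<and> 2 \<le> (\<Sum>\<mu>\<in>M. multiplicity_of ?P \<mu>)}"
  then obtain M where M: "finite M" "M \<subseteq> {..c}" "2 \<le> (\<Sum>\<mu>\<in>M. multiplicity_of ?P \<mu>)" by blast
  show "(pi / l)\<^sup>2 \<le> c"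
  proof (rule ccontr)
    assume c: "\<not> (pi / l)\<^sup>2 \<le> c"
    have "multiplicity_of ?P \<mu> \<le> (if \<mu> = 0 then 1 else 0)" if "\<mu> \<in> M" for \<mu>
    proof -
      have "\<mu> < (pi / l)\<^sup>2" using that M(2) c by auto
      then show ?thesis
        using pumpkin_multiplicity_0[OF m l] pumpkin_no_eigenvalue[OF m l, of \<mu>] multiplicity_negative[OF P, of \<mu>]
        by (cases "\<mu> = 0"; cases "\<mu> < 0") auto
    qed
    then have "(\<Sum>\<mu>\<in>M. multiplicity_of ?P \<mu>) \<le> (\<Sum>\<mu>\<in>M. if \<mu> = 0 then 1 else 0)" by (rule sum_mono)
    also have "\<dots> \<le> 1" using M(1) by simp
    finally show False using M(3) by simp
  qed
qed

theorem corollary1p4: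
  fixes G :: "('v, 'e) mgraph" and Gh :: "('w, 'f) mgraph" and W :: "'w set" and s :: real
  assumes "compact_metric_graph G" and "connected_graph G"
    and "compact_metric_graph Gh" and "connected_graph Gh"
    and "W \<subseteq> verts Gh"
    and "same_metric_graph G (double_graph Gh W)"
    and "s = girth G"
  shows "let bound = (if s = 0 then \<infinity> else ereal (4 * pi\<^sup>2 / s\<^sup>2)) in
    ereal (eigenvalue G 2) \<le> bound \<and>
    (\<forall>m l. m \<ge> 2 \<and> l > 0 \<and> same_metric_graph G (equilateral_pumpkin m l) \<longrightarrow>
       ereal (eigenvalue G 2) = bound)"
proof -
  have upper: "eigenvalue G 2 \<le> 4 * pi\<^sup>2 / s\<^sup>2" if "s \<noteq> 0"
    using eigenvalue_2_le_girth[OF assms(1,3,6)] that assms(7) by simp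
  have "s \<noteq> 0 \<and> eigenvalue G 2 = 4 * pi\<^sup>2 / s\<^sup>2"
    if ml: "m \<ge> 2" "l > 0" and same: "same_metric_graph G (equilateral_pumpkin m l)" for m l
  proof -
    have s: "s = 2 * l" using girth_pumpkin[OF assms(1) ml same] assms(7) by simp
    obtain K :: "(nat, nat) mgraph" where K: "dummy_refinement G K" "dummy_refinement (equilateral_pumpkin m l) K"
      using same by (auto simp: same_metric_graph_def)
    have "(pi / l)\<^sup>2 \<le> eigenvalue G 2"
      using eigenvalue_2_pumpkin_ge[OF ml] eigenvalue_same_metric_graph[OF assms(1) K(1) compact_pumpkin[OF ml(2)] K(2)] by simp
    moreover have "4 * pi\<^sup>2 / s\<^sup>2 = (pi / l)\<^sup>2" by (simp add: s power_divide power_mult_distrib)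
    ultimately show ?thesis using upper s ml by simp
  qed
  with upper show ?thesis by (auto simp: Let_def)
qed

end
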